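(* Let $(M,g)$ be a connected compact oriented Riemannian $4$-manifold and let $J_0,J_1$ be two positive $g$-orthogonal almost complex structures on $M$ such that $J_0$ is Kähler and $J_1$ is almost Kähler. Then the angle $\theta$ between $J_0$ and $J_1$ is constant. Thus, if $\cos\theta\ne\pm1$, $J_0$ and $J_1$ are homotopic and define a hyper-Kähler structure on $M$.
   Context: A $g$-orthogonal almost complex structure $J$ is positive if it induces the orientation of $M$; $\omega_J(X,Y)=g(JX,Y)$; $J$ is almost Kähler if $d\omega_J=0$ and Kähler if $\nabla\omega_J=0$ ($\nabla$ Levi-Civita). The angle $\theta:M\to[0,\pi]$ is given by $\cos\theta=\frac14\langle J_0,J_1\rangle$ (Hilbert–Schmidt inner product of endomorphisms). Homotopic means joined by a continuous family of positive $g$-orthogonal almost complex structures. "$J_0$ and $J_1$ define a hyper-Kähler structure" means: with $J_1'=(J_1-\cos\theta J_0)/\sin\theta$ (Gram–Schmidt orthonormalization), $(J_0,J_1',J_0J_1')$ is a hyper-Kähler structure on $(M,g)$, i.e. three anti-commuting $g$-orthogonal almost complex structures, all Kähler. *)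

theory Defs
  imports "HOL-Analysis.Analysis"
begin

section \<open>Smooth manifolds\<close>

text \<open>Meaningful for open \<open>S\<close>.\<close>

primrec Ck_on :: "nat \<Rightarrow> 'a::real_normed_vector set \<Rightarrow> ('a \<Rightarrow> 'b::real_normed_vector) \<Rightarrow> bool" where
  "Ck_on 0 S f \<longleftrightarrow> continuous_on S f"
| "Ck_on (Suc k) S f \<longleftrightarrow>
    (\<forall>x\<in>S. f differentiable (at x)) \<and> (\<forall>v. Ck_on k S (\<lambda>x. frechet_derivative f (at x) v))"

definition smooth_on :: "'a::real_normed_vector set \<Rightarrow> ('a \<Rightarrow> 'b::real_normed_vector) \<Rightarrow> bool" where
  "smooth_on S f \<longleftrightarrow> (\<forall>k. Ck_on k S f)"

text \<open>A chart is its domain together with its coordinate map; the values of the coordinate map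
  outside the domain are irrelevant.\<close>

type_synonym ('m, 'n) chart = "'m set \<times> ('m \<Rightarrow> real^'n)"

definition chart_inv :: "('m, 'n) chart \<Rightarrow> real^'n \<Rightarrow> 'm" where
  "chart_inv c = inv_into (fst c) (snd c)"

definition is_chart :: "('m::topological_space, 'n::finite) chart \<Rightarrow> bool" where
  "is_chart c \<longleftrightarrow> open (fst c) \<and> open (snd c ` fst c) \<and>
    homeomorphism (fst c) (snd c ` fst c) (snd c) (chart_inv c)"

text \<open>The whole type \<open>'m\<close> is the manifold; second countability and the Hausdorff property are
  supplied by its type class.\<close>

definition smooth_atlas ::
    "('m::{t2_space,second_countable_topology}, 'n::finite) chart set \<Rightarrow> bool" where
  "smooth_atlas A \<longleftrightarrow> (\<forall>c\<in>A. is_chart c) \<and> (\<Union>c\<in>A. fst c) = UNIV \<and>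
    (\<forall>c\<in>A. \<forall>c'\<in>A. smooth_on (snd c ` (fst c \<inter> fst c')) (snd c' \<circ> chart_inv c))"

text \<open>The Jacobian matrix at \<open>p\<close> of the transition map from \<open>c\<close> to \<open>c'\<close>.\<close>

definition transition_jac :: "('m, 'n::finite) chart \<Rightarrow> ('m, 'n) chart \<Rightarrow> 'm \<Rightarrow> real^'n^'n" where
  "transition_jac c c' p = jacobian (snd c' \<circ> chart_inv c) (at (snd c p))"

text \<open>An oriented manifold is given by an atlas of positively oriented charts.\<close>

definition oriented_atlas ::
    "('m::{t2_space,second_countable_topology}, 'n::finite) chart set \<Rightarrow> bool" where
  "oriented_atlas A \<longleftrightarrow> smooth_atlas A \<and>
    (\<forall>c\<in>A. \<forall>c'\<in>A. \<forall>p \<in> fst c \<inter> fst c'. 0 < det (transition_jac c c' p))"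

definition smooth_in_chart :: "('m, 'n::finite) chart \<Rightarrow> ('m \<Rightarrow> 'b::real_normed_vector) \<Rightarrow> bool" where
  "smooth_in_chart c f \<longleftrightarrow> smooth_on (snd c ` fst c) (f \<circ> chart_inv c)"

text \<open>\<open>pd c i f p\<close> is \<open>\<partial>f/\<partial>x\<^sup>i\<close> at \<open>p\<close> in the coordinates of \<open>c\<close>.\<close>

definition pd :: "('m, 'n::finite) chart \<Rightarrow> 'n \<Rightarrow> ('m \<Rightarrow> real) \<Rightarrow> 'm \<Rightarrow> real" where
  "pd c i f p = frechet_derivative (f \<circ> chart_inv c) (at (snd c p)) (axis i 1)"

section \<open>Tensor fields\<close>

text \<open>A tensor field with two indices assigns to every chart \<open>c\<close> and every point \<open>p\<close> of its domain
  the matrix of its components in the coordinate frame \<open>\<partial>\<^sub>1, \<dots>, \<partial>\<^sub>n\<close> of \<open>c\<close> at \<open>p\<close>; only charts of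
  the atlas and points of their domains matter. A tangent vector is identified with the column of
  its components, so an endomorphism \<open>J\<close> acts by \<open>J *v X\<close>, and a bilinear form \<open>b\<close> has
  \<open>b(X,Y) = X \<bullet> (b *v Y)\<close>, i.e. \<open>b $ i $ j = b(\<partial>\<^sub>i,\<partial>\<^sub>j)\<close>. The last conjuncts below are the
  transformation laws.\<close>

type_synonym ('m, 'n) tensor2 = "('m, 'n) chart \<Rightarrow> 'm \<Rightarrow> real^'n^'n"

definition endomorphism_field :: "('m, 'n::finite) chart set \<Rightarrow> ('m, 'n) tensor2 \<Rightarrow> bool" where
  "endomorphism_field A J \<longleftrightarrow> (\<forall>c\<in>A. smooth_in_chart c (J c)) \<and>
    (\<forall>c\<in>A. \<forall>c'\<in>A. \<forall>p \<in> fst c \<inter> fst c'. J c' p ** transition_jac c c' p = transition_jac c c' p ** J c p)"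

definition bilinear_field :: "('m, 'n::finite) chart set \<Rightarrow> ('m, 'n) tensor2 \<Rightarrow> bool" where
  "bilinear_field A b \<longleftrightarrow> (\<forall>c\<in>A. smooth_in_chart c (b c)) \<and>
    (\<forall>c\<in>A. \<forall>c'\<in>A. \<forall>p \<in> fst c \<inter> fst c'.
      transpose (transition_jac c c' p) ** b c' p ** transition_jac c c' p = b c p)"

definition riemannian_metric :: "('m, 'n::finite) chart set \<Rightarrow> ('m, 'n) tensor2 \<Rightarrow> bool" where
  "riemannian_metric A g \<longleftrightarrow> bilinear_field A g \<and>
    (\<forall>c\<in>A. \<forall>p\<in>fst c. transpose (g c p) = g c p \<and> (\<forall>X. X \<noteq> 0 \<longrightarrow> 0 < X \<bullet> (g c p *v X)))"

section \<open>The Levi-Civita connection\<close>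

text \<open>\<open>christoffel g c p k i j\<close> is \<open>\<Gamma>\<^sup>k\<^sub>i\<^sub>j\<close>, the component along \<open>\<partial>\<^sub>k\<close> of \<open>\<nabla>\<close> of \<open>\<partial>\<^sub>j\<close> in the
  direction \<open>\<partial>\<^sub>i\<close>. That these symbols are characterized by symmetry and metric compatibility
  is proved in \<open>christoffel_levi_civita\<close>.\<close>

definition christoffel ::
    "('m, 'n::finite) tensor2 \<Rightarrow> ('m, 'n) chart \<Rightarrow> 'm \<Rightarrow> 'n \<Rightarrow> 'n \<Rightarrow> 'n \<Rightarrow> real" where
  "christoffel g c p k i j = 1/2 * (\<Sum>l\<in>UNIV. matrix_inv (g c p) $ k $ l *
    (pd c i (\<lambda>q. g c q $ j $ l) p + pd c j (\<lambda>q. g c q $ i $ l) p - pd c l (\<lambda>q. g c q $ i $ j) p))"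

text \<open>\<open>(\<nabla>\<^sub>i b)\<^sub>j\<^sub>k\<close> for a bilinear form \<open>b\<close>.\<close>

definition covariant_derivative ::
    "('m, 'n::finite) tensor2 \<Rightarrow> ('m, 'n) tensor2 \<Rightarrow> ('m, 'n) chart \<Rightarrow> 'm \<Rightarrow> 'n \<Rightarrow> 'n \<Rightarrow> 'n \<Rightarrow> real" where
  "covariant_derivative g b c p i j k = pd c i (\<lambda>q. b c q $ j $ k) p
    - (\<Sum>l\<in>UNIV. christoffel g c p l i j * b c p $ l $ k)
    - (\<Sum>l\<in>UNIV. christoffel g c p l i k * b c p $ j $ l)"

text \<open>\<open>(db)\<^sub>i\<^sub>j\<^sub>k\<close> for a 2-form \<open>b\<close>, i.e. a skew-symmetric bilinear form.\<close>

definition exterior_derivative ::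
    "('m, 'n::finite) tensor2 \<Rightarrow> ('m, 'n) chart \<Rightarrow> 'm \<Rightarrow> 'n \<Rightarrow> 'n \<Rightarrow> 'n \<Rightarrow> real" where
  "exterior_derivative b c p i j k = pd c i (\<lambda>q. b c q $ j $ k) p
    + pd c j (\<lambda>q. b c q $ k $ i) p + pd c k (\<lambda>q. b c q $ i $ j) p"

lemma matrix_inv_mult:
  fixes B :: "real^'n^'n"
  assumes "invertible B"
  shows "matrix_inv B ** B = mat 1" "B ** matrix_inv B = mat 1"
  using assms someI_ex[of "\<lambda>B'. B ** B' = mat 1 \<and> B' ** B = mat 1"]
  unfolding invertible_def matrix_inv_def by blast+

lemma riemannian_metric_invertible:
  assumes "riemannian_metric A g" "c \<in> A" "p \<in> fst c"
  shows "invertible (g c p)"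
proof -
  have "X = 0" if "g c p *v X = 0" for X
    using assms that unfolding riemannian_metric_def
    by (metis inner_zero_right less_irrefl)
  then show ?thesis
    by (metis invertible_left_inverse matrix_left_invertible_ker)
qed

lemma pd_cong:
  assumes "is_chart c" "p \<in> fst c" "\<And>q. q \<in> fst c \<Longrightarrow> f q = h q"
  shows "pd c i f p = pd c i h p"
proof -
  have op: "open (snd c ` fst c)" using assms by (simp add: is_chart_def)
  have eq: "(f \<circ> chart_inv c) x = (h \<circ> chart_inv c) x" if "x \<in> snd c ` fst c" for x
    using that assms(3) by (auto simp: chart_inv_def inv_into_into)
  have "((f \<circ> chart_inv c) has_derivative D) (at (snd c p)) \<longleftrightarrow>
      ((h \<circ> chart_inv c) has_derivative D) (at (snd c p))" for D
    using has_derivative_transform_within_open[OF _ op] eq assms(2)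
    by (metis (no_types, lifting) image_eqI)
  then show ?thesis
    unfolding pd_def frechet_derivative_def by simp
qed

text \<open>The Levi-Civita connection is the unique connection which is torsion-free
  (\<open>\<Gamma>\<^sup>k\<^sub>i\<^sub>j = \<Gamma>\<^sup>k\<^sub>j\<^sub>i\<close>) and metric (\<open>\<partial>\<^sub>i g\<^sub>j\<^sub>k = \<Gamma>\<^sup>l\<^sub>i\<^sub>j g\<^sub>l\<^sub>k + \<Gamma>\<^sup>l\<^sub>i\<^sub>k g\<^sub>j\<^sub>l\<close>).\<close>

lemma christoffel_levi_civita:
  fixes A :: "('m::{t2_space,second_countable_topology}, 'n::finite) chart set"
  assumes "smooth_atlas A" and g: "riemannian_metric A g" "c \<in> A" "p \<in> fst c"
  shows "(\<forall>k i j. G k i j = christoffel g c p k i j) \<longleftrightarrow>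
    (\<forall>k i j. G k i j = G k j i) \<and>
    (\<forall>i j k. pd c i (\<lambda>q. g c q $ j $ k) p =
      (\<Sum>l\<in>UNIV. G l i j * g c p $ l $ k) + (\<Sum>l\<in>UNIV. G l i k * g c p $ j $ l))"
proof -
  define d where "d i j k = pd c i (\<lambda>q. g c q $ j $ k) p" for i j k
  define h where "h = matrix_inv (g c p)"
  define L where "L m i j = (\<Sum>l\<in>UNIV. g c p $ m $ l * G l i j)" for m i j
  have ch: "is_chart c" using assms by (auto simp: smooth_atlas_def)
  have sym: "g c q $ j $ k = g c q $ k $ j" if "q \<in> fst c" for q j k
  proof -
    have "transpose (g c q) $ j $ k = g c q $ j $ k"
      using g that by (simp add: riemannian_metric_def)
    then show ?thesis by (simp add: transpose_def)
  qed
  have dsym: "d i j k = d i k j" for i j k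
    unfolding d_def by (rule pd_cong[OF ch g(3)]) (rule sym)
  have inv: "h ** g c p = mat 1" "g c p ** h = mat 1"
    using matrix_inv_mult[OF riemannian_metric_invertible[OF g]] by (auto simp: h_def)
  have hL: "(\<forall>k. x k = (\<Sum>l\<in>UNIV. h $ k $ l * y l)) \<longleftrightarrow> (\<forall>m. (\<Sum>l\<in>UNIV. g c p $ m $ l * x l) = y m)"
    for x y
  proof -
    have "(\<chi> k. x k) = h *v (\<chi> k. y k) \<longleftrightarrow> g c p *v (\<chi> k. x k) = (\<chi> k. y k)"
      (is "?x = h *v ?y \<longleftrightarrow> _")
    proof
      assume "?x = h *v ?y"
      then show "g c p *v ?x = ?y" by (simp add: matrix_vector_mul_assoc inv)
    next
      assume "g c p *v ?x = ?y"
      then have "h *v (g c p *v ?x) = h *v ?y" by simp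
      then show "?x = h *v ?y" by (simp add: matrix_vector_mul_assoc inv)
    qed
    then show ?thesis by (simp add: matrix_vector_mult_def vec_eq_iff)
  qed
  have chr: "christoffel g c p k i j = (\<Sum>l\<in>UNIV. h $ k $ l * (1/2 * (d i j l + d j i l - d l i j)))"
    for k i j
    by (simp add: christoffel_def h_def d_def sum_distrib_left mult.left_commute)
  have "(\<forall>k i j. G k i j = christoffel g c p k i j) \<longleftrightarrow>
      (\<forall>i j. \<forall>k. G k i j = (\<Sum>l\<in>UNIV. h $ k $ l * (1/2 * (d i j l + d j i l - d l i j))))"
    unfolding chr by blast
  also have "\<dots> \<longleftrightarrow> (\<forall>i j m. L m i j = 1/2 * (d i j m + d j i m - d m i j))"
    unfolding hL L_def ..
  finally have 1: "(\<forall>k i j. G k i j = christoffel g c p k i j) \<longleftrightarrow>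
    (\<forall>i j m. L m i j = 1/2 * (d i j m + d j i m - d m i j))" .
  have Gh: "\<forall>k. G k i j = (\<Sum>l\<in>UNIV. h $ k $ l * L l i j)" for i j
    unfolding hL by (simp add: L_def)
  have s: "(\<forall>k i j. G k i j = G k j i) \<longleftrightarrow> (\<forall>m i j. L m i j = L m j i)"
  proof (intro iffI allI)
    fix m i j assume "\<forall>k i j. G k i j = G k j i"
    then have "G l i j = G l j i" for l by blast
    then show "L m i j = L m j i" unfolding L_def by (intro sum.cong refl) simp
  next
    fix k i j assume "\<forall>m i j. L m i j = L m j i"
    then have "L l i j = L l j i" for l by blast
    then have "(\<Sum>l\<in>UNIV. h $ k $ l * L l i j) = (\<Sum>l\<in>UNIV. h $ k $ l * L l j i)"
      by (intro sum.cong refl) simp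
    then show "G k i j = G k j i" using Gh[of i j] Gh[of j i] by (metis (no_types, lifting))
  qed
  have m1: "(\<Sum>l\<in>UNIV. G l i j * g c p $ l $ k) = L k i j" for i j k
    unfolding L_def by (simp add: sym[OF g(3), of k] mult.commute)
  have m2: "(\<Sum>l\<in>UNIV. G l i k * g c p $ j $ l) = L j i k" for i j k
    unfolding L_def by (simp add: mult.commute)
  have "(\<forall>i j m. L m i j = 1/2 * (d i j m + d j i m - d m i j)) \<longleftrightarrow>
    (\<forall>m i j. L m i j = L m j i) \<and> (\<forall>i j k. d i j k = L k i j + L j i k)" (is "?l \<longleftrightarrow> ?r")
  proof
    assume l: ?l
    have "L m i j = L m j i" for m i j 
      unfolding l[rule_format] dsym[of m i j] by (simp add: add.commute)
    moreover have "d i j k = L k i j + L j i k" for i j k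
      unfolding l[rule_format] using dsym[of i j k] by (simp add: algebra_simps)
    ultimately show ?r by blast
  next
    assume r: ?r
    then have r1: "L m i j = L m j i" and r2: "d i j k = L k i j + L j i k" for m i j k by blast+
    show ?l
    proof (intro allI)
      fix i j m
      show "L m i j = 1/2 * (d i j m + d j i m - d m i j)"
        unfolding r2 r1[of m j i] r1[of j m i] r1[of i m j] by simp
    qed
  qed
  then show ?thesis unfolding 1 s m1 m2 d_def .
qed

section \<open>Almost Hermitian structures\<close>

definition orthogonal_acs ::
    "('m, 'n::finite) chart set \<Rightarrow> ('m, 'n) tensor2 \<Rightarrow> ('m, 'n) tensor2 \<Rightarrow> bool" where
  "orthogonal_acs A g J \<longleftrightarrow> endomorphism_field A J \<and>
    (\<forall>c\<in>A. \<forall>p\<in>fst c. J c p ** J c p = - mat 1 \<and>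
      (\<forall>X Y. (J c p *v X) \<bullet> (g c p *v (J c p *v Y)) = X \<bullet> (g c p *v Y)))"

text \<open>On an oriented 4-manifold, \<open>J\<close> induces the orientation if every frame of the form
  \<open>X, JX, Y, JY\<close> is positively oriented.\<close>

definition positive_acs :: "('m, 4) chart set \<Rightarrow> ('m, 4) tensor2 \<Rightarrow> bool" where
  "positive_acs A J \<longleftrightarrow> (\<forall>c\<in>A. \<forall>p\<in>fst c. \<forall>X Y.
    let F = (vector [X, J c p *v X, Y, J c p *v Y] :: real^4^4) in det F \<noteq> 0 \<longrightarrow> det F > 0)"

text \<open>\<open>\<omega>\<^sub>J(X,Y) = g(JX,Y)\<close>.\<close>

definition kahler_form :: "('m, 'n::finite) tensor2 \<Rightarrow> ('m, 'n) tensor2 \<Rightarrow> ('m, 'n) tensor2" where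
  "kahler_form g J c p = transpose (J c p) ** g c p"

definition almost_kahler ::
    "('m, 'n::finite) chart set \<Rightarrow> ('m, 'n) tensor2 \<Rightarrow> ('m, 'n) tensor2 \<Rightarrow> bool" where
  "almost_kahler A g J \<longleftrightarrow>
    (\<forall>c\<in>A. \<forall>p\<in>fst c. \<forall>i j k. exterior_derivative (kahler_form g J) c p i j k = 0)"

definition kahler ::
    "('m, 'n::finite) chart set \<Rightarrow> ('m, 'n) tensor2 \<Rightarrow> ('m, 'n) tensor2 \<Rightarrow> bool" where
  "kahler A g J \<longleftrightarrow>
    (\<forall>c\<in>A. \<forall>p\<in>fst c. \<forall>i j k. covariant_derivative g (kahler_form g J) c p i j k = 0)"

text \<open>The Hilbert-Schmidt inner product \<open>tr(P\<^sup>* Q)\<close>, with \<open>P\<^sup>*\<close> the adjoint with respect to the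
  inner product with Gram matrix \<open>G\<close>.\<close>

definition hilbert_schmidt :: "real^'n^'n \<Rightarrow> real^'n^'n \<Rightarrow> real^'n^'n \<Rightarrow> real" where
  "hilbert_schmidt G P Q = trace ((matrix_inv G ** transpose P ** G) ** Q)"

text \<open>The choice of the chart is immaterial, see \<open>hilbert_schmidt_chart_indep\<close>.\<close>

definition angle ::
    "('m, 4) chart set \<Rightarrow> ('m, 4) tensor2 \<Rightarrow> ('m, 4) tensor2 \<Rightarrow> ('m, 4) tensor2 \<Rightarrow> 'm \<Rightarrow> real"
  where
  "angle A g J\<^sub>0 J\<^sub>1 p = (let c = (SOME c. c \<in> A \<and> p \<in> fst c)
    in arccos (1/4 * hilbert_schmidt (g c p) (J\<^sub>0 c p) (J\<^sub>1 c p)))"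

lemma hilbert_schmidt_conj:
  fixes B :: "real^'n^'n"
  assumes "invertible B" "invertible G" "invertible G'"
    and G: "transpose B ** G' ** B = G" and P: "P' ** B = B ** P" and Q: "Q' ** B = B ** Q"
  shows "hilbert_schmidt G P Q = hilbert_schmidt G' P' Q'"
proof -
  define C where "C = matrix_inv B"
  have C: "C ** B = mat 1" "B ** C = mat 1"
    using matrix_inv_mult[OF assms(1)] by (auto simp: C_def)
  have Ct: "transpose B ** transpose C = mat 1" "transpose C ** transpose B = mat 1"
    by (simp_all add: C matrix_transpose_mul[symmetric] transpose_mat)
  have G': "matrix_inv G' ** G' = mat 1" "G' ** matrix_inv G' = mat 1"
    using matrix_inv_mult[OF assms(3)] by auto
  have Pe: "P = C ** P' ** B" and Qe: "Q = C ** Q' ** B"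
    using P Q C by (simp_all add: matrix_mul_assoc[symmetric]) (simp_all add: matrix_mul_assoc)
  have iG: "matrix_inv G = C ** matrix_inv G' ** transpose C"
  proof -
    have "(C ** matrix_inv G' ** transpose C) ** G =
        C ** (matrix_inv G' ** ((transpose C ** transpose B) ** G')) ** B"
      unfolding G[symmetric] by (simp add: matrix_mul_assoc)
    also have "\<dots> = mat 1" using C G' Ct by simp
    finally have "(C ** matrix_inv G' ** transpose C) ** G = mat 1" .
    then have "(C ** matrix_inv G' ** transpose C) ** (G ** matrix_inv G) = matrix_inv G"
      by (simp add: matrix_mul_assoc)
    then show ?thesis
      using matrix_inv_mult[OF assms(2)] by simp
  qed
  have "matrix_inv G ** transpose P ** G ** Q =
     C ** matrix_inv G' ** (transpose C ** transpose B) ** transpose P' **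
       (transpose C ** transpose B) ** G' ** (B ** C) ** Q' ** B"
    unfolding iG unfolding G[symmetric] Pe Qe by (simp add: matrix_transpose_mul matrix_mul_assoc)
  also have "\<dots> = C ** (matrix_inv G' ** transpose P' ** G' ** Q' ** B)"
    by (simp add: C Ct matrix_mul_assoc)
  finally have "hilbert_schmidt G P Q = trace ((matrix_inv G' ** transpose P' ** G' ** Q' ** B) ** C)"
    unfolding hilbert_schmidt_def by (subst trace_mul_sym) simp
  also have "\<dots> = hilbert_schmidt G' P' Q'"
    unfolding hilbert_schmidt_def by (simp add: matrix_mul_assoc[symmetric] C)
  finally show ?thesis .
qed

lemma hilbert_schmidt_chart_indep:
  assumes "oriented_atlas A" "riemannian_metric A g" "endomorphism_field A P" "endomorphism_field A Q"
    and c: "c \<in> A" "c' \<in> A" "p \<in> fst c" "p \<in> fst c'"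
  shows "hilbert_schmidt (g c p) (P c p) (Q c p) = hilbert_schmidt (g c' p) (P c' p) (Q c' p)"
proof (rule hilbert_schmidt_conj)
  show "invertible (transition_jac c c' p)"
    unfolding invertible_det_nz using assms(1) c unfolding oriented_atlas_def by (metis IntI less_irrefl)
  show "invertible (g c p)" "invertible (g c' p)"
    using riemannian_metric_invertible[OF assms(2)] c by auto
  show "transpose (transition_jac c c' p) ** g c' p ** transition_jac c c' p = g c p"
    using assms(2) c unfolding riemannian_metric_def bilinear_field_def by blast
  show "P c' p ** transition_jac c c' p = transition_jac c c' p ** P c p"
    using assms(3) c unfolding endomorphism_field_def by blast
  show "Q c' p ** transition_jac c c' p = transition_jac c c' p ** Q c p"
    using assms(4) c unfolding endomorphism_field_def by blast
qed

definition homotopic_acs ::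
    "('m::{t2_space,second_countable_topology}, 4) chart set \<Rightarrow> ('m, 4) tensor2 \<Rightarrow>
      ('m, 4) tensor2 \<Rightarrow> ('m, 4) tensor2 \<Rightarrow> bool" where
  "homotopic_acs A g J\<^sub>0 J\<^sub>1 \<longleftrightarrow> (\<exists>J :: real \<Rightarrow> ('m, 4) tensor2.
    (\<forall>s\<in>{0..1}. orthogonal_acs A g (J s) \<and> positive_acs A (J s)) \<and>
    (\<forall>c\<in>A. continuous_on ({0..1} \<times> fst c) (\<lambda>(s, p). J s c p)) \<and>
    (\<forall>c\<in>A. \<forall>p\<in>fst c. J 0 c p = J\<^sub>0 c p \<and> J 1 c p = J\<^sub>1 c p))"

definition anticommuting ::
    "('m, 'n::finite) chart set \<Rightarrow> ('m, 'n) tensor2 \<Rightarrow> ('m, 'n) tensor2 \<Rightarrow> bool" where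
  "anticommuting A I J \<longleftrightarrow> (\<forall>c\<in>A. \<forall>p\<in>fst c. I c p ** J c p = - (J c p ** I c p))"

definition hyper_kahler ::
    "('m, 'n::finite) chart set \<Rightarrow> ('m, 'n) tensor2 \<Rightarrow> ('m, 'n) tensor2 \<Rightarrow> ('m, 'n) tensor2 \<Rightarrow>
      ('m, 'n) tensor2 \<Rightarrow> bool" where
  "hyper_kahler A g I J K \<longleftrightarrow>
    orthogonal_acs A g I \<and> orthogonal_acs A g J \<and> orthogonal_acs A g K \<and>
    anticommuting A I J \<and> anticommuting A I K \<and> anticommuting A J K \<and>
    kahler A g I \<and> kahler A g J \<and> kahler A g K"

definition orthonormalized ::
    "('m, 4) chart set \<Rightarrow> ('m, 4) tensor2 \<Rightarrow> ('m, 4) tensor2 \<Rightarrow> ('m, 4) tensor2 \<Rightarrow>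
      ('m, 4) tensor2" where
  "orthonormalized A g J\<^sub>0 J\<^sub>1 c p =
    (1 / sin (angle A g J\<^sub>0 J\<^sub>1 p)) *\<^sub>R (J\<^sub>1 c p - cos (angle A g J\<^sub>0 J\<^sub>1 p) *\<^sub>R J\<^sub>0 c p)"

definition define_hyper_kahler ::
    "('m, 4) chart set \<Rightarrow> ('m, 4) tensor2 \<Rightarrow> ('m, 4) tensor2 \<Rightarrow> ('m, 4) tensor2 \<Rightarrow> bool" where
  "define_hyper_kahler A g J\<^sub>0 J\<^sub>1 \<longleftrightarrow> (let J\<^sub>1' = orthonormalized A g J\<^sub>0 J\<^sub>1
    in hyper_kahler A g J\<^sub>0 J\<^sub>1' (\<lambda>c p. J\<^sub>0 c p ** J\<^sub>1' c p))"

end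

theory Submission
  imports Defs
begin

text \<open>
  Put \<open>f = cos \<theta> = - tr (J\<^sub>0 J\<^sub>1) / 4\<close>. Positivity means that \<open>J\<^sub>0\<close> and \<open>J\<^sub>1\<close> are self-dual, so
  \<open>J\<^sub>0 J\<^sub>1 + J\<^sub>1 J\<^sub>0 = - 2 f\<close> and \<open>P = J\<^sub>0 J\<^sub>1 + f\<close> is skew. Since \<open>\<nabla>J\<^sub>0 = 0\<close>, contracting \<open>d\<omega>\<^sub>1 = 0\<close>
  with \<open>\<omega>\<^sub>0\<close> shows that the divergence of the bivector \<open>P\<close> is \<open>- grad f\<close>. The double divergence of a
  bivector vanishes, hence \<open>f\<close> is harmonic and, by the strong maximum principle, constant.

  The volume density needed for divergences is the Pfaffian \<open>\<rho>\<close> of \<open>\<omega>\<^sub>0\<close>: the matrix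
  \<open>D = \<rho> g\<inverse>\<close> is then polynomial in the entries of \<open>\<omega>\<^sub>0\<close> and \<open>J\<^sub>0\<close>, and harmonicity reads
  \<open>\<partial>\<^sub>i (D\<^sup>i\<^sup>j \<partial>\<^sub>j f) = 0\<close>.

  Once \<open>f\<close> is constant and \<open>f\<^sup>2 < 1\<close>, the endomorphism \<open>\<nabla>\<^sub>X J\<^sub>1\<close> anticommutes with \<open>J\<^sub>0\<close> and \<open>J\<^sub>1\<close>, and
  together with \<open>d\<omega>\<^sub>1 = 0\<close> this forces it to vanish. The homotopy rotates \<open>J\<^sub>0\<close> to \<open>J\<^sub>1\<close> along a great
  circle with constant coefficients.
\<close>

section \<open>Smooth functions\<close>

text \<open>The maximum principle needs the equation for \<open>f\<close> only in charts;
  compactness enters through the existence of a maximum and connectedness through the spreading of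
  the maximum set, so nothing is integrated over the manifold. The bivector \<open>P\<close> is skew
  because the adjoint of J_0 J_1 is J_1 J_0 = - 2 f - J_0 J_1. Its divergence has two sources. As
  J_0 is parallel, tr(J_0 nabla_l J_1) = - 4 d_l f; closedness of omega_1 makes the divergence of
  J_0 J_1 half of this, - 2 d_l f, and the summand f id contributes + d_l f. Divergences in
  coordinates involve the square root of det g and the inverse of g. With the Pfaffian as density,
  smoothness of the coefficients follows from sums and products alone, without roots or matrix
  inverses. The Pfaffian also carries a sign: positivity becomes \<open>pf > 0\<close>, so all
  positive structures share the same Pfaffian, and polarizing the Pfaffian identity makes J_0 J_1 +
  J_1 J_0 a scalar.\<close>

lemma frechet_derivative_cong_open:
  assumes "open S" "x \<in> S" "\<And>y. y \<in> S \<Longrightarrow> f y = h y"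
  shows "frechet_derivative f (at x) = frechet_derivative h (at x)"
proof -
  have "(f has_derivative D) (at x) \<longleftrightarrow> (h has_derivative D) (at x)" for D
    using has_derivative_transform_within_open[OF _ assms(1,2)] assms(3) by metis
  then show ?thesis
    unfolding frechet_derivative_def by simp
qed

lemma differentiable_cong_open:
  assumes "f differentiable (at x)" "open S" "x \<in> S" "\<And>y. y \<in> S \<Longrightarrow> f y = h y"
  shows "h differentiable (at x)"
  using assms unfolding differentiable_def
  by (metis has_derivative_transform_within_open)

lemma has_derivative_frechet:
  "f differentiable (at x) \<Longrightarrow> (f has_derivative frechet_derivative f (at x)) (at x)"
  by (simp add: frechet_derivative_works)

lemma frechet_derivative_eqI:
  "(f has_derivative D) (at x) \<Longrightarrow> frechet_derivative f (at x) v = D v"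
  by (metis frechet_derivative_at)

lemma Ck_on_cong:
  assumes "open S" "\<And>x. x \<in> S \<Longrightarrow> f x = h x" "Ck_on k S f"
  shows "Ck_on k S h"
  using assms(2,3)
proof (induction k arbitrary: f h)
  case 0
  then show ?case by (simp cong: continuous_on_cong)
next
  case (Suc k)
  have "h differentiable (at x)" if "x \<in> S" for x
    using differentiable_cong_open[OF _ assms(1) that, of f h] Suc.prems that by auto
  moreover have "Ck_on k S (\<lambda>x. frechet_derivative h (at x) v)" for v
  proof (rule Suc.IH)
    show "frechet_derivative f (at x) v = frechet_derivative h (at x) v" if "x \<in> S" for x
      using frechet_derivative_cong_open[OF assms(1) that, of f h] Suc.prems by simp
  qed (use Suc.prems in auto)
  ultimately show ?case by simp
qed

lemma Ck_on_SucD: "Ck_on (Suc k) S f \<Longrightarrow> Ck_on k S f"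
proof (induction k arbitrary: f)
  case 0
  then show ?case
    by (auto simp: continuous_on_eq_continuous_within
        intro!: continuous_at_imp_continuous_within[OF differentiable_imp_continuous_within])
next
  case (Suc k)
  then show ?case by (metis Ck_on.simps(2))
qed

lemma Ck_on_add:
  assumes "open S" "Ck_on k S f" "Ck_on k S h"
  shows "Ck_on k S (\<lambda>x. f x + h x)"
  using assms(2,3)
proof (induction k arbitrary: f h)
  case 0
  then show ?case by (simp add: continuous_on_add)
next
  case (Suc k)
  have "Ck_on k S (\<lambda>x. frechet_derivative (\<lambda>x. f x + h x) (at x) v)" for v
  proof (rule Ck_on_cong[OF assms(1)])
    show "Ck_on k S (\<lambda>x. frechet_derivative f (at x) v + frechet_derivative h (at x) v)"
      using Suc by simp
    show "frechet_derivative f (at x) v + frechet_derivative h (at x) v =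
        frechet_derivative (\<lambda>x. f x + h x) (at x) v" if "x \<in> S" for x
      using that Suc.prems
      by (intro frechet_derivative_eqI[symmetric] has_derivative_add has_derivative_frechet) auto
  qed
  then show ?case using Suc.prems by simp
qed

lemma Ck_on_bounded_linear:
  assumes "open S" "bounded_linear L" "Ck_on k S f"
  shows "Ck_on k S (\<lambda>x. L (f x))"
  using assms(3)
proof (induction k arbitrary: f)
  case 0
  then show ?case using bounded_linear.continuous_on[OF assms(2)] by simp
next
  case (Suc k)
  have d: "((\<lambda>x. L (f x)) has_derivative (\<lambda>v. L (frechet_derivative f (at x) v))) (at x)"
    if "x \<in> S" for x
    using that Suc.prems by (intro bounded_linear.has_derivative[OF assms(2)] has_derivative_frechet) auto
  have "Ck_on k S (\<lambda>x. frechet_derivative (\<lambda>x. L (f x)) (at x) v)" for v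
  proof (rule Ck_on_cong[OF assms(1)])
    show "Ck_on k S (\<lambda>x. L (frechet_derivative f (at x) v))"
      using Suc by simp
  qed (use frechet_derivative_eqI[OF d] in simp)
  then show ?case using d by (auto simp: differentiable_def)
qed

text \<open>Each term of the product rule is again a value of \<open>B\<close>, with one factor
  differentiated and the other lowered from \<open>Suc k\<close> to \<open>k\<close>; hence the
  induction over arbitrary \<open>f\<close> and \<open>h\<close>. Matrix products and scalar
  multiples are instances.\<close>

lemma Ck_on_bounded_bilinear:
  assumes "open S" "bounded_bilinear B" "Ck_on k S f" "Ck_on k S h"
  shows "Ck_on k S (\<lambda>x. B (f x) (h x))"
  using assms(3,4)
proof (induction k arbitrary: f h)
  case 0
  then show ?case using bounded_bilinear.continuous_on[OF assms(2)] by simp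
next
  case (Suc k)
  have d: "((\<lambda>x. B (f x) (h x)) has_derivative
      (\<lambda>v. B (f x) (frechet_derivative h (at x) v) + B (frechet_derivative f (at x) v) (h x))) (at x)"
    if "x \<in> S" for x
    using that Suc.prems by (intro bounded_bilinear.FDERIV[OF assms(2)] has_derivative_frechet) auto
  have "Ck_on k S (\<lambda>x. frechet_derivative (\<lambda>x. B (f x) (h x)) (at x) v)" for v
  proof (rule Ck_on_cong[OF assms(1)])
    show "Ck_on k S (\<lambda>x. B (f x) (frechet_derivative h (at x) v) + B (frechet_derivative f (at x) v) (h x))"
      using Suc.prems by (intro Ck_on_add[OF assms(1)] Suc.IH) (auto intro: Ck_on_SucD)
  qed (use frechet_derivative_eqI[OF d] in simp)
  then show ?case using d by (auto simp: differentiable_def)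
qed

lemma Ck_on_const: "Ck_on k S (\<lambda>x. c)"
  by (induction k arbitrary: c) auto

lemma smooth_on_const: "smooth_on S (\<lambda>x. c)"
  by (simp add: smooth_on_def Ck_on_const)

lemma smooth_on_add:
  "open S \<Longrightarrow> smooth_on S f \<Longrightarrow> smooth_on S h \<Longrightarrow> smooth_on S (\<lambda>x. f x + h x)"
  by (simp add: smooth_on_def Ck_on_add)

lemma smooth_on_bounded_linear:
  "open S \<Longrightarrow> bounded_linear L \<Longrightarrow> smooth_on S f \<Longrightarrow> smooth_on S (\<lambda>x. L (f x))"
  by (simp add: smooth_on_def Ck_on_bounded_linear)

lemma smooth_on_bounded_bilinear:
  "open S \<Longrightarrow> bounded_bilinear B \<Longrightarrow> smooth_on S f \<Longrightarrow> smooth_on S h \<Longrightarrow> smooth_on S (\<lambda>x. B (f x) (h x))"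
  by (simp add: smooth_on_def Ck_on_bounded_bilinear)

lemma smooth_on_imp_continuous_on: "smooth_on S f \<Longrightarrow> continuous_on S f"
  unfolding smooth_on_def by (metis Ck_on.simps(1))

lemma smooth_on_imp_differentiable: "smooth_on S f \<Longrightarrow> x \<in> S \<Longrightarrow> f differentiable (at x)"
  unfolding smooth_on_def by (metis Ck_on.simps(2))

lemma smooth_on_frechet_derivative:
  "smooth_on S f \<Longrightarrow> smooth_on S (\<lambda>x. frechet_derivative f (at x) v)"
  unfolding smooth_on_def by (metis Ck_on.simps(2))

lemma bounded_bilinear_matrix_matrix_mult:
  "bounded_bilinear ((**) :: real^'n^'m \<Rightarrow> real^'p^'n \<Rightarrow> real^'p^'m)"
proof (subst bilinear_conv_bounded_bilinear[symmetric], unfold bilinear_def, intro conjI allI)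
  fix M :: "real^'n^'m" and N :: "real^'p^'n"
  show "linear (\<lambda>N :: real^'p^'n. M ** N)"
    by (intro linearI) (simp_all add: vec_eq_iff matrix_matrix_mult_def sum_distrib_left sum.distrib algebra_simps)
  show "linear (\<lambda>M :: real^'n^'m. M ** N)"
    by (intro linearI) (simp_all add: vec_eq_iff matrix_matrix_mult_def sum_distrib_left sum.distrib algebra_simps)
qed

lemma bounded_linear_transpose: "bounded_linear (transpose :: real^'n^'m \<Rightarrow> real^'m^'n)"
  by (intro linear_conv_bounded_linear[THEN iffD1] linearI) (simp_all add: vec_eq_iff transpose_def)

lemma bounded_linear_trace: "bounded_linear (trace :: real^'n^'n \<Rightarrow> real)"
  by (intro linear_conv_bounded_linear[THEN iffD1] linearI)
    (simp_all add: trace_def sum.distrib sum_distrib_left)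

lemma bounded_linear_matrix_nth: "bounded_linear (\<lambda>M :: real^'n^'m. M $ i $ j)"
  by (intro linear_conv_bounded_linear[THEN iffD1] linearI) simp_all

lemmas smooth_on_matrix_mult = smooth_on_bounded_bilinear[OF _ bounded_bilinear_matrix_matrix_mult]
lemmas smooth_on_transpose = smooth_on_bounded_linear[OF _ bounded_linear_transpose]
lemmas smooth_on_scaleR = smooth_on_bounded_bilinear[OF _ bounded_bilinear_scaleR]

section \<open>Symmetry of second derivatives\<close>

definition partial :: "'n::finite \<Rightarrow> (real^'n \<Rightarrow> 'b::real_normed_vector) \<Rightarrow> real^'n \<Rightarrow> 'b" where
  "partial i f x = frechet_derivative f (at x) (axis i 1)"

lemma has_real_derivative_line:
  fixes f :: "'a::real_normed_vector \<Rightarrow> real"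
  assumes "f differentiable (at (y + t *\<^sub>R v))"
  shows "((\<lambda>t. f (y + t *\<^sub>R v)) has_real_derivative frechet_derivative f (at (y + t *\<^sub>R v)) v) (at t)"
proof -
  let ?D = "frechet_derivative f (at (y + t *\<^sub>R v))"
  have f: "(f has_derivative ?D) (at (y + t *\<^sub>R v))"
    by (rule has_derivative_frechet[OF assms])
  have "((\<lambda>t. y + t *\<^sub>R v) has_derivative (\<lambda>s. s *\<^sub>R v)) (at t)"
    by (auto intro!: derivative_eq_intros)
  from diff_chain_at[OF this f] have "((\<lambda>t. f (y + t *\<^sub>R v)) has_derivative (\<lambda>s. ?D (s *\<^sub>R v))) (at t)"
    by (simp add: o_def)
  moreover have "?D (s *\<^sub>R v) = ?D v * s" for s
    using linear_frechet_derivative[OF assms] by (simp add: linear_cmul)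
  ultimately show ?thesis
    by (simp add: has_field_derivative_def mult_commute_abs)
qed

text \<open>The mean value theorem is applied twice: along \<open>v\<close> to the difference in
  direction \<open>w\<close>, which leaves a difference of first derivatives, and then along
  \<open>w\<close>. The left side is symmetric in \<open>v\<close> and \<open>w\<close>, the right
  side is not.\<close>

lemma second_difference:
  fixes f :: "'a::real_normed_vector \<Rightarrow> real"
  assumes "Ck_on 2 S f" "ball x d \<subseteq> S" and h: "h > 0" "h * (norm v + norm w) < d"
  shows "\<exists>p\<in>ball x d. f (x + h *\<^sub>R v + h *\<^sub>R w) - f (x + h *\<^sub>R v) - f (x + h *\<^sub>R w) + f x =
    h\<^sup>2 * frechet_derivative (\<lambda>y. frechet_derivative f (at y) v) (at p) w"
proof -
  have in_ball: "x + t *\<^sub>R v + s *\<^sub>R w \<in> ball x d" if "0 \<le> t" "t \<le> h" "0 \<le> s" "s \<le> h" for t s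
  proof -
    have "norm (t *\<^sub>R v + s *\<^sub>R w) \<le> t * norm v + s * norm w"
      using that norm_triangle_ineq[of "t *\<^sub>R v" "s *\<^sub>R w"] by simp
    also have "\<dots> \<le> h * (norm v + norm w)"
      using that by (simp add: distrib_left add_mono mult_right_mono)
    finally show ?thesis using h by (simp add: dist_norm add.assoc norm_minus_cancel[of "t *\<^sub>R v + s *\<^sub>R w", symmetric] del: norm_minus_cancel)
  qed
  have df: "f differentiable (at y)" "(\<lambda>y. frechet_derivative f (at y) v) differentiable (at y)"
    if "y \<in> ball x d" for y
    using that assms(1,2) by (auto simp: numeral_2_eq_2)
  define \<phi> where "\<phi> t = f (x + h *\<^sub>R w + t *\<^sub>R v) - f (x + t *\<^sub>R v)" for t
  have "(\<phi> has_real_derivative frechet_derivative f (at (x + h *\<^sub>R w + t *\<^sub>R v)) v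
      - frechet_derivative f (at (x + t *\<^sub>R v)) v) (at t)" if "0 \<le> t" "t \<le> h" for t
    unfolding \<phi>_def
    using in_ball[of t h] in_ball[of t 0] h that
    by (intro DERIV_diff has_real_derivative_line df) (auto simp: add_ac)
  from MVT2[OF h(1) this] obtain t where t: "0 < t" "t < h"
    and \<phi>: "\<phi> h - \<phi> 0 = h * (frechet_derivative f (at (x + h *\<^sub>R w + t *\<^sub>R v)) v
      - frechet_derivative f (at (x + t *\<^sub>R v)) v)" by auto
  define \<psi> where "\<psi> s = frechet_derivative f (at (x + t *\<^sub>R v + s *\<^sub>R w)) v" for s
  have "(\<psi> has_real_derivative
      frechet_derivative (\<lambda>y. frechet_derivative f (at y) v) (at (x + t *\<^sub>R v + s *\<^sub>R w)) w) (at s)"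
    if "0 \<le> s" "s \<le> h" for s
    unfolding \<psi>_def using in_ball[of t s] t that
    by (intro has_real_derivative_line df) auto
  from MVT2[OF h(1) this] obtain s where s: "0 < s" "s < h"
    and \<psi>: "\<psi> h - \<psi> 0 =
      h * frechet_derivative (\<lambda>y. frechet_derivative f (at y) v) (at (x + t *\<^sub>R v + s *\<^sub>R w)) w" by auto
  have "\<phi> h - \<phi> 0 = h * (\<psi> h - \<psi> 0)"
    unfolding \<phi> by (simp add: \<psi>_def add_ac)
  then show ?thesis
    using in_ball[of t s] t s unfolding \<psi>
    by (intro bexI[of _ "x + t *\<^sub>R v + s *\<^sub>R w"]) (simp_all add: \<phi>_def power2_eq_square add_ac)
qed

lemma second_derivative_symmetric:
  fixes f :: "'a::real_normed_vector \<Rightarrow> real"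
  assumes "open S" "x \<in> S" "Ck_on 2 S f"
  shows "frechet_derivative (\<lambda>y. frechet_derivative f (at y) v) (at x) w =
    frechet_derivative (\<lambda>y. frechet_derivative f (at y) w) (at x) v" (is "?F v w x = ?F w v x")
proof (rule ccontr)
  assume ne: "?F v w x \<noteq> ?F w v x"
  \<comment> \<open>Half the gap: moving each of the two values by less than \<open>e\<close> cannot
    make them meet.\<close>
  define e where "e = \<bar>?F v w x - ?F w v x\<bar> / 2"
  have e: "e > 0" using ne by (simp add: e_def)
  have cont: "continuous_on S (?F v w)" "continuous_on S (?F w v)"
    using assms(3) by (auto simp: numeral_2_eq_2)
  obtain d0 where d0: "d0 > 0" "ball x d0 \<subseteq> S"
    using assms(1,2) open_contains_ball by blast
  have ev: "\<exists>d>0. \<forall>y. dist y x < d \<longrightarrow> dist (G y) (G x) < e" if "continuous_on S G" for G :: "'a \<Rightarrow> real"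
    using that assms(2) e
    unfolding continuous_on_eq_continuous_at[OF assms(1)] continuous_at_eps_delta by metis
  obtain d1 d2 where d1: "d1 > 0" "\<And>y. dist y x < d1 \<Longrightarrow> dist (?F v w y) (?F v w x) < e"
    and d2: "d2 > 0" "\<And>y. dist y x < d2 \<Longrightarrow> dist (?F w v y) (?F w v x) < e"
    using ev[OF cont(1)] ev[OF cont(2)] by blast
  define d where "d = min d0 (min d1 d2)"
  have d: "d > 0" "ball x d \<subseteq> S" using d0 d1 d2 by (auto simp: d_def)
  \<comment> \<open>The summand 1 keeps the denominator positive when \<open>v\<close> and
    \<open>w\<close> are both zero.\<close>
  define h where "h = d / (norm v + norm w + 1)"
  have h: "h > 0" "h * (norm v + norm w) < d"
    using d(1) by (auto simp: h_def divide_simps add_nonneg_pos)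
  obtain p where p: "p \<in> ball x d"
      "f (x + h *\<^sub>R v + h *\<^sub>R w) - f (x + h *\<^sub>R v) - f (x + h *\<^sub>R w) + f x = h\<^sup>2 * ?F v w p"
    using second_difference[OF assms(3) d(2) h] by blast
  obtain q where q: "q \<in> ball x d"
      "f (x + h *\<^sub>R w + h *\<^sub>R v) - f (x + h *\<^sub>R w) - f (x + h *\<^sub>R v) + f x = h\<^sup>2 * ?F w v q"
    using second_difference[OF assms(3) d(2), of h w v] h by (auto simp: add.commute)
  have "h\<^sup>2 * ?F v w p = h\<^sup>2 * ?F w v q"
    unfolding p(2)[symmetric] q(2)[symmetric] by (simp add: algebra_simps)
  then have "?F v w p = ?F w v q" using h by simp
  moreover have "dist (?F v w p) (?F v w x) < e" "dist (?F w v q) (?F w v x) < e"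
    using p q by (auto intro!: d1 d2 simp: d_def dist_commute)
  ultimately have "\<bar>?F v w x - ?F w v x\<bar> < 2 * e" by (simp add: dist_real_def)
  then show False by (simp add: e_def)
qed

lemma partial_commute:
  fixes f :: "real^'n \<Rightarrow> real"
  assumes "open S" "x \<in> S" "smooth_on S f"
  shows "partial i (partial j f) x = partial j (partial i f) x"
proof -
  have "Ck_on 2 S f" using assms(3) by (simp add: smooth_on_def)
  from second_derivative_symmetric[OF assms(1,2) this] show ?thesis
    by (simp add: partial_def[abs_def])
qed

section \<open>The strong maximum principle\<close>

text \<open>Non-divergence form with no term of order zero, so constants are solutions and the level
  \<open>M\<close> in the maximum principle may have any sign.\<close>

definition elliptic_operator ::
    "(real^'n \<Rightarrow> real^'n^'n) \<Rightarrow> (real^'n \<Rightarrow> real^'n) \<Rightarrow> (real^'n \<Rightarrow> real) \<Rightarrow> real^'n \<Rightarrow> real" where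
  "elliptic_operator D b u x =
    (\<Sum>i\<in>UNIV. \<Sum>j\<in>UNIV. D x $ i $ j * partial j (partial i u) x) + (\<Sum>i\<in>UNIV. b x $ i * partial i u x)"

lemma frechet_derivative_eq_sum_partial:
  fixes f :: "real^'n \<Rightarrow> real"
  assumes "f differentiable (at x)"
  shows "frechet_derivative f (at x) v = (\<Sum>i\<in>UNIV. v $ i * partial i f x)"
proof -
  have "frechet_derivative f (at x) (\<Sum>i\<in>UNIV. v $ i *\<^sub>R axis i 1) =
      (\<Sum>i\<in>UNIV. v $ i * partial i f x)"
    using linear_frechet_derivative[OF assms] by (simp add: linear_sum linear_cmul partial_def)
  then show ?thesis
    using basis_expansion[of v] by (simp add: scalar_mult_eq_scaleR)
qed

text \<open>Along the line through \<open>x\<close> in direction \<open>v\<close>, a positive second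
  derivative would make the vanishing first derivative positive immediately to the right of 0, and
  the mean value theorem would produce a value above the maximum.\<close>

lemma second_derivative_nonpos_at_max:
  fixes f :: "'a::real_normed_vector \<Rightarrow> real"
  assumes S: "open S" "x \<in> S" and max: "\<And>y. y \<in> S \<Longrightarrow> f y \<le> f x"
    and f: "\<And>y. y \<in> S \<Longrightarrow> f differentiable (at y)"
    and f2: "(\<lambda>y. frechet_derivative f (at y) v) differentiable (at x)"
  shows "frechet_derivative f (at x) v = 0"
    and "frechet_derivative (\<lambda>y. frechet_derivative f (at y) v) (at x) v \<le> 0"
proof -
  let ?f1 = "\<lambda>y. frechet_derivative f (at y) v"
  let ?c = "frechet_derivative ?f1 (at x) v"
  obtain d where d: "d > 0" "ball x d \<subseteq> S"
    using S open_contains_ball by blast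
  define e where "e = d / (norm v + 1)"
  have "e * norm v < d" using d(1) by (auto simp: e_def divide_simps add_nonneg_pos)
  moreover have e: "e > 0" using d(1) by (auto simp: e_def add_nonneg_pos)
  ultimately have seg: "x + t *\<^sub>R v \<in> S" if "\<bar>t\<bar> < e" for t
  proof -
    have "\<bar>t\<bar> * norm v \<le> e * norm v" using that by (simp add: mult_right_mono)
    then show ?thesis using \<open>e * norm v < d\<close> d(2) by (auto simp: dist_norm subset_eq)
  qed
  have d1: "((\<lambda>t. f (x + t *\<^sub>R v)) has_real_derivative ?f1 (x + t *\<^sub>R v)) (at t)" if "\<bar>t\<bar> < e" for t
    using that by (intro has_real_derivative_line f seg)
  have "?f1 (x + 0 *\<^sub>R v) = 0"
    using max seg e by (intro DERIV_local_max[OF d1[of 0] e]) auto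
  then show zero: "?f1 x = 0" by simp
  show "?c \<le> 0"
  proof (rule ccontr)
    assume "\<not> ?c \<le> 0"
    then have "0 < frechet_derivative ?f1 (at (x + 0 *\<^sub>R v)) v" by simp
    from DERIV_pos_inc_right[OF has_real_derivative_line this] f2
    obtain h where h: "h > 0" "\<And>t. 0 < t \<Longrightarrow> t < h \<Longrightarrow> 0 < ?f1 (x + t *\<^sub>R v)"
      using zero by auto
    define k where "k = min h e / 2"
    have k: "0 < k" "k < h" "k < e" using h e by (auto simp: k_def)
    obtain t where "0 < t" "t < k" "f (x + k *\<^sub>R v) - f (x + 0 *\<^sub>R v) = (k - 0) * ?f1 (x + t *\<^sub>R v)"
      using MVT2[OF k(1), of "\<lambda>t. f (x + t *\<^sub>R v)" "\<lambda>t. ?f1 (x + t *\<^sub>R v)"] d1 k by auto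
    with h(2)[of t] k have "0 < f (x + k *\<^sub>R v) - f (x + 0 *\<^sub>R v)"
      by (metis diff_zero less_trans mult_pos_pos)
    then have "f x < f (x + k *\<^sub>R v)" by simp
    then show False using max[OF seg[of k]] k by simp
  qed
qed

text \<open>The gradient vanishes at the maximum. The factorization of \<open>D x\<close> turns the
  second-order part into a sum of pure second derivatives along the columns of \<open>B\<close>,
  each nonpositive.\<close>

lemma elliptic_operator_nonpos_at_max:
  fixes u :: "real^'n \<Rightarrow> real"
  assumes S: "open S" "x \<in> S" and max: "\<And>y. y \<in> S \<Longrightarrow> u y \<le> u x"
    and u: "\<And>y. y \<in> S \<Longrightarrow> u differentiable (at y)"
    and u2: "\<And>i. (\<lambda>y. partial i u y) differentiable (at x)"
    and D: "D x = B ** transpose B"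
  shows "elliptic_operator D b u x \<le> 0"
proof -
  have dir: "frechet_derivative u (at y) v = (\<Sum>i\<in>UNIV. v $ i * partial i u y)" if "y \<in> S" for y v
    by (rule frechet_derivative_eq_sum_partial[OF u[OF that]])
  have der: "((\<lambda>y. \<Sum>i\<in>UNIV. v $ i * partial i u y) has_derivative
      (\<lambda>w. \<Sum>i\<in>UNIV. v $ i * frechet_derivative (partial i u) (at x) w)) (at x)" for v :: "real^'n"
    by (intro has_derivative_sum has_derivative_mult_right has_derivative_frechet u2)
  have diff: "(\<lambda>y. frechet_derivative u (at y) v) differentiable (at x)" for v
    by (rule differentiable_cong_open[OF _ S, of "\<lambda>y. \<Sum>i\<in>UNIV. v $ i * partial i u y"])
      (use der dir in \<open>auto simp: differentiable_def\<close>)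
  have H: "frechet_derivative (\<lambda>y. frechet_derivative u (at y) v) (at x) v =
      (\<Sum>i\<in>UNIV. \<Sum>j\<in>UNIV. v $ i * v $ j * partial j (partial i u) x)" for v
  proof -
    have "frechet_derivative (\<lambda>y. frechet_derivative u (at y) v) (at x) v =
        (\<Sum>i\<in>UNIV. v $ i * frechet_derivative (partial i u) (at x) v)"
      using frechet_derivative_cong_open[OF S dir] frechet_derivative_eqI[OF der] by simp
    also have "\<dots> = (\<Sum>i\<in>UNIV. \<Sum>j\<in>UNIV. v $ i * v $ j * partial j (partial i u) x)"
      using frechet_derivative_eq_sum_partial[OF u2]
      by (simp add: sum_distrib_left mult.assoc)
    finally show ?thesis .
  qed
  have "partial i u x = 0" for i
    using second_derivative_nonpos_at_max(1)[OF S max u diff] by (simp add: partial_def)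
  then have "elliptic_operator D b u x =
      (\<Sum>i\<in>UNIV. \<Sum>j\<in>UNIV. \<Sum>a\<in>UNIV. B $ i $ a * B $ j $ a * partial j (partial i u) x)"
    by (simp add: elliptic_operator_def D matrix_matrix_mult_def transpose_def sum_distrib_right)
  also have "\<dots> = (\<Sum>a\<in>UNIV. \<Sum>i\<in>UNIV. \<Sum>j\<in>UNIV. B $ i $ a * B $ j $ a * partial j (partial i u) x)"
    by (rule trans[OF sum.cong[OF refl sum.swap] sum.swap])
  also have "\<dots> = (\<Sum>a\<in>UNIV. frechet_derivative (\<lambda>y. frechet_derivative u (at y) (column a B)) (at x) (column a B))"
    unfolding H by (simp add: column_def)
  also have "\<dots> \<le> 0"
    by (intro sum_nonpos second_derivative_nonpos_at_max(2)[OF S max u diff])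
  finally show ?thesis .
qed

section \<open>Hopf's barrier function\<close>

context
  fixes q :: "real^'n" and \<alpha> :: real
begin

definition barrier :: "real^'n \<Rightarrow> real" where
  "barrier x = exp (- \<alpha> * ((x - q) \<bullet> (x - q)))"

lemma has_derivative_barrier:
  "(barrier has_derivative (\<lambda>v. - 2 * \<alpha> * ((x - q) \<bullet> v) * barrier x)) (at x)"
  unfolding barrier_def
  by (auto intro!: derivative_eq_intros simp: fun_eq_iff inner_commute algebra_simps)

lemma partial_barrier: "partial i barrier x = - 2 * \<alpha> * (x $ i - q $ i) * barrier x"
  unfolding partial_def by (subst frechet_derivative_eqI[OF has_derivative_barrier]) (simp add: inner_axis)

lemma has_derivative_partial_barrier:
  "(partial i barrier has_derivative
    (\<lambda>v. - 2 * \<alpha> * v $ i * barrier x + 4 * \<alpha>\<^sup>2 * (x $ i - q $ i) * ((x - q) \<bullet> v) * barrier x)) (at x)"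
proof -
  have "((\<lambda>x. x $ i - q $ i) has_derivative (\<lambda>v. v $ i)) (at x)"
    by (rule has_derivative_eq_rhs[OF has_derivative_diff[OF
          bounded_linear.has_derivative[OF bounded_linear_vec_nth has_derivative_ident] has_derivative_const]]) simp
  then have "((\<lambda>x. - 2 * \<alpha> * (x $ i - q $ i) * barrier x) has_derivative
      (\<lambda>v. - 2 * \<alpha> * v $ i * barrier x + 4 * \<alpha>\<^sup>2 * (x $ i - q $ i) * ((x - q) \<bullet> v) * barrier x)) (at x)"
    by (rule has_derivative_eq_rhs[OF has_derivative_mult[OF has_derivative_mult_right has_derivative_barrier]])
      (simp add: fun_eq_iff power2_eq_square algebra_simps)
  then show ?thesis by (simp add: partial_barrier[abs_def])
qed

text \<open>The coefficient of \<open>\<alpha>\<^sup>2\<close> is the quadratic form of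
  \<open>D x\<close> at \<open>x - q\<close>. Where this is positive, a large
  \<open>\<alpha>\<close> outweighs the terms linear in \<open>\<alpha>\<close>.\<close>

lemma elliptic_operator_barrier:
  "elliptic_operator D b barrier x =
    (4 * \<alpha>\<^sup>2 * ((x - q) \<bullet> (D x *v (x - q))) - 2 * \<alpha> * (trace (D x) + b x \<bullet> (x - q))) * barrier x"
proof -
  define y where "y = x - q"
  have p2: "partial j (partial i barrier) x =
      4 * \<alpha>\<^sup>2 * barrier x * (y $ i * y $ j) - (if j = i then 2 * \<alpha> * barrier x else 0)" for i j
    unfolding partial_def[of j]
    by (subst frechet_derivative_eqI[OF has_derivative_partial_barrier])
      (simp add: inner_axis y_def algebra_simps, simp add: axis_def)
  have "(\<Sum>i\<in>UNIV. \<Sum>j\<in>UNIV. D x $ i $ j * partial j (partial i barrier) x) =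
      4 * \<alpha>\<^sup>2 * barrier x * (\<Sum>i\<in>UNIV. y $ i * (\<Sum>j\<in>UNIV. D x $ i $ j * y $ j)) -
      2 * \<alpha> * barrier x * trace (D x)"
    unfolding p2 by (simp add: right_diff_distrib sum_subtractf trace_def sum_distrib_left mult_ac
        if_distrib[of "(*) _"] sum.delta cong: if_cong)
  moreover have "(\<Sum>i\<in>UNIV. b x $ i * partial i barrier x) = - 2 * \<alpha> * barrier x * (b x \<bullet> y)"
    unfolding partial_barrier by (simp add: inner_vec_def sum_distrib_left y_def algebra_simps)
  ultimately show ?thesis
    by (simp add: elliptic_operator_def y_def[symmetric] inner_vec_def[of y] matrix_vector_mult_def
        algebra_simps)
qed

end

text \<open>Hopf's argument: a ball on which \<open>u < M\<close> touches \<open>{u = M}\<close> at \<open>z\<close>; shrinking it to half its radius makes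
  \<open>z\<close> the only contact point. Near \<open>z\<close>, adding a small multiple of the barrier pushes the boundary
  values below the value at \<open>z\<close>, so that the sum has an interior maximum, where the operator cannot be positive.\<close>

lemma strong_maximum_principle:
  fixes u :: "real^'n \<Rightarrow> real"
  assumes U: "open U" and u: "smooth_on U u"
    and D: "continuous_on U D" "\<And>x. x \<in> U \<Longrightarrow> \<exists>B :: real^'n^'n. invertible B \<and> D x = B ** transpose B"
    and b: "continuous_on U b"
    and Lu: "\<And>x. x \<in> U \<Longrightarrow> elliptic_operator D b u x = 0"
    and le: "\<And>x. x \<in> U \<Longrightarrow> u x \<le> M"
  shows "open {x\<in>U. u x = M}"
proof (rule openI)
  fix x0 assume "x0 \<in> {x\<in>U. u x = M}"
  then have x0: "x0 \<in> U" "u x0 = M" by auto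
  obtain e where e: "e > 0" "ball x0 e \<subseteq> U" using U x0(1) open_contains_ball by blast
  have contu: "continuous_on U u" by (rule smooth_on_imp_continuous_on[OF u])
  \<comment> \<open>A quarter of \<open>e\<close> leaves room for all auxiliary balls: they stay
    within \<open>3*r\<close> of \<open>x0\<close>, hence in \<open>U\<close>.\<close>
  define r where "r = e / 4"
  have r: "r > 0" using e by (simp add: r_def)
  have "u y = M" if y: "y \<in> ball x0 r" for y
  proof (rule ccontr)
    assume uy: "u y \<noteq> M"
    define F where "F = {x \<in> cball x0 (2*r). u x = M}"
    have subU: "cball x0 (3*r) \<subseteq> U" using e r by (auto simp: r_def subset_eq)
    have "closed F"
      unfolding F_def using subU r
      by (intro continuous_closed_preimage_constant continuous_on_subset[OF contu]) (auto simp: subset_eq)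
    moreover have "x0 \<in> F" using x0 r by (simp add: F_def)
    \<comment> \<open>A contact point nearest to \<open>y\<close>. Since \<open>x0\<close> competes,
      its distance \<open>R\<close> is below \<open>r\<close>, so the ball of radius
      \<open>R\<close> about \<open>y\<close> stays within \<open>2*r\<close> of \<open>x0\<close>
      and contains no point of \<open>F\<close>.\<close>
    ultimately obtain z where z: "z \<in> F" "\<And>x. x \<in> F \<Longrightarrow> dist y z \<le> dist y x"
      using distance_attains_inf[of F y] by blast
    define R where "R = dist y z"
    have uz: "u z = M" using z by (simp add: F_def)
    have R: "0 < R" "R < r"
      using uy uz z(2)[OF \<open>x0 \<in> F\<close>] y by (auto simp: R_def dist_commute)
    define q where "q = midpoint y z"
    have qz: "dist q z = R / 2" by (simp add: q_def R_def dist_midpoint)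
    \<comment> \<open>With \<open>y\<close> as origin, the half-radius condition says
      \<open>a \<bullet> a \<le> a \<bullet> c\<close>. If also \<open>|a| \<ge> |c|\<close>, then
      \<open>|a - c|\<^sup>2 \<le> 0\<close>, so the smaller closed ball meets the larger sphere
      only at \<open>z\<close>.\<close>
    have touch: "dist y x < R" if "dist q x \<le> R / 2" "x \<noteq> z" for x
    proof (rule ccontr)
      assume far: "\<not> dist y x < R"
      define a where "a = x - y"
      define c where "c = z - y"
      have c: "c \<bullet> c = R\<^sup>2"
        by (simp add: c_def R_def dist_norm norm_minus_commute[of y] flip: power2_norm_eq_inner)
      have "R\<^sup>2 \<le> a \<bullet> a"
        using far R by (simp add: a_def dist_norm norm_minus_commute flip: power2_norm_eq_inner)
      moreover have "(dist q x)\<^sup>2 \<le> (R/2)\<^sup>2" using that(1) R by (intro power_mono) auto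
      then have "(a - (1/2) *\<^sub>R c) \<bullet> (a - (1/2) *\<^sub>R c) \<le> (R/2)\<^sup>2"
      proof -
        have "x - q = a - (1/2) *\<^sub>R c"
          by (simp add: q_def midpoint_def a_def c_def algebra_simps flip: scaleR_add_left)
        then show ?thesis
          using \<open>(dist q x)\<^sup>2 \<le> (R/2)\<^sup>2\<close> by (metis dist_commute dist_norm power2_norm_eq_inner)
      qed
      then have "a \<bullet> a - a \<bullet> c \<le> 0"
        using c by (simp add: inner_diff_left inner_diff_right inner_commute power2_eq_square)
      ultimately have "(a - c) \<bullet> (a - c) \<le> 0"
        using c by (simp add: inner_diff_left inner_diff_right inner_commute)
      then have "a = c" by (metis inner_gt_zero_iff not_less right_minus_eq)
      then show False using that(2) by (simp add: a_def c_def)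
    qed
    \<comment> \<open>Less than the distance \<open>R / 2\<close> from \<open>z\<close> to
      \<open>q\<close>, so the centre of the barrier, where its quadratic term degenerates, is
      avoided.\<close>
    define s where "s = R / 4"
    have s: "s > 0" using R by (simp add: s_def)
    have near: "dist x0 x < 3*r" if "x \<in> cball z s" for x
      using that R r y dist_triangle[of x0 x z] dist_triangle[of x0 z y] by (auto simp: s_def R_def)
    then have zsU: "cball z s \<subseteq> U" using subU by (force simp: subset_eq)
    have q_far: "x \<noteq> q" if "x \<in> cball z s" for x
      using that qz R by (auto simp: s_def dist_commute)
    have uless: "u x < M" if "x \<in> U" "dist q x \<le> R / 2" "x \<noteq> z" for x
    proof -
      have "dist y x < R" using touch that by blast
      moreover have "dist x0 x \<le> dist x0 y + dist y x" by (rule dist_triangle)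
      ultimately have "x \<notin> F" "dist x0 x \<le> 2 * r" using z(2)[of x] y R by (auto simp: R_def)
      then show ?thesis using le[OF that(1)] by (auto simp: F_def)
    qed
    \<comment> \<open>On this compact part of the small sphere \<open>u\<close> stays below
      \<open>M\<close> by a fixed amount \<open>\<delta>\<close>; on the rest of the sphere the
      barrier is smaller than at \<open>z\<close>.\<close>
    define K where "K = sphere z s \<inter> cball q (R / 2)"
    obtain \<delta> where \<delta>: "\<delta> > 0" "\<And>x. x \<in> K \<Longrightarrow> u x \<le> M - \<delta>"
    proof (cases "K = {}")
      case True
      then show thesis using that[of 1] by simp
    next
      case False
      have KU: "K \<subseteq> U" using zsU by (auto simp: K_def subset_eq)
      have "compact K" by (auto simp: K_def)
      from continuous_attains_sup[OF this False continuous_on_subset[OF contu KU]]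
      obtain k where k: "k \<in> K" "\<And>x. x \<in> K \<Longrightarrow> u x \<le> u k" by blast
      have "u k < M" using k(1) KU s by (intro uless) (auto simp: K_def)
      then show thesis using that[of "M - u k"] k(2) by auto
    qed
    define P where "P x = (x - q) \<bullet> (D x *v (x - q))" for x
    define T where "T x = trace (D x) + b x \<bullet> (x - q)" for x
    have contD: "continuous_on (cball z s) D" "continuous_on (cball z s) b"
      using D(1) b zsU by (auto intro: continuous_on_subset)
    have "continuous_on (cball z s) P"
      unfolding P_def matrix_vector_mult_def
      by (intro continuous_intros contD) 
    then obtain k where k: "k \<in> cball z s" "\<And>x. x \<in> cball z s \<Longrightarrow> P k \<le> P x"
      using continuous_attains_inf[OF compact_cball, of z s P] s by auto
    have "P k > 0"
    proof -
      obtain B :: "real^'n^'n" where B: "invertible B" "D k = B ** transpose B" using D(2) k(1) zsU by blast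
      obtain C where "B ** C = mat 1" using B(1) by (auto simp: invertible_def)
      then have "transpose C ** transpose B = mat 1"
        by (metis matrix_transpose_mul transpose_mat)
      then have "transpose C *v (transpose B *v (k - q)) = k - q"
        by (metis matrix_vector_mul_assoc matrix_vector_mul_lid)
      then have "transpose B *v (k - q) \<noteq> 0"
        using q_far[OF k(1)] by (metis matrix_vector_mult_0_right right_minus_eq)
      moreover have "P k = (transpose B *v (k - q)) \<bullet> (transpose B *v (k - q))"
        unfolding P_def B(2) by (simp add: matrix_vector_mul_assoc[symmetric] dot_lmul_matrix[symmetric])
      ultimately show ?thesis by simp
    qed
    have "continuous_on (cball z s) T"
      unfolding T_def trace_def by (intro continuous_intros contD)
    then have "\<exists>k'\<in>cball z s. \<forall>x\<in>cball z s. T x \<le> T k'"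
      using s by (intro continuous_attains_sup) auto
    then obtain k' where k': "\<And>x. x \<in> cball z s \<Longrightarrow> T x \<le> T k'" by blast
    \<comment> \<open>Then \<open>2 * \<alpha> * P k = 2 * (\<bar>T k'\<bar> + 1)\<close>, which
      exceeds every value of \<open>T\<close> on the ball, while \<open>P k\<close> is the least
      value of \<open>P\<close>.\<close>
    define \<alpha> where "\<alpha> = (\<bar>T k'\<bar> + 1) / P k"
    have \<alpha>: "\<alpha> > 0" using \<open>P k > 0\<close> by (simp add: \<alpha>_def add_nonneg_pos)
    let ?h = "barrier q \<alpha>"
    have Lh: "elliptic_operator D b ?h x > 0" if "x \<in> cball z s" for x
    proof -
      have "T x < 2 * \<alpha> * P k"
        using k'[OF that] \<open>P k > 0\<close> by (simp add: \<alpha>_def)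
      also have "\<dots> \<le> 2 * \<alpha> * P x" using k(2)[OF that] \<alpha> by simp
      finally have "0 < 2 * \<alpha> * (2 * \<alpha> * P x - T x)" using \<alpha> by simp
      also have "\<dots> = 4 * \<alpha>\<^sup>2 * P x - 2 * \<alpha> * T x" by (simp add: algebra_simps power2_eq_square)
      finally show ?thesis
        unfolding elliptic_operator_barrier P_def T_def by (simp add: barrier_def)
    qed
    \<comment> \<open>The barrier lies in (0, 1], so a weight of \<open>\<delta> / 2\<close> cannot
      use up the gap \<open>\<delta>\<close> on \<open>K\<close>.\<close>
    define v where "v x = u x + \<delta> / 2 * ?h x" for x
    have h_mono: "?h x < ?h z \<longleftrightarrow> R / 2 < dist q x" for x
    proof -
      have "?h x < ?h z \<longleftrightarrow> (dist q z)\<^sup>2 < (dist q x)\<^sup>2"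
        unfolding barrier_def using \<alpha>
        by (simp add: dist_norm norm_minus_commute flip: power2_norm_eq_inner)
      then show ?thesis unfolding qz using R power2_less_imp_less power_strict_mono
        by (metis half_gt_zero less_eq_real_def zero_le_dist zero_less_numeral)
    qed
    have v_sphere: "v x < v z" if x: "x \<in> sphere z s" for x
    proof (cases "dist q x \<le> R / 2")
      case True
      have "?h x \<le> 1" using \<alpha> by (simp add: barrier_def)
      then have "v x \<le> M - \<delta> + \<delta> / 2"
        unfolding v_def using \<delta> x True by (intro add_mono) (auto simp: K_def)
      also have "\<dots> < v z"
      proof -
        have "0 < \<delta> / 2 * ?h z" using \<delta>(1) by (simp add: barrier_def)
        then show ?thesis unfolding v_def uz using \<delta>(1) by linarith
      qed
      finally show ?thesis .
    next
      case False
      have "u x \<le> M" using x zsU by (intro le) (auto simp: subset_eq)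
      then show ?thesis unfolding v_def uz using False h_mono[of x] \<delta> by (intro add_le_less_mono) auto
    qed
    have conth: "continuous_on A ?h" for A
      by (meson differentiable_imp_continuous_within continuous_at_imp_continuous_on has_derivative_barrier differentiable_def)
    have "continuous_on (cball z s) v"
      unfolding v_def by (intro continuous_intros continuous_on_subset[OF contu zsU] conth)
    then obtain w where w: "w \<in> cball z s" "\<And>x. x \<in> cball z s \<Longrightarrow> v x \<le> v w"
      using continuous_attains_sup[OF compact_cball, of z s v] s by auto
    have wb: "w \<in> ball z s"
      using w(1) v_sphere[of w] w(2)[of z] s by (auto simp: less_eq_real_def)
    have du: "u differentiable (at x)" "partial i u differentiable (at x)" if "x \<in> U" for x i
      using smooth_on_imp_differentiable[OF u that]
        smooth_on_imp_differentiable[OF smooth_on_frechet_derivative[OF u] that]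
      by (auto simp: partial_def[abs_def])
    have dh: "?h differentiable (at x)" "partial i ?h differentiable (at x)" for x i
      using has_derivative_barrier has_derivative_partial_barrier unfolding differentiable_def by blast+
    have pv: "partial i v x = partial i u x + \<delta> / 2 * partial i ?h x" if "x \<in> U" for i x
      unfolding partial_def v_def
      by (intro frechet_derivative_eqI has_derivative_add has_derivative_mult_right has_derivative_frechet du that dh)
    have dpv: "(partial i v has_derivative (\<lambda>y. frechet_derivative (partial i u) (at x) y +
        \<delta> / 2 * frechet_derivative (partial i ?h) (at x) y)) (at x)" if "x \<in> U" for i x
      by (rule has_derivative_transform_within_open[OF _ U that pv[symmetric]])
        (intro has_derivative_add has_derivative_mult_right has_derivative_frechet du that dh)
    have ppv: "partial j (partial i v) x = partial j (partial i u) x + \<delta> / 2 * partial j (partial i ?h) x"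
      if "x \<in> U" for i j x
      unfolding partial_def[of j] by (rule frechet_derivative_eqI[OF dpv[OF that]])
    have wU: "w \<in> U" using w(1) zsU by blast
    have "elliptic_operator D b v w = elliptic_operator D b u w + \<delta> / 2 * elliptic_operator D b ?h w"
      unfolding elliptic_operator_def pv[OF wU] ppv[OF wU]
      by (simp add: distrib_left sum.distrib sum_distrib_left mult_ac)
    also have "\<dots> > 0" using Lu[OF wU] Lh[OF w(1)] \<delta> by simp
    finally have "elliptic_operator D b v w > 0" .
    moreover obtain B :: "real^'n^'n" where "D w = B ** transpose B" using D(2)[OF wU] by blast
    then have "elliptic_operator D b v w \<le> 0"
    proof (intro elliptic_operator_nonpos_at_max[OF open_ball wb])
      show "v differentiable (at y)" if "y \<in> ball z s" for y
        unfolding v_def using that zsU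
        by (intro derivative_intros du dh) (auto simp: subset_eq)
      show "partial i v differentiable (at w)" for i
        using dpv[OF wU] differentiable_def by blast
    qed (use w(2) in auto)
    ultimately show False by simp
  qed
  then have "ball x0 r \<subseteq> {x\<in>U. u x = M}" using e by (auto simp: r_def)
  then show "\<exists>e>0. ball x0 e \<subseteq> {x\<in>U. u x = M}" using r by blast
qed

section \<open>Skew matrices of size four\<close>

lemma vector_4:
  "(vector [a, b, c, d] :: 'a::zero^4) $ 1 = a"
  "(vector [a, b, c, d] :: 'a^4) $ 2 = b"
  "(vector [a, b, c, d] :: 'a^4) $ 3 = c"
  "(vector [a, b, c, d] :: 'a^4) $ 4 = d"
  unfolding vector_def by simp_all

text \<open>The Pfaffian, reading only the entries above the diagonal; it is applied to skew
  matrices.\<close>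

definition pf :: "real^4^4 \<Rightarrow> real" where
  "pf S = S$1$2 * S$3$4 - S$1$3 * S$2$4 + S$1$4 * S$2$3"

text \<open>The Pfaffian analogue of the adjugate: above the diagonal its entries are minus the
  partial derivatives of \<open>pf\<close>. As \<open>pf\<close> is quadratic in size four, it is
  linear in \<open>S\<close>, like the Hodge star on 2-forms.\<close>

definition pf_adj :: "real^4^4 \<Rightarrow> real^4^4" where
  "pf_adj S = vector
    [vector [0, - S$3$4, S$2$4, - S$2$3],
     vector [S$3$4, 0, - S$1$4, S$1$3],
     vector [- S$2$4, S$1$4, 0, - S$1$2],
     vector [S$2$3, - S$1$3, S$1$2, 0]]"

lemma skew_entries:
  fixes S :: "real^4^4"
  assumes "transpose S = - S"
  shows "S$1$1 = 0" "S$2$2 = 0" "S$3$3 = 0" "S$4$4 = 0"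
    "S$2$1 = - S$1$2" "S$3$1 = - S$1$3" "S$4$1 = - S$1$4"
    "S$3$2 = - S$2$3" "S$4$2 = - S$2$4" "S$4$3 = - S$3$4"
proof -
  have *: "S $ j $ i = - S $ i $ j" for i j
    using arg_cong[OF assms, of "\<lambda>M. M $ i $ j"] by (simp add: transpose_def)
  show "S$2$1 = - S$1$2" "S$3$1 = - S$1$3" "S$4$1 = - S$1$4"
    "S$3$2 = - S$2$3" "S$4$2 = - S$2$4" "S$4$3 = - S$3$4"
    by (rule *)+
  show "S$1$1 = 0" "S$2$2 = 0" "S$3$3 = 0" "S$4$4 = 0"
    using *[of 1 1] *[of 2 2] *[of 3 3] *[of 4 4] by simp_all
qed

lemma mat_entries_4:
  "(mat 1 :: real^4^4) $ i $ j = (if i = j then 1 else 0)"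
  by (simp add: mat_def)

lemma mult_entries_4:
  "((M :: real^4^4) ** N) $ i $ j = M$i$1 * N$1$j + M$i$2 * N$2$j + M$i$3 * N$3$j + M$i$4 * N$4$j"
  by (simp add: matrix_matrix_mult_def sum_4)

lemma transpose_entries: "transpose M $ i $ j = M $ j $ i"
  by (simp add: transpose_def)

lemma neq_4: "(1::4) \<noteq> 2" "(1::4) \<noteq> 3" "(1::4) \<noteq> 4" "(2::4) \<noteq> 3" "(2::4) \<noteq> 4" "(3::4) \<noteq> 4"
  by simp_all

lemma trace_4: "trace (M :: real^4^4) = M$1$1 + M$2$2 + M$3$3 + M$4$4"
  by (simp add: trace_def sum_4)

lemmas entries_4 = mat_entries_4 mult_entries_4 transpose_entries trace_4 pf_def pf_adj_def vector_4
  vector_add_component vector_minus_component vector_uminus_component vector_scaleR_component real_scaleR_def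
  neq_4 neq_4[symmetric]

lemma mult_pf_adj:
  assumes "transpose S = - S"
  shows "S ** pf_adj S = pf S *\<^sub>R mat 1"
  by (simp only: vec_eq_iff forall_4 entries_4 skew_entries[OF assms] if_True if_False simp_thms) (simp only: algebra_simps; simp)

text \<open>The identity \<open>mult_pf_adj\<close> is quadratic in \<open>S\<close>; this is the
  associated bilinear identity.\<close>

lemma pf_adj_polarized:
  assumes "transpose S = - S" "transpose T = - T"
  shows "S ** pf_adj T + T ** pf_adj S = (pf (S + T) - pf S - pf T) *\<^sub>R mat 1"
  by (simp only: vec_eq_iff forall_4 entries_4 skew_entries[OF assms(1)] skew_entries[OF assms(2)] if_True if_False simp_thms,
      intro conjI) algebra+

text \<open>The derivative of \<open>pf_adj S\<close> along the flow of a connection matrix \<open>M\<close>; \<open>tr M\<close> is the logarithmic derivative of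
  the volume density.\<close>

lemma pf_adj_derivation:
  assumes "transpose S = - S"
  shows "pf_adj (transpose M ** S + S ** M) =
    trace M *\<^sub>R pf_adj S - M ** pf_adj S - pf_adj S ** transpose M"
  by (simp only: vec_eq_iff forall_4 entries_4 skew_entries[OF assms] if_True if_False simp_thms,
      intro conjI) algebra+

lemma det_4:
  "det (M :: 'a::comm_ring_1^4^4) =
    M$1$1 * (M$2$2 * (M$3$3 * M$4$4 - M$3$4 * M$4$3) - M$2$3 * (M$3$2 * M$4$4 - M$3$4 * M$4$2) + M$2$4 * (M$3$2 * M$4$3 - M$3$3 * M$4$2))
  - M$1$2 * (M$2$1 * (M$3$3 * M$4$4 - M$3$4 * M$4$3) - M$2$3 * (M$3$1 * M$4$4 - M$3$4 * M$4$1) + M$2$4 * (M$3$1 * M$4$3 - M$3$3 * M$4$1))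
  + M$1$3 * (M$2$1 * (M$3$2 * M$4$4 - M$3$4 * M$4$2) - M$2$2 * (M$3$1 * M$4$4 - M$3$4 * M$4$1) + M$2$4 * (M$3$1 * M$4$2 - M$3$2 * M$4$1))
  - M$1$4 * (M$2$1 * (M$3$2 * M$4$3 - M$3$3 * M$4$2) - M$2$2 * (M$3$1 * M$4$3 - M$3$3 * M$4$1) + M$2$3 * (M$3$1 * M$4$2 - M$3$2 * M$4$1))"
  (is "_ = ?r")
proof -
  have f1234: "finite {2::4, 3, 4}" "1 \<notin> {2::4, 3, 4}"
    and f234: "finite {3::4, 4}" "2 \<notin> {3::4, 4}"
    and f34: "finite {4::4}" "3 \<notin> {4::4}"
    by auto
  \<comment> \<open>Inserting the indices one at a time writes a permutation as three
    transpositions, a trivial one when the two indices agree. The sign is the product of their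
    signs.\<close>
  have sgn: "sign (Transposition.transpose a b \<circ> (Transposition.transpose c d \<circ> (Transposition.transpose e f \<circ> id))) =
      (if a = b then 1 else - 1) * (if c = d then 1 else - 1) * (if e = f then 1 else - 1)" for a b c d e f :: 4
    by (simp only: sign_compose sign_swap_id sign_id permutation_swap_id permutation_compose permutation_id mult_1_right mult.assoc)
  have "det M = (\<Sum>b\<in>{1, 2, 3, 4}. \<Sum>c\<in>{2, 3, 4}. \<Sum>d\<in>{3, 4}.
     of_int ((if 1 = b then 1 else - 1) * (if 2 = c then 1 else - 1) * (if 3 = d then 1 else - 1)) *
     (\<Prod>i\<in>UNIV. M $ i $ Transposition.transpose 1 b (Transposition.transpose 2 c (Transposition.transpose 3 d i))))"
    unfolding det_def UNIV_4
    unfolding sum_over_permutations_insert[OF f1234]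
    unfolding sum_over_permutations_insert[OF f234]
    unfolding sum_over_permutations_insert[OF f34]
    unfolding permutes_sing
    by (simp only: sgn o_apply id_apply sum.insert sum.empty finite.intros empty_iff add_0_right not_False_eq_True singleton_conv)
  also have "\<dots> = ?r"
    by (simp only: UNIV_4 sum.insert prod.insert sum.empty prod.empty finite.intros insert_iff empty_iff neq_4 neq_4[symmetric]
      transpose_apply_first transpose_apply_second transpose_apply_other transpose_same id_apply o_apply if_True if_False
      simp_thms not_False_eq_True mult_1_left mult_1_right add_0_right
      of_int_1 of_int_minus of_int_mult mult_minus_left mult_minus_right minus_minus)
     (simp only: algebra_simps add_uminus_conv_diff)
  finally show ?thesis .
qed


lemma pf_conj:
  assumes "transpose S = - S"
  shows "pf (F ** S ** transpose F) = det F * pf S"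
  by (simp only: entries_4 det_4 skew_entries[OF assms]) algebra

section \<open>Hermitian structures on a four-dimensional space\<close>

lemma inner_mult_transpose: "(M *v x) \<bullet> y = x \<bullet> (transpose M *v y)" for M :: "real^'n^'m"
  by (metis dot_lmul_matrix vector_transpose_matrix)

lemma inner_matrix_eqI:
  fixes M N :: "real^'n^'n"
  assumes "\<And>x y. x \<bullet> (M *v y) = x \<bullet> (N *v y)"
  shows "M = N"
proof -
  have "M *v y = N *v y" for y
    using assms vector_eq_rdot[of "M *v y" "N *v y"] by (metis inner_commute)
  then show ?thesis by (simp add: matrix_eq)
qed

lemmas matrix_mult_simps [simp] =
  bounded_bilinear.add_left[OF bounded_bilinear_matrix_matrix_mult]
  bounded_bilinear.add_right[OF bounded_bilinear_matrix_matrix_mult]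
  bounded_bilinear.diff_left[OF bounded_bilinear_matrix_matrix_mult]
  bounded_bilinear.diff_right[OF bounded_bilinear_matrix_matrix_mult]
  bounded_bilinear.minus_left[OF bounded_bilinear_matrix_matrix_mult]
  bounded_bilinear.minus_right[OF bounded_bilinear_matrix_matrix_mult]
  bounded_bilinear.scaleR_left[OF bounded_bilinear_matrix_matrix_mult]
  bounded_bilinear.scaleR_right[OF bounded_bilinear_matrix_matrix_mult]

lemma matrix_minus_vec [simp]: "(- M) *v x = - (M *v x)" "M *v (- x) = - (M *v x)" for M :: "real^'n^'m"
  by (simp_all add: vec_eq_iff matrix_vector_mult_def sum_negf)

lemma transpose_minus [simp]: "transpose (- M) = - transpose M" for M :: "real^'n^'m"
  by (simp add: vec_eq_iff transpose_def)

lemma transpose_zero [simp]: "transpose (0 :: real^'n^'m) = 0"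
  by (simp add: vec_eq_iff transpose_def)

lemma transpose_add [simp]: "transpose (M + N) = transpose M + transpose N" for M :: "real^'n^'m"
  by (simp add: vec_eq_iff transpose_def)

lemma transpose_diff [simp]: "transpose (M - N) = transpose M - transpose N" for M :: "real^'n^'m"
  by (simp add: vec_eq_iff transpose_def)

lemma transpose_scaleR [simp]: "transpose (a *\<^sub>R M) = a *\<^sub>R transpose M" for M :: "real^'n^'m"
  by (simp add: vec_eq_iff transpose_def)

lemma scaleR_matrix_vec [simp]: "(a *\<^sub>R M) *v x = a *\<^sub>R (M *v x)" for M :: "real^'n^'m"
  by (simp add: vec_eq_iff matrix_vector_mult_def sum_distrib_left mult_ac)

lemma matrix_conj_nth:
  fixes F :: "real^'n^'m"
  shows "(F ** S ** transpose F) $ i $ j = F $ i \<bullet> (S *v F $ j)"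
proof -
  have "(F ** S ** transpose F) $ i $ j = (\<Sum>l\<in>UNIV. \<Sum>k\<in>UNIV. F $ i $ k * S $ k $ l * F $ j $ l)"
    by (simp add: matrix_matrix_mult_def transpose_def sum_distrib_right)
  also have "\<dots> = (\<Sum>k\<in>UNIV. \<Sum>l\<in>UNIV. F $ i $ k * S $ k $ l * F $ j $ l)"
    by (rule sum.swap)
  also have "\<dots> = F $ i \<bullet> (S *v F $ j)"
    by (simp add: inner_vec_def matrix_vector_mult_def sum_distrib_left mult_ac)
  finally show ?thesis .
qed

text \<open>This and the next two definitions are the conditions on metric, almost complex structure
  and Kaehler form at a single point, free of charts.\<close>

definition pos_form :: "real^'n^'n \<Rightarrow> bool" where
  "pos_form G \<longleftrightarrow> transpose G = G \<and> (\<forall>X. X \<noteq> 0 \<longrightarrow> 0 < X \<bullet> (G *v X))"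

definition hermitian :: "real^'n^'n \<Rightarrow> real^'n^'n \<Rightarrow> bool" where
  "hermitian G J \<longleftrightarrow> J ** J = - mat 1 \<and> (\<forall>X Y. (J *v X) \<bullet> (G *v (J *v Y)) = X \<bullet> (G *v Y))"

definition fundamental_form :: "real^'n^'n \<Rightarrow> real^'n^'n \<Rightarrow> real^'n^'n" where
  "fundamental_form G J = transpose J ** G"

lemma hermitian_square_vec:
  assumes "hermitian G J"
  shows "J *v (J *v X) = - X"
  using assms by (simp add: hermitian_def matrix_vector_mul_assoc)

lemma pos_form_inner_commute:
  assumes "pos_form G"
  shows "X \<bullet> (G *v Y) = Y \<bullet> (G *v X)"
  by (metis assms inner_commute inner_mult_transpose pos_form_def)

lemma pos_form_nonneg:
  assumes "pos_form G"
  shows "0 \<le> X \<bullet> (G *v X)"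
  using assms by (cases "X = 0") (auto simp: pos_form_def less_imp_le)

lemma fundamental_form_inner: "X \<bullet> (fundamental_form G J *v Y) = (J *v X) \<bullet> (G *v Y)"
  by (simp add: fundamental_form_def inner_mult_transpose matrix_vector_mul_assoc)

lemma hermitian_inner_skew:
  assumes "hermitian G J"
  shows "(J *v X) \<bullet> (G *v Y) = - (X \<bullet> (G *v (J *v Y)))"
proof -
  have "(J *v X) \<bullet> (G *v (J *v (J *v Y))) = X \<bullet> (G *v (J *v Y))"
    using assms by (simp add: hermitian_def)
  then show ?thesis using hermitian_square_vec[OF assms] by simp
qed

lemma hermitianI:
  assumes "J ** J = - mat 1" "\<And>X Y. (J *v X) \<bullet> (G *v Y) = - (X \<bullet> (G *v (J *v Y)))"
  shows "hermitian G J"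
proof -
  have "J *v (J *v Y) = - Y" for Y using assms(1) by (simp add: matrix_vector_mul_assoc)
  then show ?thesis unfolding hermitian_def using assms by simp
qed

lemma hermitian_transpose_mult:
  assumes "hermitian G J"
  shows "transpose J ** G = - (G ** J)"
  by (rule inner_matrix_eqI)
    (metis (no_types) assms fundamental_form_inner fundamental_form_def hermitian_inner_skew inner_minus_right matrix_minus_vec(1)
      matrix_vector_mul_assoc)

lemma transpose_fundamental_form:
  assumes "pos_form G" "hermitian G J"
  shows "transpose (fundamental_form G J) = - fundamental_form G J"
  using assms(1) unfolding fundamental_form_def hermitian_transpose_mult[OF assms(2)]
  by (simp add: matrix_transpose_mul pos_form_def hermitian_transpose_mult[OF assms(2)])

lemma hermitian_transpose_square:
  assumes "hermitian G J"
  shows "transpose J ** transpose J = - mat 1"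
  using assms by (simp add: hermitian_def matrix_transpose_mul[symmetric])

text \<open>The vectors are rows, as in \<open>positive_acs\<close>. Orthonormality is not part of
  the definition; \<open>X\<close> and \<open>Y\<close> are arbitrary.\<close>

definition unitary_frame :: "real^4^4 \<Rightarrow> real^4 \<Rightarrow> real^4 \<Rightarrow> real^4^4" where
  "unitary_frame J X Y = vector [X, J *v X, Y, J *v Y]"

lemma unitary_frame_nth:
  "unitary_frame J X Y $ 1 = X" "unitary_frame J X Y $ 2 = J *v X"
  "unitary_frame J X Y $ 3 = Y" "unitary_frame J X Y $ 4 = J *v Y"
  by (simp_all add: unitary_frame_def vector_4)

text \<open>Conjugating by the frame gives the matrix of values of the fundamental form on the frame
  vectors, and \<open>pf_conj\<close> extracts the determinant. The right side is the defect in
  Bessel's inequality, which ties the sign of \<open>pf\<close> to the orientation.\<close>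

lemma pf_fundamental_form_times_det:
  assumes G: "pos_form G" "hermitian G J"
  shows "pf (fundamental_form G J) * det (unitary_frame J X Y) =
    (X \<bullet> (G *v X)) * (Y \<bullet> (G *v Y)) - (X \<bullet> (G *v Y))\<^sup>2 - ((J *v X) \<bullet> (G *v Y))\<^sup>2"
proof -
  let ?F = "unitary_frame J X Y"
  have e: "(?F ** fundamental_form G J ** transpose ?F) $ i $ j = (J *v ?F $ i) \<bullet> (G *v ?F $ j)" for i j
    unfolding matrix_conj_nth fundamental_form_inner ..
  have h: "(J *v X) \<bullet> (G *v (J *v Y)) = X \<bullet> (G *v Y)" for X Y
    using G(2) by (simp add: hermitian_def)
  have "pf (?F ** fundamental_form G J ** transpose ?F) =
    (X \<bullet> (G *v X)) * (Y \<bullet> (G *v Y)) - (X \<bullet> (G *v Y))\<^sup>2 - ((J *v X) \<bullet> (G *v Y))\<^sup>2"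
    unfolding pf_def e unitary_frame_nth hermitian_square_vec[OF G(2)] h
    using hermitian_inner_skew[OF G(2), of X Y]
    by (simp add: power2_eq_square)
  then show ?thesis
    using pf_conj[OF transpose_fundamental_form[OF G]] by (simp add: mult.commute)
qed

text \<open>Bessel's inequality for \<open>X\<close> and \<open>J *v X\<close>, which are
  \<open>G\<close>-orthogonal and of equal length.\<close>

lemma hermitian_Bessel:
  assumes G: "pos_form G" "hermitian G J"
  shows "(X \<bullet> (G *v Y))\<^sup>2 + ((J *v X) \<bullet> (G *v Y))\<^sup>2 \<le> (X \<bullet> (G *v X)) * (Y \<bullet> (G *v Y))"
proof (cases "X = 0")
  case False
  let ?g = "\<lambda>X Y. X \<bullet> (G *v Y)"
  have pos: "?g X X > 0" using False G(1) by (simp add: pos_form_def)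
  have jj: "?g (J *v X) (J *v X) = ?g X X" using G(2) by (simp add: hermitian_def)
  have xj: "?g X (J *v X) = 0" "?g (J *v X) X = 0"
    using hermitian_inner_skew[OF G(2), of X X] pos_form_inner_commute[OF G(1), of X "J *v X"] by simp_all
  have c: "?g Y X = ?g X Y" "?g Y (J *v X) = ?g (J *v X) Y"
    using pos_form_inner_commute[OF G(1)] by blast+
  \<comment> \<open>The component of \<open>Y\<close> orthogonal to \<open>X\<close> and
    \<open>J *v X\<close>, multiplied by the squared length of \<open>X\<close> to avoid a
    division.\<close>
  define Z where "Z = ?g X X *\<^sub>R Y - ?g X Y *\<^sub>R X - ?g (J *v X) Y *\<^sub>R (J *v X)"
  have "?g Z Z = ?g X X * (?g X X * ?g Y Y - (?g X Y)\<^sup>2 - (?g (J *v X) Y)\<^sup>2)"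
    unfolding Z_def
    by (simp add: matrix_vector_mult_diff_distrib matrix_vector_mult_scaleR inner_diff_left inner_diff_right jj xj c
        power2_eq_square algebra_simps)
  then have "0 \<le> ?g X X * (?g X X * ?g Y Y - (?g X Y)\<^sup>2 - (?g (J *v X) Y)\<^sup>2)"
    using pos_form_nonneg[OF G(1), of Z] by simp
  then show ?thesis using pos by (simp add: zero_le_mult_iff)
qed simp

lemma hermitian_frame_exists:
  fixes G :: "real^4^4"
  assumes G: "pos_form G" "hermitian G J"
  obtains X Y where "X \<bullet> (G *v X) = 1" "Y \<bullet> (G *v Y) = 1" "X \<bullet> (G *v Y) = 0" "(J *v X) \<bullet> (G *v Y) = 0"
proof -
  have unit: "\<exists>a. (a *\<^sub>R W) \<bullet> (G *v (a *\<^sub>R W)) = 1" if "W \<noteq> 0" for W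
  proof (intro exI)
    have "W \<bullet> (G *v W) > 0" using that G by (simp add: pos_form_def)
    then show "(1 / sqrt (W \<bullet> (G *v W))) *\<^sub>R W \<bullet> (G *v ((1 / sqrt (W \<bullet> (G *v W))) *\<^sub>R W)) = 1"
      by (simp add: matrix_vector_mult_scaleR)
  qed
  obtain X :: "real^4" where X: "X \<bullet> (G *v X) = 1"
    using unit[of "axis 1 1"] by (metis axis_eq_0_iff zero_neq_one)
  \<comment> \<open>Euclidean orthogonality to \<open>G *v X\<close> and
    \<open>G *v (J *v X)\<close> is \<open>G\<close>-orthogonality to \<open>X\<close> and
    \<open>J *v X\<close>; two vectors cannot span the four-dimensional space.\<close>
  have "dim {G *v X, G *v (J *v X)} \<le> card {G *v X, G *v (J *v X)}" by (rule dim_le_card') simp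
  also have "\<dots> < DIM(real^4)" by (simp add: card_insert_if)
  finally obtain W where W: "W \<noteq> 0" "\<And>y. y \<in> span {G *v X, G *v (J *v X)} \<Longrightarrow> orthogonal W y"
    using orthogonal_to_subspace_exists by blast
  then have W0: "W \<bullet> (G *v X) = 0" "W \<bullet> (G *v (J *v X)) = 0"
    by (auto simp: orthogonal_def intro!: span_base)
  then have W0': "X \<bullet> (G *v W) = 0" "(J *v X) \<bullet> (G *v W) = 0"
    using pos_form_inner_commute[OF G(1)] by metis+
  obtain a where "(a *\<^sub>R W) \<bullet> (G *v (a *\<^sub>R W)) = 1" using unit[OF W(1)] by blast
  then show thesis
    using W0' X by (intro that[of X "a *\<^sub>R W"]) (simp_all add: matrix_vector_mult_scaleR)
qed

lemma hermitian_unitary_frame_exists: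
  assumes G: "pos_form G" "hermitian G J"
  obtains X Y where "unitary_frame J X Y ** G ** transpose (unitary_frame J X Y) = mat 1"
    "pf (fundamental_form G J) * det (unitary_frame J X Y) = 1"
proof -
  obtain X Y where XY: "X \<bullet> (G *v X) = 1" "Y \<bullet> (G *v Y) = 1" "X \<bullet> (G *v Y) = 0" "(J *v X) \<bullet> (G *v Y) = 0"
    using hermitian_frame_exists[OF G] .
  have h: "(J *v X) \<bullet> (G *v (J *v Y)) = X \<bullet> (G *v Y)" for X Y
    using G(2) by (simp add: hermitian_def)
  have jx: "X \<bullet> (G *v (J *v X)) = 0" "(J *v X) \<bullet> (G *v X) = 0" for X
    using hermitian_inner_skew[OF G(2), of X X] pos_form_inner_commute[OF G(1), of X "J *v X"] by simp_all
  have r: "X \<bullet> (G *v (J *v Y)) = 0" "Y \<bullet> (G *v (J *v X)) = 0" "Y \<bullet> (G *v X) = 0" "(J *v Y) \<bullet> (G *v X) = 0"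
    using XY hermitian_inner_skew[OF G(2), of X Y] pos_form_inner_commute[OF G(1)] by auto
  have "(unitary_frame J X Y ** G ** transpose (unitary_frame J X Y)) $ i $ j = mat 1 $ i $ j" for i j
  proof -
    have "(unitary_frame J X Y ** G ** transpose (unitary_frame J X Y)) $ i $ j =
        unitary_frame J X Y $ i \<bullet> (G *v unitary_frame J X Y $ j)"
      by (rule matrix_conj_nth)
    also have "\<dots> = mat 1 $ i $ j"
      using exhaust_4[of i] exhaust_4[of j]
      by (elim disjE) (simp_all add: unitary_frame_nth mat_entries_4 XY h jx r)
    finally show ?thesis .
  qed
  then have "unitary_frame J X Y ** G ** transpose (unitary_frame J X Y) = mat 1"
    by (simp add: vec_eq_iff)
  moreover have "pf (fundamental_form G J) * det (unitary_frame J X Y) = 1"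
    unfolding pf_fundamental_form_times_det[OF G] XY by simp
  ultimately show thesis by (rule that)
qed

section \<open>Orientation and the sign of the Pfaffian\<close>

definition positive_at :: "real^4^4 \<Rightarrow> bool" where
  "positive_at J \<longleftrightarrow> (\<forall>X Y. det (unitary_frame J X Y) \<noteq> 0 \<longrightarrow> det (unitary_frame J X Y) > 0)"

text \<open>By the product formula and Bessel's inequality \<open>pf\<close> times the determinant
  of any frame \<open>X, JX, Y, JY\<close> is nonnegative. A unitary frame, where the product is 1,
  excludes that \<open>positive_at\<close> holds vacuously.\<close>

lemma positive_at_iff_pf:
  assumes G: "pos_form G" "hermitian G J"
  shows "positive_at J \<longleftrightarrow> pf (fundamental_form G J) > 0"
proof
  obtain X Y where XY: "pf (fundamental_form G J) * det (unitary_frame J X Y) = 1"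
    using hermitian_unitary_frame_exists[OF G] by blast
  assume "positive_at J"
  then have "det (unitary_frame J X Y) > 0"
    using XY unfolding positive_at_def by (metis mult_zero_right zero_neq_one)
  then show "pf (fundamental_form G J) > 0" using XY by (metis zero_less_mult_pos2 zero_less_one)
next
  assume pos: "pf (fundamental_form G J) > 0"
  have "0 \<le> det (unitary_frame J X Y)" for X Y
  proof -
    have "0 \<le> pf (fundamental_form G J) * det (unitary_frame J X Y)"
      unfolding pf_fundamental_form_times_det[OF G] using hermitian_Bessel[OF G, of X Y] by simp
    then show ?thesis using pos by (simp add: zero_le_mult_iff)
  qed
  then show "positive_at J" unfolding positive_at_def by (simp add: less_le)
qed

lemma pf_fundamental_form_square:
  assumes G: "pos_form G" "hermitian G J"
  shows "(pf (fundamental_form G J))\<^sup>2 = det G"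
proof -
  obtain X Y where F: "unitary_frame J X Y ** G ** transpose (unitary_frame J X Y) = mat 1"
    "pf (fundamental_form G J) * det (unitary_frame J X Y) = 1"
    using hermitian_unitary_frame_exists[OF G] .
  let ?d = "det (unitary_frame J X Y)"
  have "?d * det G * ?d = 1"
    using arg_cong[OF F(1), of det] by (simp add: det_mul det_transpose)
  then have "(pf (fundamental_form G J))\<^sup>2 = (pf (fundamental_form G J) * ?d)\<^sup>2 * det G"
    by (simp add: power2_eq_square algebra_simps)
  then show ?thesis using F(2) by simp
qed

text \<open>Both sides are the positive square root of \<open>det G\<close>, the Riemannian volume
  density.\<close>

lemma pf_fundamental_form_eq:
  assumes "pos_form G" "hermitian G J" "hermitian G J'" "positive_at J" "positive_at J'"
  shows "pf (fundamental_form G J) = pf (fundamental_form G J')"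
  using assms positive_at_iff_pf pf_fundamental_form_square by (metis less_le power2_eq_iff_nonneg)

text \<open>Multiply \<open>mult_pf_adj\<close> by \<open>transpose J\<close>, whose square is
  \<open>- mat 1\<close>. In the language of forms this is the self-duality of the fundamental form,
  up to the density.\<close>

lemma mult_pf_adj_fundamental_form:
  assumes G: "pos_form G" "hermitian G J"
  shows "G ** pf_adj (fundamental_form G J) = - pf (fundamental_form G J) *\<^sub>R transpose J"
proof -
  have "transpose J ** (transpose J ** G ** pf_adj (fundamental_form G J)) = transpose J ** (pf (fundamental_form G J) *\<^sub>R mat 1)"
    using mult_pf_adj[OF transpose_fundamental_form[OF G]] by (simp add: fundamental_form_def)
  then show ?thesis
    using hermitian_transpose_square[OF G(2)] by (simp add: matrix_mul_assoc) (metis minus_minus)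
qed

section \<open>The angle between two positive structures\<close>

definition cos_angle :: "real^4^4 \<Rightarrow> real^4^4 \<Rightarrow> real" where
  "cos_angle J J' = - trace (J ** J') / 4"

text \<open>In the polarized Pfaffian identity both mixed products carry the same factor, because
  the two Pfaffians agree; dividing by it makes the anticommutator a scalar, and the trace
  identifies this scalar.\<close>

lemma positive_hermitian_anticommutator:
  assumes G: "pos_form G" "hermitian G J" "hermitian G J'" "positive_at J" "positive_at J'"
  shows "J ** J' + J' ** J = (- 2 * cos_angle J J') *\<^sub>R mat 1"
    and "pf (fundamental_form G J + fundamental_form G J') - pf (fundamental_form G J) - pf (fundamental_form G J') = 2 * pf (fundamental_form G J) * cos_angle J J'"
proof -
  let ?r = "pf (fundamental_form G J)" 
  let ?k = "pf (fundamental_form G J + fundamental_form G J') - pf (fundamental_form G J) - pf (fundamental_form G J')"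
  have r: "?r > 0" "pf (fundamental_form G J') = ?r"
    using G positive_at_iff_pf pf_fundamental_form_eq by metis+
  have "fundamental_form G J ** pf_adj (fundamental_form G J') + fundamental_form G J' ** pf_adj (fundamental_form G J) = ?k *\<^sub>R mat 1"
    by (rule pf_adj_polarized) (use G transpose_fundamental_form in blast)+
  moreover have "fundamental_form G J ** pf_adj (fundamental_form G J') = - ?r *\<^sub>R (transpose J ** transpose J')"
    using mult_pf_adj_fundamental_form[OF G(1,3)] r(2) by (simp add: fundamental_form_def[of G J] matrix_mul_assoc[symmetric])
  moreover have "fundamental_form G J' ** pf_adj (fundamental_form G J) = - ?r *\<^sub>R (transpose J' ** transpose J)"
    using mult_pf_adj_fundamental_form[OF G(1,2)] by (simp add: fundamental_form_def[of G J'] matrix_mul_assoc[symmetric])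
  ultimately have "transpose (- ?r *\<^sub>R (transpose J ** transpose J') + - ?r *\<^sub>R (transpose J' ** transpose J)) =
      transpose (?k *\<^sub>R mat 1)" by simp
  then have "- ?r *\<^sub>R (J ** J' + J' ** J) = ?k *\<^sub>R mat 1"
    unfolding transpose_add transpose_scaleR transpose_mat
    by (simp add: matrix_transpose_mul scaleR_add_right add.commute)
  moreover have "M = (- k / r) *\<^sub>R N" if "r > 0" "- r *\<^sub>R M = k *\<^sub>R N" for M N :: "real^4^4" and k r
  proof -
    have "(- 1 / r) *\<^sub>R (- r *\<^sub>R M) = (- 1 / r) *\<^sub>R (k *\<^sub>R N)" by (simp only: that(2))
    then show ?thesis using that(1) by simp
  qed
  moreover define q where "q = - ?k / ?r"
  ultimately have *: "J ** J' + J' ** J = q *\<^sub>R mat 1"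
    using r(1) unfolding q_def by blast
  have tr: "trace (J ** J' + J' ** J) = 2 * trace (J ** J')"
    by (simp add: trace_add trace_mul_sym[of J'])
  have "2 * trace (J ** J') = 4 * q"
    unfolding tr[symmetric] * by (simp add: trace_4 mat_entries_4)
  then have k: "q = - 2 * cos_angle J J'" by (simp add: cos_angle_def)
  show "J ** J' + J' ** J = (- 2 * cos_angle J J') *\<^sub>R mat 1" using * unfolding k .
  have "?k = - q * ?r" using r by (simp add: q_def)
  then show "?k = 2 * ?r * cos_angle J J'" unfolding k by simp
qed

lemma pf_linear_combination:
  "pf (a *\<^sub>R S + b *\<^sub>R T) = a\<^sup>2 * pf S + b\<^sup>2 * pf T + a * b * (pf (S + T) - pf S - pf T)"
  by (simp add: pf_def power2_eq_square algebra_simps)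

text \<open>The condition on \<open>a\<close> and \<open>b\<close> describes the unit circle in the
  plane of \<open>J\<close> and \<open>J'\<close>. The anticommutator turns it into
  \<open>?L ** ?L = - mat 1\<close>, and \<open>pf\<close> restricted to this plane is a positive
  multiple of the same quadratic form.\<close>

lemma hermitian_linear_combination:
  assumes G: "pos_form G" "hermitian G J" "hermitian G J'" "positive_at J" "positive_at J'"
    and ab: "a\<^sup>2 + 2 * a * b * cos_angle J J' + b\<^sup>2 = 1"
  shows "hermitian G (a *\<^sub>R J + b *\<^sub>R J')" "positive_at (a *\<^sub>R J + b *\<^sub>R J')"
proof -
  let ?L = "a *\<^sub>R J + b *\<^sub>R J'"
  note anti = positive_hermitian_anticommutator[OF G]
  have "?L ** ?L = a\<^sup>2 *\<^sub>R (J ** J) + b\<^sup>2 *\<^sub>R (J' ** J') + (a * b) *\<^sub>R (J ** J' + J' ** J)"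
    by (simp add: power2_eq_square scaleR_add_right mult.commute)
  also have "\<dots> = - (a\<^sup>2 + 2 * a * b * cos_angle J J' + b\<^sup>2) *\<^sub>R mat 1"
    unfolding anti using G(2,3) by (simp add: hermitian_def algebra_simps)
  finally have sq: "?L ** ?L = - mat 1" unfolding ab by simp
  have skew: "(?L *v X) \<bullet> (G *v Y) = - (X \<bullet> (G *v (?L *v Y)))" for X Y
    using hermitian_inner_skew[OF G(2), of X Y] hermitian_inner_skew[OF G(3), of X Y]
    by (simp add: matrix_vector_mult_add_rdistrib inner_add_left inner_add_right
        matrix_vector_right_distrib matrix_vector_mult_scaleR)
  show L: "hermitian G ?L"
    by (rule hermitianI[OF sq skew])
  have "fundamental_form G ?L = a *\<^sub>R fundamental_form G J + b *\<^sub>R fundamental_form G J'"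
    by (simp add: fundamental_form_def)
  then have "pf (fundamental_form G ?L) = a\<^sup>2 * pf (fundamental_form G J) + b\<^sup>2 * pf (fundamental_form G J') +
      a * b * (2 * pf (fundamental_form G J) * cos_angle J J')"
    by (simp only: pf_linear_combination anti(2))
  also have "\<dots> = pf (fundamental_form G J) * (a\<^sup>2 + 2 * a * b * cos_angle J J' + b\<^sup>2)"
    unfolding pf_fundamental_form_eq[OF G, symmetric] by (simp add: algebra_simps)
  finally have "pf (fundamental_form G ?L) = pf (fundamental_form G J) * (a\<^sup>2 + 2 * a * b * cos_angle J J' + b\<^sup>2)" .
  then show "positive_at ?L"
    unfolding positive_at_iff_pf[OF G(1) L] ab using G positive_at_iff_pf by auto
qed

text \<open>The component \<open>L\<close> of \<open>J'\<close> orthogonal to \<open>J\<close> is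
  \<open>G\<close>-skew with square minus \<open>1 - f\<^sup>2\<close>, so the length of
  \<open>L *v X\<close> forces \<open>f\<^sup>2 \<le> 1\<close>.\<close>

lemma abs_cos_angle_le_1:
  assumes G: "pos_form G" "hermitian G J" "hermitian G J'" "positive_at J" "positive_at J'"
  shows "\<bar>cos_angle J J'\<bar> \<le> 1"
proof -
  let ?f = "cos_angle J J'"
  define L where "L = J' - ?f *\<^sub>R J"
  note anti = positive_hermitian_anticommutator[OF G]
  have "L ** L = J' ** J' + ?f\<^sup>2 *\<^sub>R (J ** J) - ?f *\<^sub>R (J ** J' + J' ** J)"
    by (simp add: L_def power2_eq_square algebra_simps)
  also have "\<dots> = - (1 - ?f\<^sup>2) *\<^sub>R mat 1"
    unfolding anti using G(2,3) by (simp add: hermitian_def vec_eq_iff power2_eq_square algebra_simps)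
  finally have "L ** L = - (1 - ?f\<^sup>2) *\<^sub>R mat 1" .
  then have sq: "L *v (L *v X) = - ((1 - ?f\<^sup>2) *\<^sub>R X)" for X
    by (simp only: matrix_vector_mul_assoc scaleR_matrix_vec matrix_minus_vec matrix_vector_mul_lid scaleR_minus_left)
  have skew: "(L *v X) \<bullet> (G *v Y) = - (X \<bullet> (G *v (L *v Y)))" for X Y
    using hermitian_inner_skew[OF G(2), of X Y] hermitian_inner_skew[OF G(3), of X Y]
    by (simp add: L_def matrix_vector_mult_diff_rdistrib inner_diff_left inner_diff_right
        matrix_vector_mult_diff_distrib matrix_vector_mult_scaleR)
  define X :: "real^4" where "X = axis 1 1"
  have "0 \<le> (L *v X) \<bullet> (G *v (L *v X))" by (rule pos_form_nonneg[OF G(1)])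
  also have "\<dots> = (1 - ?f\<^sup>2) * (X \<bullet> (G *v X))"
    unfolding skew sq by (simp add: matrix_vector_mult_scaleR)
  finally have "0 \<le> (1 - ?f\<^sup>2) * (X \<bullet> (G *v X))" .
  moreover have "X \<bullet> (G *v X) > 0" using G(1) by (simp add: pos_form_def X_def axis_eq_0_iff)
  ultimately have "?f\<^sup>2 \<le> 1" by (simp add: zero_le_mult_iff)
  then show ?thesis by (simp add: abs_square_le_1)
qed

section \<open>Pointwise contractions\<close>

lemma sum_rotate:
  fixes F :: "'a::finite \<Rightarrow> 'a \<Rightarrow> 'a \<Rightarrow> real"
  shows "(\<Sum>j\<in>UNIV. \<Sum>k\<in>UNIV. \<Sum>i\<in>UNIV. F i j k) = (\<Sum>i\<in>UNIV. \<Sum>j\<in>UNIV. \<Sum>k\<in>UNIV. F i j k)"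
  by (rule trans[OF sum.cong[OF refl sum.swap] sum.swap])

definition trilinear :: "('n \<Rightarrow> real^'n^'n) \<Rightarrow> real^'n \<Rightarrow> real^'n \<Rightarrow> real^'n \<Rightarrow> real" where
  "trilinear T X Y Z = (\<Sum>i\<in>UNIV. X $ i * (Y \<bullet> (T i *v Z)))"

lemma trilinear_cyclic:
  fixes T :: "'n::finite \<Rightarrow> real^'n^'n"
  assumes "\<And>i j k. T i $ j $ k + T j $ k $ i + T k $ i $ j = 0"
  shows "trilinear T X Y Z + trilinear T Y Z X + trilinear T Z X Y = 0"
proof -
  have e: "trilinear T X Y Z = (\<Sum>i\<in>UNIV. \<Sum>j\<in>UNIV. \<Sum>k\<in>UNIV. X $ i * Y $ j * Z $ k * T i $ j $ k)" for X Y Z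
    by (simp add: trilinear_def inner_vec_def matrix_vector_mult_def sum_distrib_left mult_ac)
  have "trilinear T Y Z X = (\<Sum>i\<in>UNIV. \<Sum>j\<in>UNIV. \<Sum>k\<in>UNIV. X $ i * Y $ j * Z $ k * T j $ k $ i)"
    unfolding e by (subst sum_rotate[symmetric]) (simp add: mult_ac)
  moreover have "trilinear T Z X Y = (\<Sum>i\<in>UNIV. \<Sum>j\<in>UNIV. \<Sum>k\<in>UNIV. X $ i * Y $ j * Z $ k * T k $ i $ j)"
    unfolding e by (subst sum_rotate) (simp add: mult_ac)
  ultimately have "trilinear T X Y Z + trilinear T Y Z X + trilinear T Z X Y =
     (\<Sum>i\<in>UNIV. \<Sum>j\<in>UNIV. \<Sum>k\<in>UNIV. X $ i * Y $ j * Z $ k * (T i $ j $ k + T j $ k $ i + T k $ i $ j))"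
    unfolding e by (simp add: sum.distrib[symmetric] algebra_simps)
  then show ?thesis using assms by simp
qed

text \<open>The vectors \<open>Y, IY, JY, IJY\<close> are \<open>G\<close>-orthogonal and equally
  long, hence a basis, and \<open>w\<close> is Euclidean-orthogonal to all of them.\<close>

lemma quaternionic_frame_kernel:
  fixes G :: "real^4^4"
  assumes G: "pos_form G" "hermitian G I" "hermitian G J" and IJ: "I ** J = - (J ** I)"
    and Y: "Y \<noteq> 0" and w: "w \<bullet> Y = 0" "w \<bullet> (I *v Y) = 0" "w \<bullet> (J *v Y) = 0" "w \<bullet> (I *v (J *v Y)) = 0"
  shows "w = 0"
proof -
  define F :: "real^4^4" where "F = vector [Y, I *v Y, J *v Y, I *v (J *v Y)]"
  have Fn: "F $ 1 = Y" "F $ 2 = I *v Y" "F $ 3 = J *v Y" "F $ 4 = I *v (J *v Y)"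
    by (simp_all add: F_def vector_4)
  let ?n = "Y \<bullet> (G *v Y)"
  have h: "(I *v X) \<bullet> (G *v (I *v Z)) = X \<bullet> (G *v Z)" "(J *v X) \<bullet> (G *v (J *v Z)) = X \<bullet> (G *v Z)" for X Z
    using G(2,3) by (simp_all add: hermitian_def)
  have i0: "X \<bullet> (G *v (I *v X)) = 0" "(I *v X) \<bullet> (G *v X) = 0" for X
    using hermitian_inner_skew[OF G(2), of X X] pos_form_inner_commute[OF G(1), of X "I *v X"] by simp_all
  have j0: "X \<bullet> (G *v (J *v X)) = 0" "(J *v X) \<bullet> (G *v X) = 0" for X
    using hermitian_inner_skew[OF G(3), of X X] pos_form_inner_commute[OF G(1), of X "J *v X"] by simp_all
  have ij: "I *v (J *v Y) = - (J *v (I *v Y))"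
    using IJ by (simp add: matrix_vector_mul_assoc)
  have k1: "(I *v Y) \<bullet> (G *v (J *v Y)) = 0" "(J *v Y) \<bullet> (G *v (I *v Y)) = 0"
  proof -
    have "(I *v Y) \<bullet> (G *v (J *v Y)) = - (Y \<bullet> (G *v (I *v (J *v Y))))"
      "(J *v Y) \<bullet> (G *v (I *v Y)) = - (Y \<bullet> (G *v (J *v (I *v Y))))"
      using hermitian_inner_skew G(2,3) by blast+
    moreover have "(I *v Y) \<bullet> (G *v (J *v Y)) = (J *v Y) \<bullet> (G *v (I *v Y))"
      by (rule pos_form_inner_commute[OF G(1)])
    ultimately show "(I *v Y) \<bullet> (G *v (J *v Y)) = 0" "(J *v Y) \<bullet> (G *v (I *v Y)) = 0"
      unfolding ij by simp_all
  qed
  have k2: "Y \<bullet> (G *v (I *v (J *v Y))) = 0" "(I *v (J *v Y)) \<bullet> (G *v Y) = 0"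
    using hermitian_inner_skew[OF G(2), of Y "J *v Y"] k1
      pos_form_inner_commute[OF G(1), of Y "I *v (J *v Y)"] by simp_all
  have "(F ** G ** transpose F) $ i $ j = (?n *\<^sub>R mat 1) $ i $ j" for i j
  proof -
    have "(F ** G ** transpose F) $ i $ j = F $ i \<bullet> (G *v F $ j)"
      by (rule matrix_conj_nth)
    also have "\<dots> = (?n *\<^sub>R mat 1) $ i $ j"
      using exhaust_4[of i] exhaust_4[of j]
      by (elim disjE) (simp_all add: Fn mat_entries_4 h i0 j0 k1 k2)
    finally show ?thesis .
  qed
  then have FGF: "F ** (G ** transpose F) = ?n *\<^sub>R mat 1"
    by (simp add: vec_eq_iff matrix_mul_assoc)
  have n: "?n > 0" using G(1) Y by (simp add: pos_form_def)
  have "F ** ((1 / ?n) *\<^sub>R (G ** transpose F)) = mat 1"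
    using FGF n by simp
  then have inv: "((1 / ?n) *\<^sub>R (G ** transpose F)) ** F = mat 1"
    by (simp only: matrix_left_right_inverse)
  have "F *v w = 0"
    unfolding vec_eq_iff forall_4 using w by (simp add: matrix_vector_mul_component Fn inner_commute)
  then have "((1 / ?n) *\<^sub>R (G ** transpose F)) *v (F *v w) = 0" by simp
  then show "w = 0" unfolding matrix_vector_mul_assoc inv by simp
qed

text \<open>The hypotheses on \<open>I\<close> and \<open>J\<close> make \<open>T(X,Y,\<cdot>)\<close> vanish on \<open>Y, IY, JY\<close>. With \<open>K = IJ\<close>, the cyclic identity kills
  \<open>T(X,Y,KY)\<close> for \<open>X = IY\<close> and \<open>X = JY\<close>; substituting \<open>IY\<close> and then \<open>KY\<close> for \<open>Y\<close> gives \<open>X = Y\<close> and \<open>X = KY\<close>.\<close>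

lemma cyclic_anticommuting_zero:
  fixes G :: "real^4^4"
  assumes G: "pos_form G" "hermitian G I" "hermitian G J" and IJ: "I ** J = - (J ** I)"
    and skew: "\<And>i. transpose (T i) = - T i"
    and TI: "\<And>i. transpose I ** T i ** I = - T i" and TJ: "\<And>i. transpose J ** T i ** J = - T i"
    and cyc: "\<And>i j k. T i $ j $ k + T j $ k $ i + T k $ i $ j = 0"
  shows "T i = 0"
proof -
  define t where "t = trilinear T"
  define K where "K = I ** J"
  have lin1: "t (- X) Y Z = - t X Y Z" "t X (- Y) Z = - t X Y Z" "t X Y (- Z) = - t X Y Z" for X Y Z
    by (simp_all add: t_def trilinear_def sum_negf)
  have sk: "t X Y Z = - t X Z Y" for X Y Z
  proof -
    have "Y \<bullet> (T i *v Z) = - (Z \<bullet> (T i *v Y))" for i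
      using inner_mult_transpose[of "T i" Z Y] by (simp add: skew inner_commute)
    then show ?thesis by (simp add: t_def trilinear_def sum_negf)
  qed
  have cycl: "t X Y Z + t Y Z X + t Z X Y = 0" for X Y Z
    unfolding t_def by (rule trilinear_cyclic[OF cyc])
  have inv: "t X (L *v Y) (L *v Z) = - t X Y Z" if "\<And>i. transpose L ** T i ** L = - T i" for X Y Z L
  proof -
    have "(L *v Y) \<bullet> (T i *v (L *v Z)) = - (Y \<bullet> (T i *v Z))" for i
    proof -
      have "(L *v Y) \<bullet> (T i *v (L *v Z)) = Y \<bullet> ((transpose L ** T i ** L) *v Z)"
        by (simp only: inner_mult_transpose matrix_vector_mul_assoc matrix_mul_assoc)
      then show ?thesis by (simp add: that)
    qed
    then show ?thesis by (simp add: t_def trilinear_def sum_negf)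
  qed
  note tI = inv[OF TI] and tJ = inv[OF TJ]
  have II: "I *v (I *v X) = - X" and JJ: "J *v (J *v X) = - X" for X
    using hermitian_square_vec G by blast+
  have K: "K *v X = I *v (J *v X)" for X by (simp add: K_def matrix_vector_mul_assoc)
  have JI: "J *v (I *v X) = - (K *v X)" for X
    using IJ by (simp add: K_def matrix_vector_mul_assoc)
  have YY: "t X Y Y = 0" for X Y using sk[of X Y Y] by simp
  \<comment> \<open>\<open>tI\<close> gives \<open>t X (I *v Y) Y = t X Y (I *v Y)\<close>, while
    \<open>sk\<close> says that they are opposite.\<close>
  have YI: "t X Y (I *v Y) = 0" "t X (I *v Y) Y = 0" for X Y
    using tI[of X Y "I *v Y"] sk[of X Y "I *v Y"] by (simp_all add: II lin1)
  have YJ: "t X Y (J *v Y) = 0" "t X (J *v Y) Y = 0" for X Y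
    using tJ[of X Y "J *v Y"] sk[of X Y "J *v Y"] by (simp_all add: JJ lin1)
  have c1: "t (I *v Y) Y (K *v Y) = 0" for Y
  proof -
    have "t Y (K *v Y) (I *v Y) = 0"
      using tI[of Y "J *v Y" Y] by (simp add: K YJ)
    then show ?thesis using cycl[of "I *v Y" Y "K *v Y"] YI by simp
  qed
  have c2: "t (J *v Y) Y (K *v Y) = 0" for Y
  proof -
    have "t Y (K *v Y) (J *v Y) = 0"
      using tJ[of Y "I *v Y" Y] by (simp add: JI YI lin1)
    then show ?thesis using cycl[of "J *v Y" Y "K *v Y"] YJ by simp
  qed
  have KI: "K *v (I *v X) = J *v X" for X
    unfolding K JI by (simp add: K II)
  have KK: "K *v (K *v X) = - X" for X
    unfolding K[of "K *v X"] K[of X] using JI[of "J *v X"] by (simp add: K JJ II)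
  have c3: "t Y Y (K *v Y) = 0" for Y
  proof -
    have "t Y (I *v Y) (J *v Y) = 0"
      using c1[of "I *v Y"] by (simp add: II lin1 KI)
    moreover have "J *v Y = - (I *v (K *v Y))" by (simp add: K II)
    ultimately show ?thesis using tI[of Y Y "K *v Y"] by (simp add: lin1)
  qed
  have c4: "t (K *v Y) Y (K *v Y) = 0" for Y
    using c3[of "K *v Y"] sk[of "K *v Y" "K *v Y" Y] by (simp add: KK lin1)
  have first: "t X Y Z = X \<bullet> (\<chi> i. Y \<bullet> (T i *v Z))" for X Y Z
    by (simp add: t_def trilinear_def inner_vec_def)
  have third: "t X Y Z = (\<Sum>i\<in>UNIV. X $ i *\<^sub>R (transpose (T i) *v Y)) \<bullet> Z" for X Y Z
    by (simp add: t_def trilinear_def inner_sum_left dot_lmul_matrix)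
  have "t X Y Z = 0" if "Y \<noteq> 0" for X Y Z
  proof -
    \<comment> \<open>The quaternionic basis is used twice: here it frees the first argument, making
      \<open>t X Y (K *v Y)\<close> vanish for every \<open>X\<close>; below it frees the
      third.\<close>
    have "(\<chi> i. Y \<bullet> (T i *v (K *v Y))) = 0"
      using c1[of Y] c2[of Y] c3[of Y] c4[of Y]
      by (intro quaternionic_frame_kernel[OF G IJ that]) (simp_all only: first K inner_commute[of "\<chi> i. _ i"])
    then have "t X Y (K *v Y) = 0" by (simp add: first)
    then have "(\<Sum>i\<in>UNIV. X $ i *\<^sub>R (transpose (T i) *v Y)) = 0"
      using YY[of X Y] YI[of X Y] YJ[of X Y]
      by (intro quaternionic_frame_kernel[OF G IJ that]) (simp_all only: third[symmetric] K)
    then show ?thesis by (simp add: third)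
  qed
  moreover have "t X 0 Z = 0" for X Z by (simp add: t_def trilinear_def)
  ultimately have t0: "t X Y Z = 0" for X Y Z by metis
  have "Y \<bullet> (T i *v Z) = Y \<bullet> (0 *v Z)" for Y Z
    using t0[of "axis i 1" Y Z] by (simp add: first inner_axis')
  then show ?thesis by (rule inner_matrix_eqI)
qed

text \<open>With \<open>H\<close> the inverse metric, the cyclic identity is contracted with the
  bivector \<open>J ** H\<close>. One term gives the trace; skewness makes the other two equal,
  which is the factor 2.\<close>

lemma codifferential_contraction:
  fixes G H :: "real^'n^'n"
  assumes HG: "H ** G = mat 1"
    and skewE: "\<And>i. transpose (E i) ** G = - (G ** E i)"
    and skewT: "\<And>i. transpose (transpose (E i) ** G) = - (transpose (E i) ** G)"
    and N: "transpose (J ** H) = - (J ** H)"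
    and cyc: "\<And>i j k. (transpose (E i) ** G) $ j $ k + (transpose (E j) ** G) $ k $ i + (transpose (E k) ** G) $ i $ j = 0"
  shows "trace (E l ** J) = 2 * (\<Sum>j\<in>UNIV. (J ** E j) $ j $ l)"
proof -
  define T where "T i = transpose (E i) ** G" for i
  define N where "N = J ** H"
  have GH: "G ** H = mat 1" using HG matrix_left_right_inverse by blast
  have Tskew: "T i $ j $ k = - T i $ k $ j" for i j k
    using arg_cong[OF skewT[of i], of "\<lambda>M. M $ k $ j"] by (simp add: transpose_def T_def)
  have Nskew: "N $ j $ k = - N $ k $ j" for j k
    using arg_cong[OF N, of "\<lambda>M. M $ k $ j"] by (simp add: transpose_def N_def)
  have a: "(\<Sum>j\<in>UNIV. \<Sum>k\<in>UNIV. N $ j $ k * T l $ j $ k) = trace (E l ** J)"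
  proof -
    have "(\<Sum>j\<in>UNIV. \<Sum>k\<in>UNIV. N $ j $ k * T l $ j $ k) = - trace (N ** T l)"
    proof -
      have "N $ j $ k * T l $ j $ k = - (N $ j $ k * T l $ k $ j)" for j k
        using Tskew[of l j k] by simp
      then show ?thesis by (simp add: trace_def matrix_matrix_mult_def sum_negf)
    qed
    also have "\<dots> = trace (J ** (H ** G) ** E l)"
      by (simp add: N_def T_def skewE matrix_mul_assoc) (simp add: trace_def sum_negf)
    also have "\<dots> = trace (E l ** J)" unfolding HG by (simp add: trace_mul_sym[of J])
    finally show ?thesis .
  qed
  have b: "(\<Sum>j\<in>UNIV. \<Sum>k\<in>UNIV. N $ j $ k * T j $ k $ l) = - (\<Sum>j\<in>UNIV. (J ** E j) $ j $ l)"
  proof -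
    have "(\<Sum>k\<in>UNIV. N $ j $ k * T j $ k $ l) = - (J ** E j) $ j $ l" for j
    proof -
      have "(\<Sum>k\<in>UNIV. N $ j $ k * T j $ k $ l) = (N ** T j) $ j $ l" by (simp add: matrix_matrix_mult_def)
      also have "N ** T j = - (J ** (H ** G) ** E j)" by (simp add: N_def T_def skewE matrix_mul_assoc)
      finally show ?thesis unfolding HG by simp
    qed
    then show ?thesis by (simp add: sum_negf)
  qed
  have "(\<Sum>j\<in>UNIV. \<Sum>k\<in>UNIV. N $ j $ k * T k $ l $ j) = (\<Sum>j\<in>UNIV. \<Sum>k\<in>UNIV. N $ k $ j * T k $ j $ l)"
    by (intro sum.cong refl) (metis Nskew Tskew minus_mult_minus)
  also have "\<dots> = (\<Sum>j\<in>UNIV. \<Sum>k\<in>UNIV. N $ j $ k * T j $ k $ l)"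
    by (rule sum.swap)
  finally have c: "(\<Sum>j\<in>UNIV. \<Sum>k\<in>UNIV. N $ j $ k * T k $ l $ j) = - (\<Sum>j\<in>UNIV. (J ** E j) $ j $ l)"
    unfolding b .
  have "0 = (\<Sum>j\<in>UNIV. \<Sum>k\<in>UNIV. N $ j $ k * (T l $ j $ k + T j $ k $ l + T k $ l $ j))"
    using cyc by (simp add: T_def)
  also have "\<dots> = trace (E l ** J) - 2 * (\<Sum>j\<in>UNIV. (J ** E j) $ j $ l)"
    by (simp add: distrib_left sum.distrib a b c)
  finally show ?thesis by simp
qed

text \<open>For a bivector density, torsion-freeness cancels the density term against one connection
  term; the other pairs the skew \<open>V\<close> with symbols symmetric in the same
  indices.\<close>

lemma skew_divergence_correction:
  fixes \<Gamma> :: "'n::finite \<Rightarrow> real^'n^'n"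
  assumes \<Gamma>: "\<And>i j l. \<Gamma> i $ l $ j = \<Gamma> j $ l $ i" and V: "\<And>i j. V $ i $ j = - V $ j $ i"
  shows "(\<Sum>j\<in>UNIV. (trace (\<Gamma> j) *\<^sub>R V - \<Gamma> j ** V - V ** transpose (\<Gamma> j)) $ j $ i) = 0"
proof -
  have "(\<Sum>j\<in>UNIV. (trace (\<Gamma> j) *\<^sub>R V) $ j $ i) = (\<Sum>j\<in>UNIV. \<Sum>l\<in>UNIV. \<Gamma> l $ l $ j * V $ j $ i)"
    using \<Gamma> by (simp add: trace_def sum_distrib_right)
  also have "\<dots> = (\<Sum>j\<in>UNIV. (\<Gamma> j ** V) $ j $ i)"
    by (subst sum.swap) (simp add: matrix_matrix_mult_def)
  finally have 1: "(\<Sum>j\<in>UNIV. (trace (\<Gamma> j) *\<^sub>R V) $ j $ i) = (\<Sum>j\<in>UNIV. (\<Gamma> j ** V) $ j $ i)" .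
  let ?S = "\<Sum>j\<in>UNIV. \<Sum>l\<in>UNIV. V $ j $ l * \<Gamma> j $ i $ l"
  have "?S = (\<Sum>l\<in>UNIV. \<Sum>j\<in>UNIV. V $ j $ l * \<Gamma> j $ i $ l)" by (rule sum.swap)
  also have "\<dots> = (\<Sum>l\<in>UNIV. \<Sum>j\<in>UNIV. - (V $ l $ j * \<Gamma> l $ i $ j))"
    by (intro sum.cong refl) (metis V \<Gamma> mult_minus_left)
  also have "\<dots> = - ?S" by (simp add: sum_negf)
  finally have "(\<Sum>j\<in>UNIV. (V ** transpose (\<Gamma> j)) $ j $ i) = 0"
    by (simp add: matrix_matrix_mult_def transpose_def)
  then show ?thesis using 1 by (simp add: sum_subtractf)
qed

section \<open>The equation for the angle in a chart\<close>

lemma partial_cong: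
  "open S \<Longrightarrow> x \<in> S \<Longrightarrow> (\<And>y. y \<in> S \<Longrightarrow> f y = h y) \<Longrightarrow> partial i f x = partial i h x"
  unfolding partial_def by (metis frechet_derivative_cong_open)

lemma partial_const [simp]: "partial i (\<lambda>x. c) x = 0"
  by (simp add: partial_def)

lemma partial_add:
  "f differentiable (at x) \<Longrightarrow> h differentiable (at x) \<Longrightarrow>
    partial i (\<lambda>x. f x + h x) x = partial i f x + partial i h x"
  unfolding partial_def by (intro frechet_derivative_eqI has_derivative_add has_derivative_frechet)

lemma differentiable_bounded_linear:
  "bounded_linear L \<Longrightarrow> f differentiable (at x) \<Longrightarrow> (\<lambda>x. L (f x)) differentiable (at x)"
  unfolding differentiable_def by (metis bounded_linear.has_derivative)

lemma partial_bounded_linear: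
  "bounded_linear L \<Longrightarrow> f differentiable (at x) \<Longrightarrow> partial i (\<lambda>x. L (f x)) x = L (partial i f x)"
  unfolding partial_def
  by (intro frechet_derivative_eqI bounded_linear.has_derivative[of L] has_derivative_frechet)

lemma partial_bounded_bilinear:
  "bounded_bilinear B \<Longrightarrow> f differentiable (at x) \<Longrightarrow> h differentiable (at x) \<Longrightarrow>
    partial i (\<lambda>x. B (f x) (h x)) x = B (f x) (partial i h x) + B (partial i f x) (h x)"
  unfolding partial_def
  by (rule frechet_derivative_eqI[OF bounded_bilinear.FDERIV])
    (auto intro: has_derivative_frechet)

lemma partial_sum:
  "finite A \<Longrightarrow> (\<And>a. a \<in> A \<Longrightarrow> f a differentiable (at x)) \<Longrightarrow>
    partial i (\<lambda>x. \<Sum>a\<in>A. f a x) x = (\<Sum>a\<in>A. partial i (f a) x)"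
  unfolding partial_def
  by (intro frechet_derivative_eqI has_derivative_sum has_derivative_frechet)

lemmas partial_matrix_mult = partial_bounded_bilinear[OF bounded_bilinear_matrix_matrix_mult]
lemmas partial_times = partial_bounded_bilinear[OF bounded_bilinear_mult]
lemmas partial_transpose = partial_bounded_linear[OF bounded_linear_transpose]
lemmas partial_trace = partial_bounded_linear[OF bounded_linear_trace]
lemmas partial_matrix_nth = partial_bounded_linear[OF bounded_linear_matrix_nth]

lemma smooth_on_partial: "smooth_on S f \<Longrightarrow> smooth_on S (partial i f)"
  using smooth_on_frechet_derivative unfolding partial_def[abs_def] .

lemmas smooth_on_matrix_nth = smooth_on_bounded_linear[OF _ bounded_linear_matrix_nth]

lemma bounded_linear_pf_adj: "bounded_linear pf_adj"
  by (intro linear_conv_bounded_linear[THEN iffD1] linearI)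
    (simp_all add: vec_eq_iff forall_4 pf_adj_def vector_4)

lemma smooth_on_sum:
  assumes "open S" "\<And>a. a \<in> A \<Longrightarrow> smooth_on S (f a)"
  shows "smooth_on S (\<lambda>x. \<Sum>a\<in>A. f a x)"
  using assms(2) by (induction A rule: infinite_finite_induct)
    (auto intro: smooth_on_const smooth_on_add[OF assms(1)])

lemma smooth_on_vec_lambda:
  assumes "open S" "\<And>i. smooth_on S (\<lambda>x. f x i)"
  shows "smooth_on S (\<lambda>x. (\<chi> i. f x i) :: real^'c)"
proof -
  have "smooth_on S (\<lambda>x. \<Sum>i\<in>UNIV. f x i *\<^sub>R (axis i 1 :: real^'c))"
    by (intro smooth_on_sum[OF assms(1)] smooth_on_scaleR[OF assms(1)] assms(2) smooth_on_const)
  moreover have "(\<Sum>i\<in>UNIV. f x i *\<^sub>R (axis i 1 :: real^'c)) = (\<chi> i. f x i)" for x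
    using basis_expansion[of "\<chi> i. f x i"] by (simp add: scalar_mult_eq_scaleR)
  ultimately show ?thesis by simp
qed

text \<open>Second partial derivatives are symmetric and \<open>V\<close> is skew, so exchanging
  \<open>i\<close> and \<open>j\<close> changes the sign of the double sum.\<close>

lemma second_divergence_skew:
  fixes V :: "real^'n \<Rightarrow> real^'n^'n"
  assumes U: "open U" "x \<in> U" and V: "smooth_on U V" and skew: "\<And>y i j. y \<in> U \<Longrightarrow> V y $ i $ j = - V y $ j $ i"
  shows "(\<Sum>i\<in>UNIV. \<Sum>j\<in>UNIV. partial i (partial j (\<lambda>y. V y $ j $ i)) x) = 0"
proof -
  let ?w = "\<lambda>i j y. V y $ i $ j"
  let ?S = "\<Sum>i\<in>UNIV. \<Sum>j\<in>UNIV. partial i (partial j (?w j i)) x"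
  have w: "smooth_on U (?w i j)" for i j by (rule smooth_on_matrix_nth[OF U(1) V])
  have neg: "partial i (partial j (?w j k)) x = - partial i (partial j (?w k j)) x" for i j k
  proof -
    have p: "partial j (?w j k) y = - partial j (?w k j) y" if "y \<in> U" for y
    proof -
      have "partial j (?w j k) y = partial j (\<lambda>y. - ?w k j y) y"
        by (rule partial_cong[OF U(1) that]) (rule skew)
      also have "\<dots> = - partial j (?w k j) y"
        by (rule partial_bounded_linear[OF bounded_linear_minus[OF bounded_linear_ident] smooth_on_imp_differentiable[OF w that]])
      finally show ?thesis .
    qed
    have "partial i (partial j (?w j k)) x = partial i (\<lambda>y. - partial j (?w k j) y) x"
      by (rule partial_cong[OF U p])
    also have "\<dots> = - partial i (partial j (?w k j)) x"
      by (rule partial_bounded_linear[OF bounded_linear_minus[OF bounded_linear_ident]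
            smooth_on_imp_differentiable[OF smooth_on_partial[OF w] U(2)]])
    finally show ?thesis .
  qed
  have "?S = (\<Sum>i\<in>UNIV. \<Sum>j\<in>UNIV. - partial j (partial i (?w i j)) x)"
    by (intro sum.cong refl) (metis neg partial_commute[OF U w])
  also have "\<dots> = - (\<Sum>j\<in>UNIV. \<Sum>i\<in>UNIV. partial j (partial i (?w i j)) x)"
    by (subst sum.swap) (simp add: sum_negf)
  finally show ?thesis by simp
qed

text \<open>Everything is expressed in the coordinates of one chart, with \<open>\<Gamma> i x $ l $ j\<close> for \<open>\<Gamma>\<^sup>l\<^sub>i\<^sub>j\<close>. Below, \<open>E i\<close> is
  \<open>\<nabla>\<^sub>i J'\<close>, \<open>D = \<rho> g\<inverse>\<close>, and \<open>V\<close> is the bivector \<open>P\<close> multiplied by the volume density.\<close>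

locale kahler_chart =
  fixes U :: "(real^4) set" and g J J' :: "real^4 \<Rightarrow> real^4^4" and \<Gamma> :: "4 \<Rightarrow> real^4 \<Rightarrow> real^4^4"
  assumes open_U: "open U"
    and smooth: "smooth_on U g" "smooth_on U J" "smooth_on U J'"
    and pos: "x \<in> U \<Longrightarrow> pos_form (g x)"
    and herm: "x \<in> U \<Longrightarrow> hermitian (g x) (J x)" "x \<in> U \<Longrightarrow> hermitian (g x) (J' x)"
    and positive: "x \<in> U \<Longrightarrow> positive_at (J x)" "x \<in> U \<Longrightarrow> positive_at (J' x)"
    and torsion_free: "x \<in> U \<Longrightarrow> \<Gamma> i x $ l $ j = \<Gamma> j x $ l $ i"
    and metric: "x \<in> U \<Longrightarrow> partial i g x = transpose (\<Gamma> i x) ** g x + g x ** \<Gamma> i x"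
    and parallel: "x \<in> U \<Longrightarrow> partial i J x = J x ** \<Gamma> i x - \<Gamma> i x ** J x"
    and closed: "x \<in> U \<Longrightarrow> partial i (\<lambda>y. fundamental_form (g y) (J' y)) x $ j $ k +
      partial j (\<lambda>y. fundamental_form (g y) (J' y)) x $ k $ i + partial k (\<lambda>y. fundamental_form (g y) (J' y)) x $ i $ j = 0"
begin

lemma diff: "x \<in> U \<Longrightarrow> g differentiable (at x)" "x \<in> U \<Longrightarrow> J differentiable (at x)"
  "x \<in> U \<Longrightarrow> J' differentiable (at x)"
  using smooth smooth_on_imp_differentiable by blast+

lemma smooth_fundamental_form:
  "smooth_on U (\<lambda>x. fundamental_form (g x) (J x))" "smooth_on U (\<lambda>x. fundamental_form (g x) (J' x))"
  unfolding fundamental_form_def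
  by (intro smooth_on_matrix_mult smooth_on_transpose smooth open_U)+

section \<open>First-order identities for the derivative of the second structure\<close>

definition f :: "real^4 \<Rightarrow> real" where "f x = cos_angle (J x) (J' x)"

definition E :: "4 \<Rightarrow> real^4 \<Rightarrow> real^4^4" where
  "E i x = partial i J' x + \<Gamma> i x ** J' x - J' x ** \<Gamma> i x"

lemma smooth_f: "smooth_on U f"
proof -
  have "smooth_on U (\<lambda>x. trace (J x ** J' x))"
    by (intro smooth_on_bounded_linear[OF open_U bounded_linear_trace] smooth_on_matrix_mult open_U smooth)
  from smooth_on_bounded_linear[OF open_U bounded_linear_mult_right this, of "- 1 / 4"]
  show ?thesis by (simp add: f_def[abs_def] cos_angle_def)
qed

lemma partial_J': "partial i J' x = E i x + J' x ** \<Gamma> i x - \<Gamma> i x ** J' x"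
  by (simp add: E_def)

lemma partial_mult_J:
  assumes "x \<in> U"
  shows "partial i (\<lambda>x. J x ** J' x) x = J x ** E i x + J x ** J' x ** \<Gamma> i x - \<Gamma> i x ** J x ** J' x"
    "partial i (\<lambda>x. J' x ** J x) x = E i x ** J x + J' x ** J x ** \<Gamma> i x - \<Gamma> i x ** J' x ** J x"
  using assms by (simp_all add: partial_matrix_mult diff parallel partial_J' matrix_mul_assoc)

text \<open>Since \<open>J\<close> is parallel, the connection terms form a commutator, which the
  trace kills.\<close>

lemma partial_f:
  assumes "x \<in> U"
  shows "partial i f x = - trace (J x ** E i x) / 4"
proof -
  have d: "(\<lambda>x. J x ** J' x) differentiable (at x)"
    by (rule smooth_on_imp_differentiable[OF smooth_on_matrix_mult[OF open_U smooth(2,3)] assms])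
  have "partial i f x = (- 1 / 4) * partial i (\<lambda>x. trace (J x ** J' x)) x"
    unfolding f_def[abs_def] cos_angle_def
    by (subst partial_bounded_linear[OF bounded_linear_mult_right, symmetric])
      (use d differentiable_bounded_linear[OF bounded_linear_trace d] in simp_all)
  also have "partial i (\<lambda>x. trace (J x ** J' x)) x = trace (J x ** E i x)"
    unfolding partial_trace[OF d] partial_mult_J[OF assms]
    by (simp add: trace_add trace_sub matrix_mul_assoc[symmetric] trace_mul_sym[of "\<Gamma> i x"])
  finally show ?thesis by simp
qed

lemma anticommutator: "x \<in> U \<Longrightarrow> J x ** J' x + J' x ** J x = (- 2 * f x) *\<^sub>R mat 1"
  unfolding f_def by (rule positive_hermitian_anticommutator(1)) (use pos herm positive in auto)

text \<open>Differentiate the scalar anticommutator: its connection terms form a commutator with a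
  multiple of the identity and vanish.\<close>

lemma E_anticommutator:
  assumes "x \<in> U"
  shows "J x ** E i x + E i x ** J x = (- 2 * partial i f x) *\<^sub>R mat 1"
proof -
  have d: "(\<lambda>x. J x ** J' x) differentiable (at x)" "(\<lambda>x. J' x ** J x) differentiable (at x)"
    by (rule smooth_on_imp_differentiable[OF smooth_on_matrix_mult[OF open_U] assms], rule smooth, rule smooth)+
  have "partial i (\<lambda>x. J x ** J' x + J' x ** J x) x = partial i (\<lambda>x. (- 2 * f x) *\<^sub>R mat 1) x"
    by (rule partial_cong[OF open_U assms anticommutator])
  also have "\<dots> = (- 2 * partial i f x) *\<^sub>R mat 1"
    by (rule partial_bounded_linear[OF bounded_linear_compose[OF bounded_linear_scaleR_left bounded_linear_mult_right],
          unfolded o_def, OF smooth_on_imp_differentiable[OF smooth_f assms]])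
  finally have "partial i (\<lambda>x. J x ** J' x) x + partial i (\<lambda>x. J' x ** J x) x = (- 2 * partial i f x) *\<^sub>R mat 1"
    by (simp only: partial_add[OF d])
  moreover have "(J x ** J' x) ** \<Gamma> i x + (J' x ** J x) ** \<Gamma> i x = \<Gamma> i x ** (J x ** J' x) + \<Gamma> i x ** (J' x ** J x)"
  proof -
    have "(J x ** J' x + J' x ** J x) ** \<Gamma> i x = \<Gamma> i x ** (J x ** J' x + J' x ** J x)"
      unfolding anticommutator[OF assms] by simp
    then show ?thesis by simp
  qed
  ultimately show ?thesis
    unfolding partial_mult_J[OF assms] by (simp add: matrix_mul_assoc algebra_simps)
qed

lemma E_square_zero:
  assumes "x \<in> U"
  shows "J' x ** E i x + E i x ** J' x = 0"
proof -
  have "partial i (\<lambda>x. J' x ** J' x) x = partial i (\<lambda>x. - mat 1) x"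
    by (rule partial_cong[OF open_U assms]) (use herm(2) in \<open>simp add: hermitian_def\<close>)
  then have "J' x ** E i x + E i x ** J' x + (J' x ** J' x) ** \<Gamma> i x - \<Gamma> i x ** (J' x ** J' x) = 0"
    using assms by (simp add: partial_matrix_mult diff partial_J' matrix_mul_assoc algebra_simps)
  then show ?thesis using herm(2)[OF assms] by (simp add: hermitian_def)
qed

lemma fundamental_form_derivative:
  assumes "x \<in> U"
  shows "partial i (\<lambda>y. fundamental_form (g y) (J y)) x =
      transpose (\<Gamma> i x) ** fundamental_form (g x) (J x) + fundamental_form (g x) (J x) ** \<Gamma> i x"
    and "partial i (\<lambda>y. fundamental_form (g y) (J' y)) x = transpose (E i x) ** g x +
      transpose (\<Gamma> i x) ** fundamental_form (g x) (J' x) + fundamental_form (g x) (J' x) ** \<Gamma> i x"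
  using assms
  by (simp_all add: fundamental_form_def partial_matrix_mult partial_transpose diff metric parallel partial_J'
      differentiable_bounded_linear[OF bounded_linear_transpose] matrix_transpose_mul matrix_mul_assoc algebra_simps)

lemma skew_fundamental_form: "x \<in> U \<Longrightarrow> transpose (fundamental_form (g x) (J x)) = - fundamental_form (g x) (J x)"
  "x \<in> U \<Longrightarrow> transpose (fundamental_form (g x) (J' x)) = - fundamental_form (g x) (J' x)"
  using transpose_fundamental_form pos herm by blast+

lemma E_skew:
  assumes "x \<in> U"
  shows "transpose (transpose (E i x) ** g x) = - (transpose (E i x) ** g x)"
    and "transpose (E i x) ** g x = - (g x ** E i x)"
proof -
  have d: "(\<lambda>y. fundamental_form (g y) (J' y)) differentiable (at x)"
    by (rule smooth_on_imp_differentiable[OF smooth_fundamental_form(2) assms])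
  have "partial i (\<lambda>y. transpose (fundamental_form (g y) (J' y))) x = partial i (\<lambda>y. - fundamental_form (g y) (J' y)) x"
    by (rule partial_cong[OF open_U assms skew_fundamental_form(2)])
  then have "transpose (partial i (\<lambda>y. fundamental_form (g y) (J' y)) x) = - partial i (\<lambda>y. fundamental_form (g y) (J' y)) x"
    using partial_transpose[OF d] partial_bounded_linear[OF bounded_linear_minus[OF bounded_linear_ident] d]
    by simp
  then show 1: "transpose (transpose (E i x) ** g x) = - (transpose (E i x) ** g x)"
    unfolding fundamental_form_derivative[OF assms]
    by (simp add: matrix_transpose_mul[of _ "fundamental_form _ _"] matrix_transpose_mul[of "fundamental_form _ _"] skew_fundamental_form[OF assms])
  have "transpose (g x) = g x" using pos[OF assms] by (simp add: pos_form_def)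
  then show "transpose (E i x) ** g x = - (g x ** E i x)"
    using 1 by (simp add: matrix_transpose_mul)
qed

text \<open>Torsion-freeness cancels the connection terms in the cyclic sum, so closedness of the
  2-form can be expressed with covariant derivatives.\<close>

lemma E_cyclic:
  assumes "x \<in> U"
  shows "(transpose (E i x) ** g x) $ j $ k + (transpose (E j x) ** g x) $ k $ i +
    (transpose (E k x) ** g x) $ i $ j = 0"
proof -
  define W where "W = fundamental_form (g x) (J' x)"
  have W: "W $ a $ b = - W $ b $ a" for a b
    using arg_cong[OF skew_fundamental_form(2)[OF assms], of "\<lambda>M. M $ b $ a"] by (simp add: transpose_def W_def)
  have c: "(W ** \<Gamma> a x) $ b $ c = - (transpose (\<Gamma> c x) ** W) $ a $ b" for a b c
    unfolding matrix_matrix_mult_def transpose_def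
    by (simp add: sum_negf[symmetric]) (intro sum.cong refl, metis W mult.commute mult_minus_right torsion_free[OF assms])
  show ?thesis
    using closed[OF assms, of i j k] unfolding fundamental_form_derivative[OF assms] W_def[symmetric]
    by (simp add: c)
qed

section \<open>The weighted inverse metric, the bivector and harmonicity\<close>

definition \<rho> :: "real^4 \<Rightarrow> real" where "\<rho> x = pf (fundamental_form (g x) (J x))"

definition D :: "real^4 \<Rightarrow> real^4^4" where "D x = pf_adj (fundamental_form (g x) (J x)) ** transpose (J x)"

definition V :: "real^4 \<Rightarrow> real^4^4" where "V x = (J x ** J' x + f x *\<^sub>R mat 1) ** D x"

lemma \<rho>_pos: "x \<in> U \<Longrightarrow> \<rho> x > 0"
  unfolding \<rho>_def using positive_at_iff_pf pos herm(1) positive(1) by blast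

lemma smooth_D: "smooth_on U D"
  unfolding D_def[abs_def]
  by (intro smooth_on_matrix_mult smooth_on_transpose smooth_on_bounded_linear[OF _ bounded_linear_pf_adj]
      smooth_fundamental_form smooth open_U)

lemma smooth_V: "smooth_on U V"
  unfolding V_def[abs_def]
  by (intro smooth_on_matrix_mult smooth_on_add smooth_on_scaleR smooth_on_const smooth_D smooth_f smooth open_U)

lemma D_inverse:
  assumes "x \<in> U"
  shows "g x ** D x = \<rho> x *\<^sub>R mat 1" "D x ** g x = \<rho> x *\<^sub>R mat 1"
proof -
  show 1: "g x ** D x = \<rho> x *\<^sub>R mat 1"
    using mult_pf_adj_fundamental_form[OF pos[OF assms] herm(1)[OF assms]] hermitian_transpose_square[OF herm(1)[OF assms]]
    by (simp add: D_def \<rho>_def matrix_mul_assoc)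
  then have "g x ** ((1 / \<rho> x) *\<^sub>R D x) = mat 1" using \<rho>_pos[OF assms] by simp
  then have "((1 / \<rho> x) *\<^sub>R D x) ** g x = mat 1" by (simp only: matrix_left_right_inverse)
  then have "\<rho> x *\<^sub>R (((1 / \<rho> x) *\<^sub>R D x) ** g x) = \<rho> x *\<^sub>R mat 1" by simp
  then show "D x ** g x = \<rho> x *\<^sub>R mat 1" using \<rho>_pos[OF assms] by simp
qed

text \<open>For a unitary frame \<open>F\<close> the inverse of \<open>g x\<close> is
  \<open>transpose F ** F\<close>; scaling by \<open>sqrt (\<rho> x)\<close> gives the factor
  required by the maximum principle.\<close>

lemma D_factorization:
  assumes "x \<in> U"
  shows "\<exists>B :: real^4^4. invertible B \<and> D x = B ** transpose B"
proof -
  obtain X Y where "unitary_frame (J x) X Y ** g x ** transpose (unitary_frame (J x) X Y) = mat 1"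
    using hermitian_unitary_frame_exists[OF pos[OF assms] herm(1)[OF assms]] by blast
  then obtain F :: "real^4^4" where F: "F ** g x ** transpose F = mat 1" by blast
  have inv: "(g x ** transpose F) ** F = mat 1" "(transpose F ** F) ** g x = mat 1"
  proof -
    show 1: "(g x ** transpose F) ** F = mat 1"
      using F matrix_left_right_inverse by (metis matrix_mul_assoc)
    then have "g x ** (transpose F ** F) = mat 1" by (simp add: matrix_mul_assoc)
    then show "(transpose F ** F) ** g x = mat 1" using matrix_left_right_inverse by blast
  qed
  have "D x = (transpose F ** F) ** (g x ** D x)"
    using inv(2) by (simp add: matrix_mul_assoc)
  also have "\<dots> = (sqrt (\<rho> x) *\<^sub>R transpose F) ** transpose (sqrt (\<rho> x) *\<^sub>R transpose F)"
    using \<rho>_pos[OF assms] unfolding D_inverse[OF assms] by (simp add: transpose_transpose)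
  finally have "D x = (sqrt (\<rho> x) *\<^sub>R transpose F) ** transpose (sqrt (\<rho> x) *\<^sub>R transpose F)" .
  moreover have "invertible (sqrt (\<rho> x) *\<^sub>R transpose F)"
  proof -
    have "((1 / sqrt (\<rho> x)) *\<^sub>R (F ** g x)) ** (sqrt (\<rho> x) *\<^sub>R transpose F) = mat 1"
      using F \<rho>_pos[OF assms] by simp
    then show ?thesis by (metis invertible_left_inverse)
  qed
  ultimately show ?thesis by blast
qed

lemma transpose_D: "x \<in> U \<Longrightarrow> transpose (D x) = D x"
  using D_factorization by (metis matrix_transpose_mul transpose_transpose)

lemma V_skew:
  assumes "x \<in> U"
  shows "V x $ i $ j = - V x $ j $ i"
proof -
  define P where "P = J x ** J' x + f x *\<^sub>R mat 1"
  have tg: "transpose (J x) ** g x = - (g x ** J x)" "transpose (J' x) ** g x = - (g x ** J' x)"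
    using hermitian_transpose_mult herm assms by blast+
  have "transpose P ** g x = transpose (J' x) ** (transpose (J x) ** g x) + f x *\<^sub>R g x"
    by (simp add: P_def matrix_transpose_mul matrix_mul_assoc transpose_mat)
  also have "\<dots> = - ((transpose (J' x) ** g x) ** J x) + f x *\<^sub>R g x"
    unfolding tg(1) by (simp add: matrix_mul_assoc)
  also have "\<dots> = g x ** (J' x ** J x) + f x *\<^sub>R g x"
    unfolding tg(2) by (simp add: matrix_mul_assoc)
  also have "J' x ** J x = (- 2 * f x) *\<^sub>R mat 1 - J x ** J' x"
    using anticommutator[OF assms] by (simp add: algebra_simps)
  also have "g x ** \<dots> + f x *\<^sub>R g x = - (g x ** P)"
    by (simp add: P_def algebra_simps) (simp add: vec_eq_iff)
  \<comment> \<open>So far \<open>P\<close> is skew with respect to \<open>g x\<close>. Multiplying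
    by \<open>D x\<close> on both sides raises the indices, up to the positive factor
    \<open>\<rho> x\<close>.\<close>
  finally have "D x ** (transpose P ** g x) ** D x = - (D x ** (g x ** P) ** D x)" by simp
  moreover have "D x ** (transpose P ** g x) ** D x = \<rho> x *\<^sub>R (D x ** transpose P)"
  proof -
    have "D x ** (transpose P ** g x) ** D x = (D x ** transpose P) ** (g x ** D x)"
      by (simp only: matrix_mul_assoc)
    then show ?thesis by (simp add: D_inverse[OF assms])
  qed
  moreover have "D x ** (g x ** P) ** D x = \<rho> x *\<^sub>R (P ** D x)"
    by (simp add: matrix_mul_assoc D_inverse[OF assms])
  ultimately have "\<rho> x *\<^sub>R (D x ** transpose P) = \<rho> x *\<^sub>R (- (P ** D x))" by simp
  then have "D x ** transpose P = - (P ** D x)"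
    using \<rho>_pos[OF assms] by (metis less_irrefl scaleR_left_imp_eq)
  moreover have "transpose (P ** D x) = D x ** transpose P"
    by (simp add: matrix_transpose_mul transpose_D[OF assms])
  ultimately have "transpose (V x) = - V x" by (simp add: V_def P_def)
  from arg_cong[OF this, of "\<lambda>M. M $ j $ i"] show ?thesis by (simp add: transpose_def)
qed

lemma partial_D:
  assumes "x \<in> U"
  shows "partial i D x = trace (\<Gamma> i x) *\<^sub>R D x - \<Gamma> i x ** D x - D x ** transpose (\<Gamma> i x)"
proof -
  have d: "(\<lambda>x. fundamental_form (g x) (J x)) differentiable (at x)"
    by (rule smooth_on_imp_differentiable[OF smooth_fundamental_form(1) assms])
  have "partial i D x = pf_adj (fundamental_form (g x) (J x)) ** partial i (\<lambda>x. transpose (J x)) x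
      + partial i (\<lambda>x. pf_adj (fundamental_form (g x) (J x))) x ** transpose (J x)"
    unfolding D_def[abs_def]
    by (intro partial_matrix_mult differentiable_bounded_linear[OF bounded_linear_pf_adj d]
        differentiable_bounded_linear[OF bounded_linear_transpose] diff assms)
  also have "\<dots> = pf_adj (fundamental_form (g x) (J x)) ** transpose (J x ** \<Gamma> i x - \<Gamma> i x ** J x)
      + (trace (\<Gamma> i x) *\<^sub>R pf_adj (fundamental_form (g x) (J x)) - \<Gamma> i x ** pf_adj (fundamental_form (g x) (J x))
        - pf_adj (fundamental_form (g x) (J x)) ** transpose (\<Gamma> i x)) ** transpose (J x)"
    unfolding partial_bounded_linear[OF bounded_linear_pf_adj d] fundamental_form_derivative[OF assms]
      pf_adj_derivation[OF skew_fundamental_form(1)[OF assms]] partial_transpose[OF diff(2)[OF assms]] parallel[OF assms] ..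
  also have "\<dots> = trace (\<Gamma> i x) *\<^sub>R D x - \<Gamma> i x ** D x - D x ** transpose (\<Gamma> i x)"
    by (simp add: D_def matrix_transpose_mul matrix_mul_assoc)
  finally show ?thesis .
qed

text \<open>The connection terms of both factors combine into the correction of
  \<open>skew_divergence_correction\<close>, leaving only covariant derivatives of the first
  factor.\<close>

lemma partial_V:
  assumes "x \<in> U"
  shows "partial i V x = (J x ** E i x + partial i f x *\<^sub>R mat 1) ** D x +
    (trace (\<Gamma> i x) *\<^sub>R V x - \<Gamma> i x ** V x - V x ** transpose (\<Gamma> i x))"
proof -
  have d: "(\<lambda>x. J x ** J' x) differentiable (at x)" "(\<lambda>x. f x *\<^sub>R mat 1 :: real^4^4) differentiable (at x)"
    "(\<lambda>x. J x ** J' x + f x *\<^sub>R mat 1) differentiable (at x)" "D differentiable (at x)"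
    by (rule smooth_on_imp_differentiable[OF _ assms], intro smooth_on_matrix_mult smooth_on_add smooth_on_scaleR
        smooth_on_const smooth_D smooth_f smooth open_U)+
  have "partial i (\<lambda>x. f x *\<^sub>R mat 1 :: real^4^4) x = partial i f x *\<^sub>R mat 1"
    by (rule partial_bounded_linear[OF bounded_linear_scaleR_left smooth_on_imp_differentiable[OF smooth_f assms]])
  then have dP: "partial i (\<lambda>x. J x ** J' x + f x *\<^sub>R mat 1) x =
      J x ** E i x + J x ** J' x ** \<Gamma> i x - \<Gamma> i x ** J x ** J' x + partial i f x *\<^sub>R mat 1"
    unfolding partial_add[OF d(1,2)] partial_mult_J[OF assms] by simp
  show ?thesis
    unfolding V_def[abs_def] partial_matrix_mult[OF d(3,4)] dP partial_D[OF assms]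
    by (simp add: matrix_mul_assoc algebra_simps)
qed

lemma trace_E:
  assumes "x \<in> U"
  shows "(\<Sum>j\<in>UNIV. (J x ** E j x) $ j $ l) = - 2 * partial l f x"
proof -
  let ?H = "(1 / \<rho> x) *\<^sub>R D x"
  have HG: "?H ** g x = mat 1" using D_inverse[OF assms] \<rho>_pos[OF assms] by simp
  have N: "transpose (J x ** ?H) = - (J x ** ?H)"
  proof -
    have "J x ** D x = J x ** pf_adj (fundamental_form (g x) (J x)) ** transpose (J x)"
      by (simp add: D_def matrix_mul_assoc)
    moreover have "transpose (pf_adj S) = - pf_adj S" for S
      by (simp add: vec_eq_iff forall_4 pf_adj_def vector_4 transpose_def)
    ultimately have "transpose (J x ** D x) = - (J x ** D x)"
      by (simp add: matrix_transpose_mul matrix_mul_assoc transpose_transpose)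
    then show ?thesis by simp
  qed
  have "trace (E l x ** J x) = 2 * (\<Sum>j\<in>UNIV. (J x ** E j x) $ j $ l)"
    by (rule codifferential_contraction[OF HG E_skew(2)[OF assms] E_skew(1)[OF assms] N E_cyclic[OF assms]])
  then show ?thesis unfolding partial_f[OF assms] trace_mul_sym[of "E l x"] by simp
qed

lemma divergence_V:
  assumes "x \<in> U"
  shows "(\<Sum>j\<in>UNIV. partial j (\<lambda>y. V y $ j $ i) x) = - (\<Sum>l\<in>UNIV. D x $ l $ i * partial l f x)"
proof -
  have dV: "V differentiable (at x)" by (rule smooth_on_imp_differentiable[OF smooth_V assms])
  have "(\<Sum>j\<in>UNIV. partial j (\<lambda>y. V y $ j $ i) x) =
      (\<Sum>j\<in>UNIV. ((J x ** E j x + partial j f x *\<^sub>R mat 1) ** D x) $ j $ i) +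
      (\<Sum>j\<in>UNIV. (trace (\<Gamma> j x) *\<^sub>R V x - \<Gamma> j x ** V x - V x ** transpose (\<Gamma> j x)) $ j $ i)"
    unfolding partial_matrix_nth[OF dV] partial_V[OF assms] by (simp add: sum.distrib)
  also have "(\<Sum>j\<in>UNIV. (trace (\<Gamma> j x) *\<^sub>R V x - \<Gamma> j x ** V x - V x ** transpose (\<Gamma> j x)) $ j $ i) = 0"
    using skew_divergence_correction[of "\<lambda>j. \<Gamma> j x" "V x" i] torsion_free[OF assms] V_skew[OF assms] by blast
  also have "(\<Sum>j\<in>UNIV. ((J x ** E j x + partial j f x *\<^sub>R mat 1) ** D x) $ j $ i) =
      (\<Sum>j\<in>UNIV. \<Sum>l\<in>UNIV. (J x ** E j x) $ j $ l * D x $ l $ i) + (\<Sum>j\<in>UNIV. partial j f x * D x $ j $ i)"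
    by (simp add: sum.distrib[symmetric]) (simp add: matrix_matrix_mult_def)
  also have "(\<Sum>j\<in>UNIV. \<Sum>l\<in>UNIV. (J x ** E j x) $ j $ l * D x $ l $ i) =
      (\<Sum>l\<in>UNIV. (\<Sum>j\<in>UNIV. (J x ** E j x) $ j $ l) * D x $ l $ i)"
    unfolding sum_distrib_right by (rule sum.swap)
  finally show ?thesis
    unfolding trace_E[OF assms]
    by (simp add: sum.distrib[symmetric] sum_negf[symmetric] mult_ac)
qed

definition b :: "real^4 \<Rightarrow> real^4" where
  "b x = (\<chi> l. \<Sum>i\<in>UNIV. partial i (\<lambda>y. D y $ l $ i) x)"

text \<open>Differentiate \<open>divergence_V\<close> once more: the left side is the double
  divergence of a skew matrix, and \<open>b\<close> collects the derivatives of \<open>D\<close> in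
  the expansion of the right side.\<close>

lemma elliptic_equation:
  assumes "x \<in> U"
  shows "elliptic_operator D b f x = 0"
proof -
  have sm: "smooth_on U (partial l f)" "smooth_on U (\<lambda>y. D y $ l $ i)"
    "smooth_on U (partial j (\<lambda>y. V y $ k $ i))" for i j k l
    by (intro smooth_on_partial smooth_f smooth_on_matrix_nth[OF open_U] smooth_D smooth_V)+
  note dsm = sm[THEN smooth_on_imp_differentiable, OF assms]
  have dmult: "(\<lambda>y. D y $ l $ i * partial l f y) differentiable (at x)" for i l
    by (intro differentiable_mult dsm)
  have "partial i (\<lambda>y. \<Sum>j\<in>UNIV. partial j (\<lambda>y. V y $ j $ i) y) x =
      partial i (\<lambda>y. - (\<Sum>l\<in>UNIV. D y $ l $ i * partial l f y)) x" for i
    by (rule partial_cong[OF open_U assms divergence_V])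
  moreover have "partial i (\<lambda>y. \<Sum>j\<in>UNIV. partial j (\<lambda>y. V y $ j $ i) y) x =
      (\<Sum>j\<in>UNIV. partial i (partial j (\<lambda>y. V y $ j $ i)) x)" for i
    by (intro partial_sum dsm) simp
  moreover have "partial i (\<lambda>y. - (\<Sum>l\<in>UNIV. D y $ l $ i * partial l f y)) x =
      - (\<Sum>l\<in>UNIV. D x $ l $ i * partial i (partial l f) x + partial i (\<lambda>y. D y $ l $ i) x * partial l f x)" for i
  proof -
    have "partial i (\<lambda>y. - (\<Sum>l\<in>UNIV. D y $ l $ i * partial l f y)) x =
        - partial i (\<lambda>y. \<Sum>l\<in>UNIV. D y $ l $ i * partial l f y) x"
      by (rule partial_bounded_linear[OF bounded_linear_minus[OF bounded_linear_ident]])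
        (intro differentiable_sum finite dmult ballI)
    also have "partial i (\<lambda>y. \<Sum>l\<in>UNIV. D y $ l $ i * partial l f y) x =
        (\<Sum>l\<in>UNIV. D x $ l $ i * partial i (partial l f) x + partial i (\<lambda>y. D y $ l $ i) x * partial l f x)"
      by (subst partial_sum) (simp_all add: dmult partial_times dsm)
    finally show ?thesis .
  qed
  ultimately have "(\<Sum>i\<in>UNIV. \<Sum>j\<in>UNIV. partial i (partial j (\<lambda>y. V y $ j $ i)) x) =
      - (\<Sum>i\<in>UNIV. \<Sum>l\<in>UNIV. D x $ l $ i * partial i (partial l f) x + partial i (\<lambda>y. D y $ l $ i) x * partial l f x)"
    by (simp add: sum_negf)
  also have "(\<Sum>i\<in>UNIV. \<Sum>l\<in>UNIV. D x $ l $ i * partial i (partial l f) x + partial i (\<lambda>y. D y $ l $ i) x * partial l f x)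
      = elliptic_operator D b f x"
    by (subst sum.swap) (simp add: elliptic_operator_def b_def sum.distrib sum_distrib_right)
  finally show ?thesis
    using second_divergence_skew[OF open_U assms smooth_V V_skew] by simp
qed

lemma open_maximum_set:
  assumes "\<And>x. x \<in> U \<Longrightarrow> f x \<le> M"
  shows "open {x\<in>U. f x = M}"
proof (rule strong_maximum_principle[OF open_U smooth_f])
  show "continuous_on U D" by (rule smooth_on_imp_continuous_on[OF smooth_D])
  show "continuous_on U b"
    unfolding b_def[abs_def]
    by (intro smooth_on_imp_continuous_on smooth_on_vec_lambda smooth_on_sum smooth_on_partial smooth_on_matrix_nth
        open_U smooth_D)
qed (use D_factorization elliptic_equation assms in auto)

lemma parallel_if_constant_angle:
  assumes const: "\<And>x. x \<in> U \<Longrightarrow> f x = c" and c: "c\<^sup>2 < 1" and "x \<in> U"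
  shows "E i x = 0"
proof -
  define s where "s = sqrt (1 - c\<^sup>2)"
  have s: "s > 0" "s\<^sup>2 = 1 - c\<^sup>2" using c by (simp_all add: s_def)
  \<comment> \<open>The Gram-Schmidt orthonormalization of \<open>J'\<close>, with \<open>s\<close>
    the sine of the angle. It anticommutes with \<open>J x\<close> and, being a combination of
    \<open>J x\<close> and \<open>J' x\<close>, with \<open>E i x\<close>.\<close>
  define K where "K = (- c / s) *\<^sub>R J x + (1 / s) *\<^sub>R J' x"
  have "partial i f x = partial i (\<lambda>x. c) x" for i
    by (rule partial_cong[OF open_U \<open>x \<in> U\<close> const])
  then have JE: "E i x ** J x = - (J x ** E i x)" for i
    using E_anticommutator[OF \<open>x \<in> U\<close>, of i] by (simp add: add_eq_0_iff)
  have J'E: "E i x ** J' x = - (J' x ** E i x)" for i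
    using E_square_zero[OF \<open>x \<in> U\<close>, of i] by (simp add: add_eq_0_iff)
  have KE: "E i x ** K = - (K ** E i x)" for i
    by (simp add: K_def JE J'E)
  have ang: "cos_angle (J x) (J' x) = c" using const[OF \<open>x \<in> U\<close>] by (simp add: f_def)
  have K: "hermitian (g x) K"
    unfolding K_def
  proof (rule hermitian_linear_combination(1)[OF pos herm positive])
    show "(- c / s)\<^sup>2 + 2 * (- c / s) * (1 / s) * cos_angle (J x) (J' x) + (1 / s)\<^sup>2 = 1"
    proof -
      have "(- c / s)\<^sup>2 + 2 * (- c / s) * (1 / s) * c + (1 / s)\<^sup>2 = (1 - c\<^sup>2) / s\<^sup>2"
        using s(1) by (simp add: field_simps power2_eq_square)
      then show ?thesis unfolding ang using s c by simp
    qed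
  qed (rule \<open>x \<in> U\<close>)+
  have JK: "J x ** K = - (K ** J x)"
  proof -
    have "J x ** K + K ** J x = (2 * (- c / s)) *\<^sub>R (J x ** J x) + (1 / s) *\<^sub>R (J x ** J' x + J' x ** J x)"
      unfolding K_def by (simp add: vec_eq_iff algebra_simps)
    also have "\<dots> = 0"
      unfolding anticommutator[OF \<open>x \<in> U\<close>] const[OF \<open>x \<in> U\<close>]
      using herm(1)[OF \<open>x \<in> U\<close>] by (simp add: hermitian_def vec_eq_iff)
    finally show ?thesis by (simp add: add_eq_0_iff2)
  qed
  have anti: "transpose L ** (transpose (E i x) ** g x) ** L = - (transpose (E i x) ** g x)"
    if L: "hermitian (g x) L" "\<And>i. E i x ** L = - (L ** E i x)" for L i
  proof -
    have "transpose L ** (transpose (E i x) ** g x) ** L = transpose L ** transpose (E i x) ** (g x ** L)"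
      by (simp only: matrix_mul_assoc)
    also have "\<dots> = - (transpose L ** transpose (E i x) ** (transpose L ** g x))"
      using hermitian_transpose_mult[OF L(1)] by simp
    also have "transpose L ** transpose (E i x) = - (transpose (E i x) ** transpose L)"
      using arg_cong[OF L(2)[of i], of transpose] by (simp add: matrix_transpose_mul)
    also have "- (\<dots> ** (transpose L ** g x)) = transpose (E i x) ** (transpose L ** transpose L) ** g x"
      by (simp add: matrix_mul_assoc)
    finally show ?thesis using hermitian_transpose_square[OF L(1)] by simp
  qed
  have "transpose (E i x) ** g x = 0"
    by (rule cyclic_anticommuting_zero[OF pos[OF \<open>x \<in> U\<close>] herm(1)[OF \<open>x \<in> U\<close>] K JK
          E_skew(1)[OF \<open>x \<in> U\<close>] anti[OF herm(1)[OF \<open>x \<in> U\<close>] JE] anti[OF K KE] E_cyclic[OF \<open>x \<in> U\<close>]])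
  then have "(transpose (E i x) ** g x) ** D x = 0" by simp
  then have "transpose (E i x) ** (g x ** D x) = 0" by (simp only: matrix_mul_assoc)
  then have "transpose (E i x) = 0" using \<rho>_pos[OF \<open>x \<in> U\<close>] by (simp add: D_inverse[OF \<open>x \<in> U\<close>])
  then show ?thesis by (metis transpose_transpose transpose_zero)
qed

end

section \<open>Globalization\<close>

lemma chart_facts:
  assumes "is_chart c"
  shows "open (snd c ` fst c)" "open (fst c)"
    "x \<in> snd c ` fst c \<Longrightarrow> chart_inv c x \<in> fst c" "x \<in> snd c ` fst c \<Longrightarrow> snd c (chart_inv c x) = x"
    "p \<in> fst c \<Longrightarrow> chart_inv c (snd c p) = p" "continuous_on (fst c) (snd c)"
  using assms unfolding is_chart_def homeomorphism_def by auto

section \<open>Covariant derivatives in a single chart\<close>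

lemma pd_eq_partial: "pd c i f p = partial i (f \<circ> chart_inv c) (snd c p)"
  by (simp add: pd_def partial_def)

lemma pd_matrix_nth:
  assumes "(M \<circ> chart_inv c) differentiable (at (snd c p))"
  shows "pd c i (\<lambda>q. M q $ j $ k) p = partial i (M \<circ> chart_inv c) (snd c p) $ j $ k"
  using partial_matrix_nth[OF assms] by (simp add: pd_eq_partial o_def)

definition christoffel_matrix :: "('m, 'n::finite) tensor2 \<Rightarrow> ('m, 'n) chart \<Rightarrow> 'm \<Rightarrow> 'n \<Rightarrow> real^'n^'n" where
  "christoffel_matrix g c p i = (\<chi> l j. christoffel g c p l i j)"

definition nabla :: "('m, 'n::finite) tensor2 \<Rightarrow> ('m, 'n) tensor2 \<Rightarrow> ('m, 'n) chart \<Rightarrow> 'm \<Rightarrow> 'n \<Rightarrow> real^'n^'n" where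
  "nabla g J c p i = partial i (J c \<circ> chart_inv c) (snd c p) +
    christoffel_matrix g c p i ** J c p - J c p ** christoffel_matrix g c p i"

locale riemannian_chart =
  fixes A :: "('m::{t2_space,second_countable_topology}, 'n::finite) chart set" and g :: "('m, 'n) tensor2"
    and c :: "('m, 'n) chart"
  assumes atlas: "smooth_atlas A" and metric: "riemannian_metric A g" and c: "c \<in> A"
begin

lemma is_chart: "is_chart c"
  using atlas c by (simp add: smooth_atlas_def)

lemmas chart = chart_facts[OF is_chart]

lemma in_image: "p \<in> fst c \<Longrightarrow> snd c p \<in> snd c ` fst c"
  by (rule imageI)

lemma differentiable_in_chart:
  "smooth_in_chart c (J c) \<Longrightarrow> p \<in> fst c \<Longrightarrow> (J c \<circ> chart_inv c) differentiable (at (snd c p))"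
  unfolding smooth_in_chart_def by (rule smooth_on_imp_differentiable[OF _ in_image])

lemma continuous_on_chart:
  assumes "smooth_in_chart c f"
  shows "continuous_on (fst c) f"
proof -
  have "continuous_on (snd c ` fst c) (f \<circ> chart_inv c)"
    using assms unfolding smooth_in_chart_def by (rule smooth_on_imp_continuous_on)
  from continuous_on_compose[OF chart(6) this]
  have "continuous_on (fst c) (\<lambda>p. (f \<circ> chart_inv c) (snd c p))" by (simp add: o_def)
  then show ?thesis
    by (rule continuous_on_eq) (simp add: chart(5))
qed

lemma smooth_g: "smooth_in_chart c (g c)"
  using metric c by (auto simp: riemannian_metric_def bilinear_field_def)

lemma pos_form_g: "p \<in> fst c \<Longrightarrow> pos_form (g c p)"
  using metric c by (auto simp: riemannian_metric_def pos_form_def)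

lemma christoffel_matrix_symmetric:
  "p \<in> fst c \<Longrightarrow> christoffel_matrix g c p i $ l $ j = christoffel_matrix g c p j $ l $ i"
  using christoffel_levi_civita[OF atlas metric c, of p "christoffel g c p"]
  by (auto simp: christoffel_matrix_def)

lemma partial_metric:
  assumes "p \<in> fst c"
  shows "partial i (g c \<circ> chart_inv c) (snd c p) =
    transpose (christoffel_matrix g c p i) ** g c p + g c p ** christoffel_matrix g c p i"
proof -
  have "\<forall>i j k. pd c i (\<lambda>q. g c q $ j $ k) p =
      (\<Sum>l\<in>UNIV. christoffel g c p l i j * g c p $ l $ k) + (\<Sum>l\<in>UNIV. christoffel g c p l i k * g c p $ j $ l)"
    using christoffel_levi_civita[OF atlas metric c assms, of "christoffel g c p"] by blast
  then show ?thesis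
    unfolding pd_matrix_nth[of "g c", OF differentiable_in_chart[of g, OF smooth_g assms]]
    by (simp add: vec_eq_iff matrix_matrix_mult_def transpose_def christoffel_matrix_def mult.commute)
qed

lemma smooth_kahler_form:
  assumes "smooth_in_chart c (J c)"
  shows "smooth_in_chart c (kahler_form g J c)"
  using assms smooth_g
    smooth_on_matrix_mult[OF chart(1) smooth_on_transpose[OF chart(1), of "J c \<circ> chart_inv c"], of "g c \<circ> chart_inv c"]
  by (simp add: smooth_in_chart_def kahler_form_def o_def)

lemma partial_kahler_form:
  assumes "smooth_in_chart c (J c)" "p \<in> fst c"
  shows "partial i (kahler_form g J c \<circ> chart_inv c) (snd c p) =
    transpose (nabla g J c p i) ** g c p + transpose (christoffel_matrix g c p i) ** kahler_form g J c p
      + kahler_form g J c p ** christoffel_matrix g c p i"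
proof -
  note d = differentiable_in_chart[of J, OF assms] differentiable_in_chart[of g, OF smooth_g assms(2)]
  have e: "kahler_form g J c \<circ> chart_inv c = (\<lambda>x. transpose ((J c \<circ> chart_inv c) x) ** (g c \<circ> chart_inv c) x)"
    by (simp add: fun_eq_iff kahler_form_def)
  show ?thesis
    unfolding e partial_matrix_mult[OF differentiable_bounded_linear[OF bounded_linear_transpose d(1)] d(2)]
      partial_transpose[OF d(1)] partial_metric[OF assms(2)]
    by (simp add: nabla_def kahler_form_def chart(5)[OF assms(2)] matrix_transpose_mul matrix_mul_assoc algebra_simps)
qed

lemma covariant_derivative_kahler_form:
  assumes "smooth_in_chart c (J c)" "p \<in> fst c"
  shows "covariant_derivative g (kahler_form g J) c p i j k = (transpose (nabla g J c p i) ** g c p) $ j $ k"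
proof -
  have "covariant_derivative g (kahler_form g J) c p i j k =
    (partial i (kahler_form g J c \<circ> chart_inv c) (snd c p) - transpose (christoffel_matrix g c p i) ** kahler_form g J c p
      - kahler_form g J c p ** christoffel_matrix g c p i) $ j $ k"
    unfolding covariant_derivative_def
      pd_matrix_nth[of "kahler_form g J c", OF differentiable_in_chart[of "kahler_form g J", OF smooth_kahler_form[of J, OF assms(1)] assms(2)]]
    by (simp add: matrix_matrix_mult_def transpose_def christoffel_matrix_def mult.commute)
  then show ?thesis unfolding partial_kahler_form[of J, OF assms] by simp
qed

lemma covariant_derivative_zero_iff:
  assumes "smooth_in_chart c (J c)" "p \<in> fst c"
  shows "(\<forall>j k. covariant_derivative g (kahler_form g J) c p i j k = 0) \<longleftrightarrow> nabla g J c p i = 0"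
proof
  assume "\<forall>j k. covariant_derivative g (kahler_form g J) c p i j k = 0"
  then have "transpose (nabla g J c p i) ** g c p = 0"
    unfolding covariant_derivative_kahler_form[of J, OF assms] by (simp add: vec_eq_iff)
  then have "transpose (nabla g J c p i) ** (g c p ** matrix_inv (g c p)) = 0"
    by (simp add: matrix_mul_assoc)
  then show "nabla g J c p i = 0"
    using matrix_inv_mult(2)[OF riemannian_metric_invertible[OF metric c assms(2)]]
    by (metis matrix_mul_rid transpose_transpose transpose_zero)
next
  assume "nabla g J c p i = 0"
  then show "\<forall>j k. covariant_derivative g (kahler_form g J) c p i j k = 0"
    unfolding covariant_derivative_kahler_form[of J, OF assms] by (simp add: transpose_zero)
qed

end

text \<open>The metric is parallel and invertible, so the Kaehler form is parallel exactly when the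
  endomorphism is; the latter formulation is linear and obeys the Leibniz rule.\<close>

lemma kahler_iff_nabla:
  assumes "smooth_atlas A" "riemannian_metric A g" "endomorphism_field A J"
  shows "kahler A g J \<longleftrightarrow> (\<forall>c\<in>A. \<forall>p\<in>fst c. \<forall>i. nabla g J c p i = 0)"
proof -
  have "(\<forall>i j k. covariant_derivative g (kahler_form g J) c p i j k = 0) \<longleftrightarrow> (\<forall>i. nabla g J c p i = 0)"
    if "c \<in> A" "p \<in> fst c" for c p
  proof -
    interpret riemannian_chart A g c by unfold_locales (use assms that in auto)
    show ?thesis
      using covariant_derivative_zero_iff[of J p] assms(3) that by (auto simp: endomorphism_field_def)
  qed
  then show ?thesis unfolding kahler_def by blast
qed

lemma orthogonal_acs_iff:
  "orthogonal_acs A g J \<longleftrightarrow> endomorphism_field A J \<and> (\<forall>c\<in>A. \<forall>p\<in>fst c. hermitian (g c p) (J c p))"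
  by (auto simp: orthogonal_acs_def hermitian_def)

lemma positive_acs_iff: "positive_acs A J \<longleftrightarrow> (\<forall>c\<in>A. \<forall>p\<in>fst c. positive_at (J c p))"
  by (simp add: positive_acs_def positive_at_def unitary_frame_def Let_def)

text \<open>The \<open>G\<close>-adjoint of a hermitian \<open>J\<close> is \<open>- J\<close>, so
  the metric drops out of the formula.\<close>

lemma hilbert_schmidt_eq_cos_angle:
  assumes "invertible G" "hermitian G J"
  shows "1/4 * hilbert_schmidt G J J' = cos_angle J J'"
proof -
  have "matrix_inv G ** transpose J ** G = matrix_inv G ** (transpose J ** G)"
    by (simp only: matrix_mul_assoc)
  also have "\<dots> = - J"
    unfolding hermitian_transpose_mult[OF assms(2)] using matrix_inv_mult(1)[OF assms(1)]
    by (simp add: matrix_mul_assoc)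
  finally have "hilbert_schmidt G J J' = trace (- (J ** J'))" by (simp add: hilbert_schmidt_def)
  then show ?thesis by (simp add: cos_angle_def trace_def sum_negf)
qed

section \<open>From charts to the compact manifold\<close>

locale kahler_almost_kahler =
  fixes A :: "('m::{t2_space,second_countable_topology}, 4) chart set" and g J\<^sub>0 J\<^sub>1 :: "('m, 4) tensor2"
  assumes conn: "connected (UNIV :: 'm set)" and comp: "compact (UNIV :: 'm set)"
    and oriented: "oriented_atlas A" and g: "riemannian_metric A g"
    and J0: "orthogonal_acs A g J\<^sub>0" "positive_acs A J\<^sub>0"
    and J1: "orthogonal_acs A g J\<^sub>1" "positive_acs A J\<^sub>1"
    and K0: "kahler A g J\<^sub>0" and aK1: "almost_kahler A g J\<^sub>1"
begin

lemma atlas: "smooth_atlas A"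
  using oriented by (simp add: oriented_atlas_def)

lemma riemannian_chart: "c \<in> A \<Longrightarrow> riemannian_chart A g c"
  by (simp add: riemannian_chart_def atlas g)

lemma endo: "endomorphism_field A J\<^sub>0" "endomorphism_field A J\<^sub>1"
  using J0(1) J1(1) by (simp_all add: orthogonal_acs_iff)

lemma pointwise:
  assumes "c \<in> A" "p \<in> fst c"
  shows "pos_form (g c p)" "hermitian (g c p) (J\<^sub>0 c p)" "hermitian (g c p) (J\<^sub>1 c p)"
    "positive_at (J\<^sub>0 c p)" "positive_at (J\<^sub>1 c p)"
  using assms J0 J1 riemannian_chart.pos_form_g[OF riemannian_chart] 
  by (auto simp: orthogonal_acs_iff positive_acs_iff)

lemma smooth_J: "c \<in> A \<Longrightarrow> smooth_in_chart c (J\<^sub>0 c)" "c \<in> A \<Longrightarrow> smooth_in_chart c (J\<^sub>1 c)"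
  using endo by (auto simp: endomorphism_field_def)

lemma kahler_chart:
  assumes "c \<in> A"
  shows "kahler_chart (snd c ` fst c) (g c \<circ> chart_inv c) (J\<^sub>0 c \<circ> chart_inv c) (J\<^sub>1 c \<circ> chart_inv c)
    (\<lambda>i x. christoffel_matrix g c (chart_inv c x) i)"
proof -
  interpret riemannian_chart A g c by (rule riemannian_chart[OF assms])
  have nabla0: "nabla g J\<^sub>0 c p i = 0" if "p \<in> fst c" for p i
    using K0 assms that kahler_iff_nabla[OF atlas g endo(1)] by blast
  have form: "(\<lambda>y. fundamental_form ((g c \<circ> chart_inv c) y) ((J\<^sub>1 c \<circ> chart_inv c) y)) = kahler_form g J\<^sub>1 c \<circ> chart_inv c"
    by (simp add: fun_eq_iff fundamental_form_def kahler_form_def)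
  show ?thesis
  proof (unfold_locales, goal_cases)
    case 1 then show ?case by (rule chart(1))
  next
    case 2 then show ?case using smooth_g by (simp add: smooth_in_chart_def)
  next
    case 3 then show ?case using smooth_J(1)[OF assms] by (simp add: smooth_in_chart_def)
  next
    case 4 then show ?case using smooth_J(2)[OF assms] by (simp add: smooth_in_chart_def)
  next
    case (5 x) then show ?case using pointwise(1)[OF assms] chart(3) by simp
  next
    case (6 x) then show ?case using pointwise(2)[OF assms] chart(3) by simp
  next
    case (7 x) then show ?case using pointwise(3)[OF assms] chart(3) by simp
  next
    case (8 x) then show ?case using pointwise(4)[OF assms] chart(3) by simp
  next
    case (9 x) then show ?case using pointwise(5)[OF assms] chart(3) by simp
  next
    case (10 x i l j) then show ?case using christoffel_matrix_symmetric[OF chart(3)] by blast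
  next
    case (11 x i) then show ?case using partial_metric[OF chart(3)] chart(4) by simp
  next
    case (12 x i) then show ?case
      using nabla0[OF chart(3), of x i] by (simp add: nabla_def chart(4) algebra_simps)
  next
    case (13 x i j k)
    have "exterior_derivative (kahler_form g J\<^sub>1) c (chart_inv c x) i j k = 0"
      using aK1 assms chart(3)[OF 13] by (simp add: almost_kahler_def)
    then show ?case
      unfolding form exterior_derivative_def
        pd_matrix_nth[of "kahler_form g J\<^sub>1 c", OF differentiable_in_chart[of "kahler_form g J\<^sub>1",
            OF smooth_kahler_form[of J\<^sub>1, OF smooth_J(2)[OF assms]] chart(3)[OF 13]]]
      by (simp add: chart(4)[OF 13])
  qed
qed

lemma angle_eq:
  assumes "c \<in> A" "p \<in> fst c"
  shows "angle A g J\<^sub>0 J\<^sub>1 p = arccos (cos_angle (J\<^sub>0 c p) (J\<^sub>1 c p))"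
proof -
  define c' where "c' = (SOME c. c \<in> A \<and> p \<in> fst c)"
  have c': "c' \<in> A" "p \<in> fst c'"
    using someI[of "\<lambda>c. c \<in> A \<and> p \<in> fst c" c] assms by (auto simp: c'_def)
  have "angle A g J\<^sub>0 J\<^sub>1 p = arccos (1/4 * hilbert_schmidt (g c' p) (J\<^sub>0 c' p) (J\<^sub>1 c' p))"
    by (simp add: angle_def c'_def Let_def)
  also have "hilbert_schmidt (g c' p) (J\<^sub>0 c' p) (J\<^sub>1 c' p) = hilbert_schmidt (g c p) (J\<^sub>0 c p) (J\<^sub>1 c p)"
    by (rule hilbert_schmidt_chart_indep[OF oriented g endo c'(1) assms(1) c'(2) assms(2)])
  finally show ?thesis
    using hilbert_schmidt_eq_cos_angle[OF riemannian_metric_invertible[OF g assms] pointwise(2)[OF assms]] by simp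
qed

lemma cos_angle_eq:
  assumes "c \<in> A" "p \<in> fst c"
  shows "cos (angle A g J\<^sub>0 J\<^sub>1 p) = cos_angle (J\<^sub>0 c p) (J\<^sub>1 c p)"
  unfolding angle_eq[OF assms]
  by (rule cos_arccos_abs[OF abs_cos_angle_le_1[OF pointwise[OF assms]]])

lemma chart_at: obtains c where "c \<in> A" "p \<in> fst c"
  using atlas unfolding smooth_atlas_def by (metis UNIV_I UN_E)

lemma angle_constant: "\<exists>\<theta>. \<forall>p. angle A g J\<^sub>0 J\<^sub>1 p = \<theta>"
proof -
  \<comment> \<open>The cosine agrees in every chart with the smooth function \<open>f\<close>,
    whereas \<open>arccos\<close> is not differentiable at the ends of its range.\<close>
  define \<phi> where "\<phi> p = cos (angle A g J\<^sub>0 J\<^sub>1 p)" for p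
  have local: "continuous_on (fst c) \<phi>" "(\<And>p. \<phi> p \<le> M) \<Longrightarrow> open {p \<in> fst c. \<phi> p = M}" "open (fst c)"
    if c: "c \<in> A" for c M
  proof -
    interpret riemannian_chart A g c by (rule riemannian_chart[OF c])
    interpret kahler_chart "snd c ` fst c" "g c \<circ> chart_inv c" "J\<^sub>0 c \<circ> chart_inv c" "J\<^sub>1 c \<circ> chart_inv c"
      "\<lambda>i x. christoffel_matrix g c (chart_inv c x) i" by (rule kahler_chart[OF c])
    have \<phi>: "\<phi> p = f (snd c p)" if "p \<in> fst c" for p
      by (simp add: \<phi>_def cos_angle_eq[OF c that] f_def chart(5)[OF that])
    have "continuous_on (fst c) (\<lambda>p. f (snd c p))"
      by (rule continuous_on_compose2[OF smooth_on_imp_continuous_on[OF smooth_f] chart(6)]) auto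
    then show "continuous_on (fst c) \<phi>" by (rule continuous_on_eq) (simp add: \<phi>)
    show op: "open (fst c)" by (rule chart(2))
    assume le: "\<And>p. \<phi> p \<le> M"
    have "f x \<le> M" if "x \<in> snd c ` fst c" for x using that le \<phi> by (metis imageE)
    from open_maximum_set[OF this] have "open (snd c -` {x \<in> snd c ` fst c. f x = M} \<inter> fst c)"
      using chart(6) op continuous_on_open_vimage by blast
    moreover have "snd c -` {x \<in> snd c ` fst c. f x = M} \<inter> fst c = {p \<in> fst c. \<phi> p = M}"
      using \<phi> by auto
    ultimately show "open {p \<in> fst c. \<phi> p = M}" by simp
  qed
  have cont: "continuous_on UNIV \<phi>"
  proof -
    have "isCont \<phi> p" for p
      using chart_at[of p] local(1,3) continuous_on_eq_continuous_at by metis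
    then show ?thesis by (simp add: continuous_at_imp_continuous_on)
  qed
  obtain q where q: "\<And>p. \<phi> p \<le> \<phi> q"
    using continuous_attains_sup[OF comp UNIV_not_empty cont] by auto
  have "{p. \<phi> p = \<phi> q} = (\<Union>c\<in>A. {p \<in> fst c. \<phi> p = \<phi> q})"
    using chart_at by blast
  moreover have "open (\<Union>c\<in>A. {p \<in> fst c. \<phi> p = \<phi> q})"
    using local(2)[OF _ q] by blast
  ultimately have "open {p. \<phi> p = \<phi> q}" by simp
  moreover have "closed {p. \<phi> p = \<phi> q}"
    using continuous_closed_preimage_constant[OF cont closed_UNIV, of "\<phi> q"] by simp
  moreover have "\<forall>T :: 'm set. open T \<and> closed T \<longrightarrow> T = {} \<or> T = UNIV"
    using conn unfolding connected_clopen by simp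
  ultimately have "{p. \<phi> p = \<phi> q} = {} \<or> {p. \<phi> p = \<phi> q} = UNIV"
    by blast
  then have "\<phi> p = \<phi> q" for p by blast
  then have "angle A g J\<^sub>0 J\<^sub>1 p = arccos (\<phi> q)" for p
  proof -
    assume *: "\<And>p. \<phi> p = \<phi> q"
    obtain c where c: "c \<in> A" "p \<in> fst c" by (rule chart_at)
    show ?thesis
      using angle_eq[OF c] cos_angle_eq[OF c] *[of p] by (simp add: \<phi>_def)
  qed
  then show ?thesis by blast
qed

text \<open>Because the angle is constant, one pair of constants works at all points, and smoothness
  and the transformation law pass to the combination.\<close>

lemma orthogonal_acs_combination:
  assumes \<theta>: "\<And>p. angle A g J\<^sub>0 J\<^sub>1 p = \<theta>" and ab: "a\<^sup>2 + 2 * a * b * cos \<theta> + b\<^sup>2 = 1"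
  shows "orthogonal_acs A g (\<lambda>c p. a *\<^sub>R J\<^sub>0 c p + b *\<^sub>R J\<^sub>1 c p)" "positive_acs A (\<lambda>c p. a *\<^sub>R J\<^sub>0 c p + b *\<^sub>R J\<^sub>1 c p)"
proof -
  have "endomorphism_field A (\<lambda>c p. a *\<^sub>R J\<^sub>0 c p + b *\<^sub>R J\<^sub>1 c p)"
    unfolding endomorphism_field_def
  proof (intro conjI ballI)
    fix c assume c: "c \<in> A"
    interpret riemannian_chart A g c by (rule riemannian_chart[OF c])
    show "smooth_in_chart c (\<lambda>p. a *\<^sub>R J\<^sub>0 c p + b *\<^sub>R J\<^sub>1 c p)"
      using smooth_J[OF c] unfolding smooth_in_chart_def o_def
      by (intro smooth_on_add smooth_on_scaleR smooth_on_const chart(1))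
  next
    fix c c' p assume "c \<in> A" "c' \<in> A" "p \<in> fst c \<inter> fst c'"
    then show "(a *\<^sub>R J\<^sub>0 c' p + b *\<^sub>R J\<^sub>1 c' p) ** transition_jac c c' p =
        transition_jac c c' p ** (a *\<^sub>R J\<^sub>0 c p + b *\<^sub>R J\<^sub>1 c p)"
      using endo by (simp add: endomorphism_field_def)
  qed
  moreover have "hermitian (g c p) (a *\<^sub>R J\<^sub>0 c p + b *\<^sub>R J\<^sub>1 c p)" "positive_at (a *\<^sub>R J\<^sub>0 c p + b *\<^sub>R J\<^sub>1 c p)"
    if "c \<in> A" "p \<in> fst c" for c p
    using hermitian_linear_combination[OF pointwise[OF that]] ab cos_angle_eq[OF that] \<theta> by auto
  ultimately show "orthogonal_acs A g (\<lambda>c p. a *\<^sub>R J\<^sub>0 c p + b *\<^sub>R J\<^sub>1 c p)"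
    "positive_acs A (\<lambda>c p. a *\<^sub>R J\<^sub>0 c p + b *\<^sub>R J\<^sub>1 c p)"
    by (auto simp: orthogonal_acs_iff positive_acs_iff)
qed

lemma homotopic:
  assumes \<theta>: "\<And>p. angle A g J\<^sub>0 J\<^sub>1 p = \<theta>" and s: "sin \<theta> \<noteq> 0"
  shows "homotopic_acs A g J\<^sub>0 J\<^sub>1"
proof -
  \<comment> \<open>These are the coefficients of \<open>cos (s * \<theta>)\<close> times J_0 plus
    \<open>sin (s * \<theta>)\<close> times J_1', after J_1' = (J_1 - cos \<theta> J_0) / sin
    \<theta> is expanded.\<close>
  define a where "a s = cos (s * \<theta>) - sin (s * \<theta>) * cos \<theta> / sin \<theta>" for s
  define b where "b s = sin (s * \<theta>) / sin \<theta>" for s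
  have ab: "(a s)\<^sup>2 + 2 * a s * b s * cos \<theta> + (b s)\<^sup>2 = 1" for s
  proof -
    define C S where "C = cos (s * \<theta>)" and "S = sin (s * \<theta>)"
    have CS: "C\<^sup>2 + S\<^sup>2 = 1" by (simp add: C_def S_def)
    have "(a s)\<^sup>2 + 2 * a s * b s * cos \<theta> + (b s)\<^sup>2 = C\<^sup>2 + S\<^sup>2 * ((1 - (cos \<theta>)\<^sup>2) / (sin \<theta>)\<^sup>2)"
      unfolding a_def b_def C_def[symmetric] S_def[symmetric]
      using s by (simp add: field_simps power2_eq_square)
    also have "(1 - (cos \<theta>)\<^sup>2) / (sin \<theta>)\<^sup>2 = 1" using s by (simp add: sin_squared_eq[symmetric])
    finally show ?thesis using CS by simp
  qed
  have cont: "continuous_on ({0..1} \<times> fst c) (\<lambda>(s, p). a s *\<^sub>R J\<^sub>0 c p + b s *\<^sub>R J\<^sub>1 c p)" if c: "c \<in> A" for c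
  proof -
    interpret riemannian_chart A g c by (rule riemannian_chart[OF c])
    have "continuous_on ({0..1} \<times> fst c) (\<lambda>x. a (fst x))" "continuous_on ({0..1} \<times> fst c) (\<lambda>x. b (fst x))"
      unfolding a_def b_def using s by (auto intro!: continuous_intros)
    moreover have "continuous_on ({0..1} \<times> fst c) (\<lambda>x. J\<^sub>0 c (snd x))" "continuous_on ({0..1} \<times> fst c) (\<lambda>x. J\<^sub>1 c (snd x))"
      by (rule continuous_on_compose2[OF continuous_on_chart continuous_on_snd[OF continuous_on_id]],
          rule smooth_J, rule c, auto)+
    ultimately show ?thesis
      unfolding case_prod_beta by (intro continuous_on_add continuous_on_scaleR)
  qed
  show ?thesis
    unfolding homotopic_acs_def
  proof (intro exI[of _ "\<lambda>s c p. a s *\<^sub>R J\<^sub>0 c p + b s *\<^sub>R J\<^sub>1 c p"] conjI ballI)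
    show "a 0 *\<^sub>R J\<^sub>0 c p + b 0 *\<^sub>R J\<^sub>1 c p = J\<^sub>0 c p" "a 1 *\<^sub>R J\<^sub>0 c p + b 1 *\<^sub>R J\<^sub>1 c p = J\<^sub>1 c p" for c p
      using s by (simp_all add: a_def b_def)
  qed (use orthogonal_acs_combination[OF \<theta> ab] cont in auto)
qed

lemma hyper_kahler:
  assumes \<theta>: "\<And>p. angle A g J\<^sub>0 J\<^sub>1 p = \<theta>" and s: "sin \<theta> \<noteq> 0"
  shows "define_hyper_kahler A g J\<^sub>0 J\<^sub>1"
proof -
  define a b where "a = - cos \<theta> / sin \<theta>" and "b = 1 / sin \<theta>"
  define J where "J = (\<lambda>c p. a *\<^sub>R J\<^sub>0 c p + b *\<^sub>R J\<^sub>1 c p)"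
  define K where "K = (\<lambda>c p. J\<^sub>0 c p ** J c p)"
  have J_eq: "orthonormalized A g J\<^sub>0 J\<^sub>1 = J"
    using \<theta> by (simp add: fun_eq_iff orthonormalized_def J_def a_def b_def algebra_simps)
  have ab: "a\<^sup>2 + 2 * a * b * cos \<theta> + b\<^sup>2 = 1"
  proof -
    have "a\<^sup>2 + 2 * a * b * cos \<theta> + b\<^sup>2 = (1 - (cos \<theta>)\<^sup>2) / (sin \<theta>)\<^sup>2"
      unfolding a_def b_def using s by (simp add: field_simps power2_eq_square)
    then show ?thesis using s by (simp add: sin_squared_eq[symmetric])
  qed
  have J: "orthogonal_acs A g J"
    unfolding J_def by (rule orthogonal_acs_combination(1)[OF \<theta> ab])
  then have endoJ: "endomorphism_field A J" by (simp add: orthogonal_acs_iff)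
  have sq: "J\<^sub>0 c p ** J\<^sub>0 c p = - mat 1" "J c p ** J c p = - mat 1" if "c \<in> A" "p \<in> fst c" for c p
    using J0(1) J that by (auto simp: orthogonal_acs_def)
  have anti: "J c p ** J\<^sub>0 c p = - (J\<^sub>0 c p ** J c p)" if "c \<in> A" "p \<in> fst c" for c p
  proof -
    have "J\<^sub>0 c p ** J c p + J c p ** J\<^sub>0 c p =
        (2 * a) *\<^sub>R (J\<^sub>0 c p ** J\<^sub>0 c p) + b *\<^sub>R (J\<^sub>0 c p ** J\<^sub>1 c p + J\<^sub>1 c p ** J\<^sub>0 c p)"
      unfolding J_def by (simp add: vec_eq_iff algebra_simps)
    also have "\<dots> = 0"
      unfolding positive_hermitian_anticommutator(1)[OF pointwise[OF that]] sq[OF that]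
        cos_angle_eq[OF that, symmetric] \<theta>
      by (simp add: vec_eq_iff a_def b_def)
    finally show ?thesis by (simp add: add_eq_0_iff)
  qed
  have comm: "J\<^sub>0 c p ** K c p = - (K c p ** J\<^sub>0 c p)" "J c p ** K c p = - (K c p ** J c p)"
    "K c p ** K c p = - mat 1" if "c \<in> A" "p \<in> fst c" for c p
  proof -
    note sq = sq[OF that] and anti = anti[OF that]
    have "K c p ** J\<^sub>0 c p = J c p"
    proof -
      have "K c p ** J\<^sub>0 c p = J\<^sub>0 c p ** (J c p ** J\<^sub>0 c p)" by (simp only: K_def matrix_mul_assoc)
      also have "\<dots> = - ((J\<^sub>0 c p ** J\<^sub>0 c p) ** J c p)" by (simp add: anti matrix_mul_assoc)
      finally show ?thesis by (simp add: sq)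
    qed
    moreover have "J\<^sub>0 c p ** K c p = - J c p" by (simp add: K_def matrix_mul_assoc sq)
    ultimately show "J\<^sub>0 c p ** K c p = - (K c p ** J\<^sub>0 c p)" by simp
    have JK: "J c p ** K c p = J\<^sub>0 c p"
    proof -
      have "J c p ** K c p = (J c p ** J\<^sub>0 c p) ** J c p" by (simp only: K_def matrix_mul_assoc)
      also have "\<dots> = - (J\<^sub>0 c p ** (J c p ** J c p))" by (simp add: anti matrix_mul_assoc)
      finally show ?thesis by (simp add: sq)
    qed
    moreover have "K c p ** J c p = - J\<^sub>0 c p" by (simp add: K_def matrix_mul_assoc[symmetric] sq)
    ultimately show "J c p ** K c p = - (K c p ** J c p)" by simp
    have "K c p ** K c p = J\<^sub>0 c p ** (J c p ** K c p)"
      unfolding K_def by (simp only: matrix_mul_assoc)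
    then show "K c p ** K c p = - mat 1" by (simp add: JK sq)
  qed
  have endoK: "endomorphism_field A K"
    unfolding endomorphism_field_def
  proof (intro conjI ballI)
    fix c assume c: "c \<in> A"
    interpret riemannian_chart A g c by (rule riemannian_chart[OF c])
    show "smooth_in_chart c (K c)"
      using smooth_J(1)[OF c] endoJ c unfolding smooth_in_chart_def o_def K_def endomorphism_field_def
      by (intro smooth_on_matrix_mult chart(1)) auto
  next
    fix c c' p assume c: "c \<in> A" "c' \<in> A" "p \<in> fst c \<inter> fst c'"
    let ?B = "transition_jac c c' p"
    have "J\<^sub>0 c' p ** ?B = ?B ** J\<^sub>0 c p" "J c' p ** ?B = ?B ** J c p"
      using endo(1) endoJ c by (simp_all add: endomorphism_field_def)
    then have "J\<^sub>0 c' p ** (J c' p ** ?B) = ?B ** J\<^sub>0 c p ** J c p"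
      by (simp add: matrix_mul_assoc)
    then show "K c' p ** ?B = ?B ** K c p"
      by (simp add: K_def matrix_mul_assoc)
  qed
  have K: "orthogonal_acs A g K"
    unfolding orthogonal_acs_iff
  proof (intro conjI endoK ballI)
    fix c p assume cp: "c \<in> A" "p \<in> fst c"
    have "(K c p *v X) \<bullet> (g c p *v (K c p *v Y)) = X \<bullet> (g c p *v Y)" for X Y
    proof -
      have "K c p *v X = J\<^sub>0 c p *v (J c p *v X)" for X by (simp add: K_def matrix_vector_mul_assoc)
      then show ?thesis using J0(1) J cp by (simp add: orthogonal_acs_def del: matrix_vector_mul_assoc)
    qed
    then show "hermitian (g c p) (K c p)" using comm(3)[OF cp] by (simp add: hermitian_def)
  qed
  have c2: "(cos \<theta>)\<^sup>2 < 1" using s by (simp add: cos_squared_eq)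
  have nablaJ: "nabla g J\<^sub>0 c p i = 0" "nabla g J c p i = 0" "nabla g K c p i = 0" if cp: "c \<in> A" "p \<in> fst c" for c p i
  proof -
    interpret riemannian_chart A g c by (rule riemannian_chart[OF cp(1)])
    interpret kahler_chart "snd c ` fst c" "g c \<circ> chart_inv c" "J\<^sub>0 c \<circ> chart_inv c" "J\<^sub>1 c \<circ> chart_inv c"
      "\<lambda>i x. christoffel_matrix g c (chart_inv c x) i" by (rule kahler_chart[OF cp(1)])
    show n0: "nabla g J\<^sub>0 c p i = 0"
      using K0 cp kahler_iff_nabla[OF atlas g endo(1)] by blast
    have const: "f x = cos \<theta>" if "x \<in> snd c ` fst c" for x
      using cos_angle_eq[OF cp(1) chart(3)[OF that]] \<theta> by (simp add: f_def)
    \<comment> \<open>Here almost Kaehler becomes Kaehler: constancy of the angle together with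
      \<open>c2\<close> makes J_1 parallel.\<close>
    have n1: "nabla g J\<^sub>1 c p i = 0"
      using parallel_if_constant_angle[OF const c2 in_image[OF cp(2)], of i]
      by (simp add: E_def nabla_def chart(5)[OF cp(2)])
    note d = differentiable_in_chart[of J\<^sub>0, OF smooth_J(1)[OF cp(1)] cp(2)]
      differentiable_in_chart[of J\<^sub>1, OF smooth_J(2)[OF cp(1)] cp(2)]
    have eJ: "J c \<circ> chart_inv c = (\<lambda>x. a *\<^sub>R (J\<^sub>0 c \<circ> chart_inv c) x + b *\<^sub>R (J\<^sub>1 c \<circ> chart_inv c) x)"
      by (simp add: J_def fun_eq_iff)
    have pJ: "partial i (J c \<circ> chart_inv c) (snd c p) =
        a *\<^sub>R partial i (J\<^sub>0 c \<circ> chart_inv c) (snd c p) + b *\<^sub>R partial i (J\<^sub>1 c \<circ> chart_inv c) (snd c p)"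
      unfolding eJ
      by (simp only: partial_add[OF differentiable_bounded_linear[OF bounded_linear_scaleR_right d(1)]
            differentiable_bounded_linear[OF bounded_linear_scaleR_right d(2)]]
          partial_bounded_linear[OF bounded_linear_scaleR_right d(1)] partial_bounded_linear[OF bounded_linear_scaleR_right d(2)])
    have "nabla g J c p i = a *\<^sub>R nabla g J\<^sub>0 c p i + b *\<^sub>R nabla g J\<^sub>1 c p i"
      unfolding nabla_def pJ by (simp add: J_def algebra_simps)
    then show nJ: "nabla g J c p i = 0" using n0 n1 by simp
    have dJ: "(J c \<circ> chart_inv c) differentiable (at (snd c p))"
      using endoJ cp by (intro differentiable_in_chart) (auto simp: endomorphism_field_def)
    have eK: "K c \<circ> chart_inv c = (\<lambda>x. (J\<^sub>0 c \<circ> chart_inv c) x ** (J c \<circ> chart_inv c) x)"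
      by (simp add: K_def fun_eq_iff)
    \<comment> \<open>Leibniz rule: the connection terms between the two factors cancel, so the
      product of parallel endomorphisms is parallel.\<close>
    have "nabla g K c p i = J\<^sub>0 c p ** nabla g J c p i + nabla g J\<^sub>0 c p i ** J c p"
      unfolding nabla_def eK partial_matrix_mult[OF d(1) dJ]
      by (simp add: K_def chart(5)[OF cp(2)] matrix_mul_assoc algebra_simps)
    then show "nabla g K c p i = 0" using n0 nJ by simp
  qed
  have "kahler A g J\<^sub>0" "kahler A g J" "kahler A g K"
    using nablaJ kahler_iff_nabla[OF atlas g] endo(1) endoJ endoK by blast+
  then have "hyper_kahler A g J\<^sub>0 J K"
    unfolding hyper_kahler_def anticommuting_def using J0(1) J K anti comm by auto
  then show ?thesis
    unfolding define_hyper_kahler_def J_eq Let_def K_def .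
qed

end

theorem proposition1p2:
  fixes A :: "('m::{t2_space,second_countable_topology}, 4) chart set"
    and g J\<^sub>0 J\<^sub>1 :: "('m, 4) tensor2"
  assumes "connected (UNIV :: 'm set)" and "compact (UNIV :: 'm set)"
    and "oriented_atlas A" and "riemannian_metric A g"
    and "orthogonal_acs A g J\<^sub>0" and "positive_acs A J\<^sub>0"
    and "orthogonal_acs A g J\<^sub>1" and "positive_acs A J\<^sub>1"
    and "kahler A g J\<^sub>0" and "almost_kahler A g J\<^sub>1"
  shows "\<exists>\<theta>. (\<forall>p. angle A g J\<^sub>0 J\<^sub>1 p = \<theta>) \<and>
    (cos \<theta> \<noteq> 1 \<and> cos \<theta> \<noteq> -1 \<longrightarrow> homotopic_acs A g J\<^sub>0 J\<^sub>1 \<and> define_hyper_kahler A g J\<^sub>0 J\<^sub>1)"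
proof -
  interpret kahler_almost_kahler A g J\<^sub>0 J\<^sub>1
    by unfold_locales (rule assms)+
  obtain \<theta> where \<theta>: "\<And>p. angle A g J\<^sub>0 J\<^sub>1 p = \<theta>"
    using angle_constant by blast
  have "sin \<theta> \<noteq> 0" if "cos \<theta> \<noteq> 1" "cos \<theta> \<noteq> -1"
  proof
    assume "sin \<theta> = 0"
    then have "(cos \<theta>)\<^sup>2 = 1" by (simp add: cos_squared_eq)
    then show False using that by (simp add: power2_eq_1_iff)
  qed
  then show ?thesis
    using \<theta> homotopic[OF \<theta>] hyper_kahler[OF \<theta>] by blast
qed

end
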